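(* Let $X$ be a $\mathrm{GTGS}^0_\gamma(\alpha,\lambda,\delta;\mu)$ random variable on $\mathbb R$ with $\alpha_+,\alpha_-\in(0,1)$ and $\gamma_+,\gamma_-\neq1$. Let $m$ be its L\'evy density, and put $\mu_0=\int_{\{|x|<1\}}x\,m(x)dx$, $\mu_1=\int_{\{|x|>1\}}x\,m(x)dx$. For $z\in\mathbb R$ and $a>0$ write $$(\mp iz)^{a}=|z|^{a}\left(\cos\frac{a\pi}{2}\mp i\sin\frac{a\pi}{2}\,\mathrm{sgn}(z)\right),$$ and set $$\ell(x,y,w)=w^{x/y}\,\frac{\pi}{\sin(-\pi x/y)}\,\frac{1}{y\,\Gamma(1+x)}.$$ Then, for parameters for which all the quantities appearing are well defined and finite (with values at $z=0$ understood as limits), the following hold. (i) If $\gamma_+=\gamma_-=0$, $$\psi_X(z)=\frac{\delta_+}{\alpha_+}\log\!\left(\frac{\lambda_+}{(-iz)^{\alpha_+}+\lambda_+}\right)+\frac{\delta_-}{\alpha_-}\log\!\left(\frac{\lambda_-}{(iz)^{\alpha_-}+\lambda_-}\right)+iz(\mu-\mu_0).$$ (ii) If $\max\{\alpha_++\gamma_+,\alpha_-+\gamma_-\}\in(0,1)$, $$\begin{aligned}\psi_X(z)=\;&\delta_+\Big(\Gamma(-\gamma_+)(-iz)^{\gamma_+}\,{}_2R_1\big(1,-\gamma_+,1,\alpha_+;\tfrac{-\lambda_+}{(-iz)^{\alpha_+}}\big)-\ell(\gamma_+,\alpha_+,\lambda_+)\Big)\\&+\delta_-\Big(\Gamma(-\gamma_-)(iz)^{\gamma_-}\,{}_2R_1\big(1,-\gamma_-,1,\alpha_-;\tfrac{-\lambda_-}{(iz)^{\alpha_-}}\big)-\ell(\gamma_-,\alpha_-,\lambda_-)\Big)+iz(\mu-\mu_0).\end{aligned}$$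 (iii) If $\min\{\alpha_++\gamma_+,\alpha_-+\gamma_-\}\in[1,3)$, $$\begin{aligned}\psi_X(z)=\;&\delta_+\Big(\Gamma(-\gamma_+)(-iz)^{\gamma_+}\,{}_2R_1\big(1,-\gamma_+,1,\alpha_+;\tfrac{-\lambda_+}{(-iz)^{\alpha_+}}\big)-\ell(\gamma_+,\alpha_+,\lambda_+)-iz\,\ell(\gamma_+-1,\alpha_+,\lambda_+)\Big)\\&+\delta_-\Big(\Gamma(-\gamma_-)(iz)^{\gamma_-}\,{}_2R_1\big(1,-\gamma_-,1,\alpha_-;\tfrac{-\lambda_-}{(iz)^{\alpha_-}}\big)-\ell(\gamma_-,\alpha_-,\lambda_-)+iz\,\ell(\gamma_--1,\alpha_-,\lambda_-)\Big)+iz(\mu+\mu_1).\end{aligned}$$ The cases not covered by (i)--(iii) are obtained by combining the expressions for positive and negative parts corresponding to the relevant conditions satisfied by $\alpha_\pm+\gamma_\pm$: $\psi_X(z)=iz\mu+A_+(z)+A_-(z)$, where $A_\pm$ is the $\delta_\pm$-term of the applicable formula, together with $-iz\int_{\{|x|<1,\pm x>0\}}x\,m(x)dx$ in cases (i), (ii), or $+iz\int_{\{|x|>1,\pm x>0\}}x\,m(x)dx$ in case (iii).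
   Context: For $a\in(0,1]$, $E_a(z)=\sum_{k\ge0}z^k/\Gamma(ak+1)$. Let $\alpha=(\alpha_+,\alpha_-)\in(0,1]^2$, $\lambda=(\lambda_+,\lambda_-)\in(0,\infty)^2$, $\delta=(\delta_+,\delta_-)\in[0,\infty)^2\setminus\{(0,0)\}$, $\gamma=(\gamma_+,\gamma_-)\in[0,2)^2$, $\mu\in\mathbb R$. The law $\mathrm{GTGS}^0_\gamma(\alpha,\lambda,\delta;\mu)$ is the infinitely divisible law on $\mathbb R$ with L\'evy triplet $(\mu,0,m(x)dx)$, where $$m(x)=\frac{\delta_+}{x^{1+\gamma_+}}E_{\alpha_+}(-\lambda_+x^{\alpha_+})\mathbf 1_{\{x>0\}}+\frac{\delta_-}{|x|^{1+\gamma_-}}E_{\alpha_-}(-\lambda_-|x|^{\alpha_-})\mathbf 1_{\{x<0\}}.$$ That is, $E[e^{izX}]=e^{\psi_X(z)}$ with $\psi_X(z)=iz\mu+\int_{\mathbb R}(e^{izx}-1-izx\mathbf 1_{\{|x|<1\}})m(x)\,dx$. Logarithms are principal branches. The function ${}_2R_1$ is, for $\tau>0$, $c\notin\mathbb Z_{\le0}$ and $|w|<1$, $${}_2R_1(a,b,c,\tau;w)=\frac{\Gamma(c)}{\Gamma(b)}\sum_{k\ge0}\frac{(a)_k\Gamma(b+\tau k)}{\Gamma(c+\tau k)}\frac{w^k}{k!},\qquad (a)_k=\frac{\Gamma(a+k)}{\Gamma(a)},$$ (defined when the coefficients are finite), extended analytically to $w\in\mathbb C\setminus[1,\infty)$.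 *)

theory Defs
  imports "HOL-Probability.Probability" "HOL-Complex_Analysis.Complex_Analysis"
begin

definition mittag_leffler :: "real \<Rightarrow> 'a::{real_normed_field,banach} \<Rightarrow> 'a" where
  "mittag_leffler a z = (\<Sum>k. z ^ k / of_real (Gamma (a * real k + 1)))"

text \<open>Subscripts \<open>p\<close> and \<open>m\<close> mark the parameters of the positive and of the negative half-line.\<close>

definition gtgs_density ::
    "real \<Rightarrow> real \<Rightarrow> real \<Rightarrow> real \<Rightarrow> real \<Rightarrow> real \<Rightarrow> real \<Rightarrow> real \<Rightarrow> real \<Rightarrow> real" where
  "gtgs_density \<gamma>\<^sub>p \<gamma>\<^sub>m \<alpha>\<^sub>p \<alpha>\<^sub>m lam\<^sub>p lam\<^sub>m \<delta>\<^sub>p \<delta>\<^sub>m x =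
     (if x > 0 then \<delta>\<^sub>p / x powr (1 + \<gamma>\<^sub>p) * mittag_leffler \<alpha>\<^sub>p (- lam\<^sub>p * x powr \<alpha>\<^sub>p)
      else if x < 0 then \<delta>\<^sub>m / \<bar>x\<bar> powr (1 + \<gamma>\<^sub>m) * mittag_leffler \<alpha>\<^sub>m (- lam\<^sub>m * \<bar>x\<bar> powr \<alpha>\<^sub>m)
      else 0)"

text \<open>Levy--Khintchine exponent of the triplet with drift \<open>b\<close> (relative to truncation at
  \<open>\<bar>x\<bar> < 1\<close>), no Gaussian part, and Levy measure of Lebesgue density \<open>m\<close>.\<close>

definition levy_exponent :: "real \<Rightarrow> (real \<Rightarrow> real) \<Rightarrow> real \<Rightarrow> complex" where
  "levy_exponent b m z =
     \<i> * of_real z * of_real b +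
     (LINT x|lborel. (exp (\<i> * of_real z * of_real x) - 1
        - \<i> * of_real z * of_real x * of_bool (\<bar>x\<bar> < 1)) * of_real (m x))"

text \<open>A law is determined by its characteristic function, so infinite divisibility need not be
  required separately.\<close>

definition GTGS0_law ::
    "real \<Rightarrow> real \<Rightarrow> real \<Rightarrow> real \<Rightarrow> real \<Rightarrow> real \<Rightarrow> real \<Rightarrow> real \<Rightarrow> real \<Rightarrow> real measure \<Rightarrow> bool" where
  "GTGS0_law \<gamma>\<^sub>p \<gamma>\<^sub>m \<alpha>\<^sub>p \<alpha>\<^sub>m lam\<^sub>p lam\<^sub>m \<delta>\<^sub>p \<delta>\<^sub>m \<mu> N \<longleftrightarrow>
     real_distribution N \<and>
     (\<forall>z. char N z =
        exp (levy_exponent \<mu> (gtgs_density \<gamma>\<^sub>p \<gamma>\<^sub>m \<alpha>\<^sub>p \<alpha>\<^sub>m lam\<^sub>p lam\<^sub>m \<delta>\<^sub>p \<delta>\<^sub>m) z))"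

definition R21_coeff :: "complex \<Rightarrow> complex \<Rightarrow> complex \<Rightarrow> real \<Rightarrow> nat \<Rightarrow> complex" where
  "R21_coeff a b c \<tau> k =
     Gamma c / Gamma b *
     (pochhammer a k * Gamma (b + of_real \<tau> * of_nat k) / Gamma (c + of_real \<tau> * of_nat k)) / fact k"

text \<open>HOL's \<open>Gamma\<close> is total (zero at its poles), so finiteness of the coefficients has to be
  stated separately. A pole of the denominator \<open>Gamma (c + \<tau> k)\<close> is harmless: there both
  \<open>1 / Gamma\<close> and HOL's quotient are zero.\<close>

definition R21_defined :: "complex \<Rightarrow> complex \<Rightarrow> real \<Rightarrow> bool" where
  "R21_defined b c \<tau> \<longleftrightarrow>
     \<tau> > 0 \<and> c \<notin> \<int>\<^sub>\<le>\<^sub>0 \<and> (\<forall>k::nat. b + of_real \<tau> * of_nat k \<notin> \<int>\<^sub>\<le>\<^sub>0)"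

text \<open>The value at \<open>w\<close> of the analytic extension of the series from the unit disc to the plane cut
  along \<open>[1,\<infinity>)\<close>; it is unique because the cut plane is connected.\<close>

definition R21 :: "complex \<Rightarrow> complex \<Rightarrow> complex \<Rightarrow> real \<Rightarrow> complex \<Rightarrow> complex" where
  "R21 a b c \<tau> w =
     (THE v. \<exists>f. f holomorphic_on (- complex_of_real ` {1..}) \<and>
        (\<forall>u. norm u < 1 \<longrightarrow> (\<lambda>k. R21_coeff a b c \<tau> k * u ^ k) sums f u) \<and> v = f w)"

text \<open>In what follows \<open>s = 1\<close> refers to the positive and \<open>s = -1\<close> to the negative half-line;
  \<open>iz_pow s a z\<close> is the power \<open>(- s \<i> z)\<^sup>a\<close>.\<close>

definition iz_pow :: "real \<Rightarrow> real \<Rightarrow> real \<Rightarrow> complex" where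
  "iz_pow s a z =
     of_real (\<bar>z\<bar> powr a) *
     (of_real (cos (a * pi / 2)) - of_real s * \<i> * of_real (sin (a * pi / 2)) * of_real (sgn z))"

definition ell :: "real \<Rightarrow> real \<Rightarrow> real \<Rightarrow> real" where
  "ell x y w = w powr (x / y) * (pi / sin (- pi * x / y)) * (1 / (y * Gamma (1 + x)))"

definition ell_defined :: "real \<Rightarrow> real \<Rightarrow> bool" where
  "ell_defined x y \<longleftrightarrow> sin (- pi * x / y) \<noteq> 0 \<and> 1 + x \<notin> \<int>\<^sub>\<le>\<^sub>0"

definition term_log :: "real \<Rightarrow> real \<Rightarrow> real \<Rightarrow> real \<Rightarrow> real \<Rightarrow> complex" where
  "term_log s \<alpha> lam \<delta> z =
     of_real (\<delta> / \<alpha>) * Ln (of_real lam / (iz_pow s \<alpha> z + of_real lam))"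

definition term_low :: "real \<Rightarrow> real \<Rightarrow> real \<Rightarrow> real \<Rightarrow> real \<Rightarrow> real \<Rightarrow> complex" where
  "term_low s \<gamma> \<alpha> lam \<delta> z =
     of_real \<delta> *
     (of_real (Gamma (- \<gamma>)) * iz_pow s \<gamma> z
        * R21 1 (of_real (- \<gamma>)) 1 \<alpha> (of_real (- lam) / iz_pow s \<alpha> z)
      - of_real (ell \<gamma> \<alpha> lam))"

definition term_high :: "real \<Rightarrow> real \<Rightarrow> real \<Rightarrow> real \<Rightarrow> real \<Rightarrow> real \<Rightarrow> complex" where
  "term_high s \<gamma> \<alpha> lam \<delta> z =
     of_real \<delta> *
     (of_real (Gamma (- \<gamma>)) * iz_pow s \<gamma> z
        * R21 1 (of_real (- \<gamma>)) 1 \<alpha> (of_real (- lam) / iz_pow s \<alpha> z)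
      - of_real (ell \<gamma> \<alpha> lam)
      - of_real s * \<i> * of_real z * of_real (ell (\<gamma> - 1) \<alpha> lam))"

definition low_defined :: "real \<Rightarrow> real \<Rightarrow> bool" where
  "low_defined \<gamma> \<alpha> \<longleftrightarrow>
     - \<gamma> \<notin> \<int>\<^sub>\<le>\<^sub>0 \<and> R21_defined (of_real (- \<gamma>)) 1 \<alpha> \<and> ell_defined \<gamma> \<alpha>"

definition high_defined :: "real \<Rightarrow> real \<Rightarrow> bool" where
  "high_defined \<gamma> \<alpha> \<longleftrightarrow> low_defined \<gamma> \<alpha> \<and> ell_defined (\<gamma> - 1) \<alpha>"

text \<open>The full contribution of one half-line, by the regime its own parameters are in.\<close>

definition half_line_part ::
    "real \<Rightarrow> (real \<Rightarrow> real) \<Rightarrow> real \<Rightarrow> real \<Rightarrow> real \<Rightarrow> real \<Rightarrow> real \<Rightarrow> complex" where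
  "half_line_part s m \<gamma> \<alpha> lam \<delta> z =
     (if \<gamma> = 0 then
        term_log s \<alpha> lam \<delta> z
        - \<i> * of_real z * of_real (LINT x:{x. \<bar>x\<bar> < 1 \<and> s * x > 0}|lborel. x * m x)
      else if \<alpha> + \<gamma> < 1 then
        term_low s \<gamma> \<alpha> lam \<delta> z
        - \<i> * of_real z * of_real (LINT x:{x. \<bar>x\<bar> < 1 \<and> s * x > 0}|lborel. x * m x)
      else
        term_high s \<gamma> \<alpha> lam \<delta> z
        + \<i> * of_real z * of_real (LINT x:{x. \<bar>x\<bar> > 1 \<and> s * x > 0}|lborel. x * m x))"

definition half_line_defined :: "real \<Rightarrow> real \<Rightarrow> bool" where
  "half_line_defined \<gamma> \<alpha> \<longleftrightarrow>
     (if \<gamma> = 0 then True else if \<alpha> + \<gamma> < 1 then low_defined \<gamma> \<alpha> else high_defined \<gamma> \<alpha>)"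

text \<open>Equality of functions on the real line when the right-hand side at \<open>0\<close> is read as a limit
  (its argument of \<open>R21\<close> is infinite there).\<close>

definition eq_with_limit_at_0 :: "(real \<Rightarrow> complex) \<Rightarrow> (real \<Rightarrow> complex) \<Rightarrow> bool" where
  "eq_with_limit_at_0 \<psi> F \<longleftrightarrow> (\<forall>z. z \<noteq> 0 \<longrightarrow> \<psi> z = F z) \<and> (F \<longlongrightarrow> \<psi> 0) (at 0)"

end

theory Submission
  imports Defs
begin

text \<open>
  Fix one half-line of sign \<open>s\<close>, write \<open>u(x) = E\<^sub>a(- lam x\<^sup>a)\<close>, \<open>W\<^sub>g(x) = x\<^sup>-\<^sup>g\<^sup>-\<^sup>1 u(x)\<close>, and put
  \<open>\<zeta> = - s \<i> z\<close>. Up to a linear term in \<open>z\<close> the half-line contributes \<open>\<delta> J(\<zeta>)\<close>, where \<open>J\<close> is the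
  integral of \<open>(exp(- \<zeta> x) - 1) W\<^sub>\<gamma>(x)\<close> or of \<open>(exp(- \<zeta> x) - 1 + \<zeta> x) W\<^sub>\<gamma>(x)\<close> over \<open>x > 0\<close>, whichever
  converges. Such integrals are continuous for \<open>Re \<zeta> \<ge> 0\<close> and holomorphic for \<open>Re \<zeta> > 0\<close>, so they can be
  identified for large real \<open>\<zeta>\<close> and carried to the imaginary axis (\<open>eq_of_derivative_eq_at_large_reals\<close>).

  For large real \<open>\<zeta>\<close> the Mittag-Leffler series may be integrated term by term once enough derivatives have
  removed the compensators (\<open>G_sums\<close>). The result is the termwise derivative of
  \<open>F(\<zeta>) = \<Gamma>(- \<gamma>) \<zeta>\<^sup>\<gamma> R21(- lam / \<zeta>\<^sup>a)\<close>. Hence \<open>J - F\<close> is a constant, or an affine function after two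
  derivatives. Its coefficients are found at \<open>\<zeta> \<rightarrow> 0\<close>, where \<open>J\<close> and, in the second case, also its
  derivative vanish: they are the limits of \<open>F\<close> for the parameters \<open>\<gamma>\<close> and \<open>\<gamma> - 1\<close>, up to sign. To compute
  these, one needs \<open>R21\<close> near infinity, far outside the disc of its series. All but finitely many coefficients are multiples of Beta
  integrals, and summing the series under the integral gives an explicit continuation to the cut plane
  (\<open>R_holomorphic\<close>, \<open>R21_eq_R\<close>); after rescaling, the limit becomes a Mellin integral of \<open>1 / (1 + lam v\<^sup>a)\<close>,
  and the reflection formula gives exactly \<open>ell\<close> (\<open>F_tendsto_ell\<close>). For \<open>\<gamma> = 0\<close> the series in question is
  geometric and \<open>F\<close> is replaced by a logarithm.

  The convergence of the integrals at infinity rests on the decay of \<open>u\<close>, which its alternating series does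
  not show. It comes from the Volterra equation of \<open>u\<close>: the decreasing kernel forces \<open>u > 0\<close> (\<open>u_pos\<close>), and
  positivity turns the equation into the bound \<open>O(x\<^sup>1\<^sup>-\<^sup>a)\<close> on the integral of \<open>u\<close> over \<open>(0, x)\<close> (\<open>u_mean_bound\<close>).
\<close>

section \<open>Integrals depending on a complex parameter\<close>

text \<open>Dominated convergence along an arbitrary approach to a point of a metric space. The bound is
  only asked for on \<open>S\<close>; this is what permits limits at boundary points of the closed half-plane.\<close>

lemma tendsto_integral_dominated_within:
  fixes f :: "'p::metric_space \<Rightarrow> 'a \<Rightarrow> 'b::{banach,second_countable_topology}"
  assumes lim: "\<And>x. x \<in> space M \<Longrightarrow> ((\<lambda>p. f p x) \<longlongrightarrow> g x) (at a within S)"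
    and meas: "\<And>p. p \<in> S \<Longrightarrow> f p \<in> borel_measurable M" "g \<in> borel_measurable M"
    and bound: "\<And>p x. p \<in> S \<Longrightarrow> x \<in> space M \<Longrightarrow> norm (f p x) \<le> h x"
    and h: "integrable M h"
  shows "((\<lambda>p. LINT x|M. f p x) \<longlongrightarrow> (LINT x|M. g x)) (at a within S)"
  unfolding tendsto_at_iff_sequentially
proof (intro allI impI)
  fix X :: "nat \<Rightarrow> 'p" assume X: "\<forall>i. X i \<in> S - {a}" "X \<longlonglongrightarrow> a"
  show "((\<lambda>p. LINT x|M. f p x) \<circ> X) \<longlonglongrightarrow> (LINT x|M. g x)"
    unfolding o_def
  proof (rule integral_dominated_convergence[where w = h])
    show "AE x in M. (\<lambda>i. f (X i) x) \<longlonglongrightarrow> g x"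
    proof (rule AE_I2)
      fix x assume "x \<in> space M"
      from lim[OF this] X show "(\<lambda>i. f (X i) x) \<longlonglongrightarrow> g x"
        unfolding tendsto_at_iff_sequentially o_def by blast
    qed
  qed (use meas h X bound in auto)
qed

text \<open>The mean value inequality on the convex set \<open>S\<close> turns the bound on the derivative into the
  same bound on all difference quotients, so that dominated convergence applies to them.\<close>

lemma has_field_derivative_integral_dominated:
  fixes f f' :: "'a \<Rightarrow> complex \<Rightarrow> complex"
  assumes S: "open S" "convex S" "z \<in> S"
    and int: "\<And>w. w \<in> S \<Longrightarrow> integrable M (\<lambda>x. f x w)"
    and der: "\<And>x w. x \<in> space M \<Longrightarrow> w \<in> S \<Longrightarrow> (f x has_field_derivative f' x w) (at w)"
    and meas: "(\<lambda>x. f' x z) \<in> borel_measurable M"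
    and bound: "\<And>x w. x \<in> space M \<Longrightarrow> w \<in> S \<Longrightarrow> norm (f' x w) \<le> h x"
    and h: "integrable M h"
  shows "((\<lambda>w. LINT x|M. f x w) has_field_derivative (LINT x|M. f' x z)) (at z)"
proof -
  have "((\<lambda>w. LINT x|M. (f x w - f x z) / (w - z)) \<longlongrightarrow> (LINT x|M. f' x z)) (at z within S)"
  proof (rule tendsto_integral_dominated_within[where h = h])
    fix x assume x: "x \<in> space M"
    show "((\<lambda>w. (f x w - f x z) / (w - z)) \<longlongrightarrow> f' x z) (at z within S)"
      using has_field_derivative_at_within[OF der[OF x S(3)]]
      by (simp add: has_field_derivative_iff)
    fix w assume w: "w \<in> S"
    have "norm (f x w - f x z) \<le> h x * norm (w - z)"
      by (rule field_differentiable_bound[OF S(2) _ _ w S(3)])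
         (use der bound x in \<open>auto intro: has_field_derivative_at_within\<close>)
    moreover have "0 \<le> h x" using bound[OF x w] by (meson norm_ge_zero order_trans)
    ultimately show "norm ((f x w - f x z) / (w - z)) \<le> h x"
      by (cases "w = z") (auto simp: norm_divide field_simps)
  next
    fix w assume w: "w \<in> S"
    show "(\<lambda>x. (f x w - f x z) / (w - z)) \<in> borel_measurable M"
      using int[OF w] int[OF S(3)] by (auto intro!: borel_measurable_divide borel_measurable_diff)
  qed (use meas h in auto)
  moreover have "\<forall>\<^sub>F w in at z within S. (LINT x|M. (f x w - f x z) / (w - z))
      = ((LINT x|M. f x w) - (LINT x|M. f x z)) / (w - z)"
    unfolding eventually_at_filter
    by (intro always_eventually) (use int S(3) in simp)
  ultimately have "((\<lambda>w. ((LINT x|M. f x w) - (LINT x|M. f x z)) / (w - z)) \<longlongrightarrow> (LINT x|M. f' x z)) (at z within S)"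
    by (rule Lim_transform_eventually)
  then show ?thesis
    unfolding has_field_derivative_iff at_within_open[OF S(3) S(1)] .
qed

abbreviation right_half_plane :: "complex set" where
  "right_half_plane \<equiv> {\<zeta>. 0 < Re \<zeta>}"

lemma open_right_half_plane: "open right_half_plane"
  by (simp add: open_halfspace_Re_gt)

lemma connected_right_half_plane: "connected right_half_plane"
  by (intro convex_connected convex_halfspace_Re_gt)

text \<open>The identity theorem applied to the derivative. Series expansions of the integrals below are
  available only for large real arguments; this lemma carries what they give to the half-plane.\<close>

lemma constant_of_deriv_zero_at_large_reals:
  fixes D :: "complex \<Rightarrow> complex"
  assumes hol: "D holomorphic_on right_half_plane"
    and R: "R > 0" and der: "\<And>t. t > R \<Longrightarrow> deriv D (complex_of_real t) = 0"
  obtains c where "\<And>\<zeta>. Re \<zeta> > 0 \<Longrightarrow> D \<zeta> = c"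
proof -
  have hol': "deriv D holomorphic_on right_half_plane"
    using hol open_right_half_plane by (rule holomorphic_deriv)
  have "complex_of_real (R + 1) islimpt (complex_of_real ` {R<..})"
    unfolding islimpt_sequential
  proof (intro exI[of _ "\<lambda>n. complex_of_real (R + 1 + inverse (real (Suc n)))"] conjI allI)
    show "(\<lambda>n. complex_of_real (R + 1 + inverse (real (Suc n)))) \<longlonglongrightarrow> complex_of_real (R + 1)"
      by (intro tendsto_of_real) (rule tendsto_eq_intros LIMSEQ_inverse_real_of_nat refl | simp)+
  qed (auto simp del: of_real_add of_nat_Suc simp: add_pos_pos)
  from analytic_continuation[OF hol' open_right_half_plane connected_right_half_plane _ _ this]
  have "deriv D \<zeta> = 0" if "Re \<zeta> > 0" for \<zeta>
    using R der that by force
  moreover have "(D has_field_derivative deriv D \<zeta>) (at \<zeta>)" if "Re \<zeta> > 0" for \<zeta>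
    using holomorphic_derivI[OF hol open_right_half_plane, of \<zeta>] that by simp
  ultimately have "D constant_on right_half_plane"
    by (intro has_field_derivative_0_imp_constant_on open_right_half_plane connected_right_half_plane)
       (metis mem_Collect_eq)
  then show ?thesis
    using that by (auto simp: constant_on_def)
qed

section \<open>Growth of the Mittag-Leffler coefficients\<close>

text \<open>Restrict Euler's integral to the interval \<open>[A, A + 1]\<close>. Since \<open>A\<close> is arbitrary, the
  Gamma function outgrows every exponential, which is all that the convergence of the
  Mittag-Leffler series requires.\<close>

lemma Gamma_lower_bound:
  fixes A s :: real
  assumes "A > 0" "s \<ge> 0"
  shows "exp (- A - 1) * A powr s \<le> Gamma (s + 1)"
proof -
  have "exp (- A - 1) * A powr s = integral {A..A + 1} (\<lambda>t. exp (- A - 1) * A powr s)"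
    by simp
  also have "\<dots> \<le> integral {A..A + 1} (\<lambda>t. t powr (s + 1 - 1) / exp t)"
  proof (rule integral_le)
    show "(\<lambda>t. t powr (s + 1 - 1) / exp t) integrable_on {A..A + 1}"
      using assms by (intro integrable_continuous_interval continuous_intros) auto
    fix t assume t: "t \<in> {A..A + 1}"
    have "exp (- A - 1) * A powr s \<le> exp (- t) * t powr s"
      using t assms by (intro mult_mono powr_mono2) auto
    then show "exp (- A - 1) * A powr s \<le> t powr (s + 1 - 1) / exp t"
      by (simp add: exp_minus field_simps)
  qed auto
  also have "\<dots> \<le> integral {0..} (\<lambda>t. t powr (s + 1 - 1) / exp t)"
  proof (rule integral_subset_le)
    show "(\<lambda>t. t powr (s + 1 - 1) / exp t) integrable_on {A..A + 1}"
      using assms by (intro integrable_continuous_interval continuous_intros) auto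
    show "(\<lambda>t. t powr (s + 1 - 1) / exp t) integrable_on {0..}"
      using Gamma_integral_real[of "s + 1"] assms by (auto simp: integrable_on_def)
  qed (use assms in auto)
  also have "\<dots> = Gamma (s + 1)"
    using Gamma_integral_real[of "s + 1"] assms by (auto simp: integral_unique)
  finally show ?thesis .
qed

lemma summable_mittag_leffler:
  fixes c a :: real
  assumes a: "a > 0"
  shows "summable (\<lambda>k. c ^ k / Gamma (a * real k + 1))"
proof -
  \<comment> \<open>With this choice the terms are dominated by a geometric series of ratio 1/2.\<close>
  define A where "A = (2 * \<bar>c\<bar> + 1) powr (1 / a)"
  have A: "A > 0" "A powr a = 2 * \<bar>c\<bar> + 1"
    using a by (auto simp: A_def powr_powr)
  show ?thesis
  proof (rule summable_comparison_test'[where N = 0])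
    show "summable (\<lambda>k. exp (A + 1) * (1 / 2) ^ k :: real)"
      by (intro summable_mult summable_geometric) auto
    fix k :: nat
    have G: "exp (- A - 1) * A powr (a * real k) \<le> Gamma (a * real k + 1)"
      using A a by (intro Gamma_lower_bound) auto
    have Ap: "A powr (a * real k) = (2 * \<bar>c\<bar> + 1) ^ k"
      using A powr_powr[of A a "real k"] by (simp add: powr_realpow)
    have "norm (c ^ k / Gamma (a * real k + 1)) = \<bar>c\<bar> ^ k / Gamma (a * real k + 1)"
      using a by (simp add: power_abs Gamma_real_pos add_nonneg_pos order_less_imp_le)
    also have "\<dots> \<le> \<bar>c\<bar> ^ k / (exp (- A - 1) * (2 * \<bar>c\<bar> + 1) ^ k)"
      using G Ap a by (intro divide_left_mono) (auto intro!: mult_pos_pos Gamma_real_pos add_nonneg_pos)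
    also have "\<dots> = exp (A + 1) * (\<bar>c\<bar> / (2 * \<bar>c\<bar> + 1)) ^ k"
      using exp_minus[of "A + 1"] by (simp add: power_divide field_simps)
    also have "\<dots> \<le> exp (A + 1) * (1 / 2) ^ k"
      by (intro mult_left_mono power_mono) (auto simp: field_simps)
    finally show "norm (c ^ k / Gamma (a * real k + 1)) \<le> exp (A + 1) * (1 / 2) ^ k" .
  qed
qed

lemma continuous_mittag_leffler:
  fixes a :: real
  assumes "a > 0"
  shows "continuous_on UNIV (mittag_leffler a :: real \<Rightarrow> real)"
proof -
  have "isCont (\<lambda>z. \<Sum>k. (1 / Gamma (a * real k + 1)) * z ^ k) z" for z :: real
    by (rule isCont_powser[where K = "\<bar>z\<bar> + 1"])
       (use summable_mittag_leffler[OF assms, of "\<bar>z\<bar> + 1"] in auto)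
  then show ?thesis
    unfolding continuous_on_eq_continuous_at[OF open_UNIV] mittag_leffler_def by simp
qed

lemma set_integral_sums:
  fixes f :: "nat \<Rightarrow> 'a \<Rightarrow> 'b::{banach,second_countable_topology}"
  assumes int: "\<And>k. set_integrable M A (f k)"
    and sums: "\<And>x. x \<in> A \<Longrightarrow> (\<lambda>k. f k x) sums g x"
    and abs: "\<And>x. x \<in> A \<Longrightarrow> summable (\<lambda>k. norm (f k x))"
    and summable: "summable (\<lambda>k. LINT x:A|M. norm (f k x))"
  shows "set_integrable M A g" "(\<lambda>k. LINT x:A|M. f k x) sums (LINT x:A|M. g x)"
proof -
  let ?F = "\<lambda>k x. indicator A x *\<^sub>R f k x"
  have g: "(\<Sum>k. ?F k x) = indicator A x *\<^sub>R g x" for x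
    using sums[of x] by (cases "x \<in> A") (auto simp: sums_iff)
  have 1: "integrable M (?F k)" for k
    using int[of k] by (simp add: set_integrable_def)
  have 2: "AE x in M. summable (\<lambda>k. norm (?F k x))"
    using abs by (intro AE_I2) (auto simp: indicator_def)
  have 3: "summable (\<lambda>k. LINT x|M. norm (?F k x))"
    using summable by (simp add: set_lebesgue_integral_def)
  show "set_integrable M A g"
    using integrable_suminf[OF 1 2 3] by (simp add: g set_integrable_def)
  show "(\<lambda>k. LINT x:A|M. f k x) sums (LINT x:A|M. g x)"
    using sums_integral[OF 1 2 3] by (simp add: g set_lebesgue_integral_def)
qed

text \<open>For nonnegative integrands, an evaluation in the Henstock sense carries over to the Lebesgue
  integral; the Euler integrals and the integrals of powers below are obtained in this way.\<close>

lemma set_integral_of_nonneg_has_integral: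
  fixes f :: "real \<Rightarrow> real"
  assumes f: "(f has_integral r) S" "f \<in> borel_measurable borel" and S: "S \<in> sets borel"
    and nonneg: "\<And>x. x \<in> S \<Longrightarrow> 0 \<le> f x"
  shows "set_integrable lborel S f" "(LINT x:S|lborel. f x) = r"
proof -
  have "f absolutely_integrable_on S"
    using f nonneg by (subst absolutely_integrable_on_iff_nonneg) auto
  then show *: "set_integrable lborel S f"
    unfolding set_integrable_def using f S by (subst (asm) integrable_completion) auto
  show "(LINT x:S|lborel. f x) = r"
    using set_borel_integral_eq_integral(2)[OF *] f by (simp add: integral_unique)
qed

lemma Beta_set_integral:
  fixes p q :: real
  assumes "p > 0" "q > 0"
  shows "set_integrable lborel {0<..<1} (\<lambda>t. t powr (p - 1) * (1 - t) powr (q - 1))"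
    and "(LINT t:{0<..<1}|lborel. t powr (p - 1) * (1 - t) powr (q - 1)) = Beta p q"
proof -
  have "((\<lambda>t. t powr (p - 1) * (1 - t) powr (q - 1)) has_integral Beta p q) {0<..<1}"
    using has_integral_Beta_real[OF assms] by (simp add: has_integral_Icc_iff_Ioo)
  from set_integral_of_nonneg_has_integral[OF this]
  show "set_integrable lborel {0<..<1} (\<lambda>t. t powr (p - 1) * (1 - t) powr (q - 1))"
    and "(LINT t:{0<..<1}|lborel. t powr (p - 1) * (1 - t) powr (q - 1)) = Beta p q"
    by auto
qed

section \<open>Positivity and decay of the relaxation function\<close>

text \<open>The parameters of one half-line. The function \<open>u\<close> below solves the fractional relaxation
  equation \<open>D\<^sup>a u = - lam u\<close>, \<open>u(0) = 1\<close>, whence the name.\<close>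

locale relaxation =
  fixes a lam :: real
  assumes a: "0 < a" "a < 1" and lam: "0 < lam"
begin

definition u :: "real \<Rightarrow> real" where
  "u x = mittag_leffler a (- lam * x powr a)"

lemma u_sums:
  assumes "x \<ge> 0"
  shows "(\<lambda>k. (- lam * x powr a) ^ k / Gamma (a * real k + 1)) sums u x"
  using summable_mittag_leffler[OF a(1), of "- lam * x powr a"]
  by (simp add: u_def mittag_leffler_def summable_sums)

lemma u_0: "u 0 = 1"
proof -
  have "(\<lambda>k. (- lam * 0 powr a) ^ k / Gamma (a * real k + 1)) sums 1"
    using powser_sums_zero[of "\<lambda>k. 1 / Gamma (a * real k + 1)"] by simp
  with u_sums[of 0] show ?thesis
    by (metis order_refl sums_unique2)
qed

lemma continuous_on_u [continuous_intros]: "continuous_on {0..} u"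
  unfolding u_def
  by (rule continuous_on_compose2[OF continuous_mittag_leffler[OF a(1)]])
     (use a in \<open>auto intro!: continuous_intros continuous_on_powr'\<close>)

lemma measurable_u [measurable]: "u \<in> borel_measurable borel"
proof -
  have [measurable]: "(mittag_leffler a :: real \<Rightarrow> real) \<in> borel_measurable borel"
    by (intro borel_measurable_continuous_onI continuous_mittag_leffler a)
  show ?thesis unfolding u_def by measurable
qed

text \<open>The integrated relaxation equation, written on the unit interval. Termwise it is Euler's Beta
  integral, which maps the \<open>k\<close>-th term of the series to a multiple of the term of index \<open>k + 1\<close>.\<close>

lemma u_Volterra_unit:
  assumes x: "x \<ge> 0"
  shows "set_integrable lborel {0<..<1} (\<lambda>t. (1 - t) powr (a - 1) * u (x * t))"
    and "u x = 1 - lam / Gamma a * (x powr a * (LINT t:{0<..<1}|lborel. (1 - t) powr (a - 1) * u (x * t)))"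
proof -
  define c where "c = - lam * x powr a"
  define G where "G k = Gamma (a * real k + 1)" for k
  let ?f = "\<lambda>k t. c ^ k / G k * (t powr (a * real k + 1 - 1) * (1 - t) powr (a - 1))"
  have arg: "a * real k + 1 > 0" for k
    using a by (auto intro!: add_nonneg_pos)
  have G: "G k > 0" "Gamma a > 0" for k
    using a arg[of k] by (auto simp: G_def intro!: Gamma_real_pos)
  note B = Beta_set_integral[OF arg a(1)]
  have Beta: "Beta (a * real k + 1) a = G k * Gamma a / G (Suc k)" for k
    by (simp add: Beta_def G_def algebra_simps)
  \<comment> \<open>Integration is over the open interval because 0 powr 0 is 0 here.\<close>
  have pw: "c ^ k * t powr (a * real k) = (- lam * (x * t) powr a) ^ k" if "t \<in> {0<..<1}" for k t
  proof -
    have "t powr (a * real k) = (t powr a) ^ k"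
      using that powr_powr[of t a "real k"] by (simp add: powr_realpow)
    then show ?thesis
      using that x by (simp add: c_def powr_mult power_mult_distrib[symmetric] mult.assoc)
  qed
  have sm: "summable (\<lambda>k. d ^ k / G k)" for d
    unfolding G_def by (rule summable_mittag_leffler[OF a(1)])
  have int: "set_integrable lborel {0<..<1} (?f k)" for k
    using B(1) by (intro set_integrable_mult_right) auto
  have eq: "?f k t = (1 - t) powr (a - 1) * ((- lam * (x * t) powr a) ^ k / G k)" if "t \<in> {0<..<1}" for k t
    using pw[OF that, of k] by simp
  have sums: "(\<lambda>k. ?f k t) sums ((1 - t) powr (a - 1) * u (x * t))" if "t \<in> {0<..<1}" for t
    unfolding eq[OF that] unfolding G_def using that x by (intro sums_mult u_sums) auto
  have abs: "summable (\<lambda>k. norm (?f k t))" if "t \<in> {0<..<1}" for t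
  proof -
    have "norm (?f k t) = (1 - t) powr (a - 1) * (\<bar>lam * (x * t) powr a\<bar> ^ k / G k)" for k
      unfolding eq[OF that] using G(1)[of k] by (simp add: abs_mult power_abs)
    then show ?thesis using sm by (simp only:) (intro summable_mult, auto)
  qed
  have "(LINT t:{0<..<1}|lborel. norm (?f k t)) = \<bar>c\<bar> ^ k * Gamma a / G (Suc k)" for k
  proof -
    have "(LINT t:{0<..<1}|lborel. norm (?f k t)) = \<bar>c ^ k / G k\<bar> * Beta (a * real k + 1) a"
      using B(2)[of k] by (simp add: abs_mult)
    also have "\<dots> = \<bar>c\<bar> ^ k * Gamma a / G (Suc k)"
      unfolding Beta using G(1)[of k] G(2) by (simp add: abs_mult power_abs)
    finally show ?thesis .
  qed
  moreover have "summable (\<lambda>k. \<bar>c\<bar> ^ k * Gamma a / G (Suc k))"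
  proof (rule summable_comparison_test')
    show "summable (\<lambda>k. Gamma a * ((\<bar>c\<bar> + 1) ^ Suc k / G (Suc k)))"
      using sm[of "\<bar>c\<bar> + 1"] by (intro summable_mult) (subst summable_Suc_iff)
    fix k :: nat
    have "\<bar>c\<bar> ^ k \<le> (\<bar>c\<bar> + 1) ^ Suc k"
      using mult_mono[of 1 "\<bar>c\<bar> + 1" "\<bar>c\<bar> ^ k" "(\<bar>c\<bar> + 1) ^ k"] by (simp add: power_mono)
    then have "Gamma a * (\<bar>c\<bar> ^ k / G (Suc k)) \<le> Gamma a * ((\<bar>c\<bar> + 1) ^ Suc k / G (Suc k))"
      using G(1)[of "Suc k"] G(2) by (intro divide_right_mono mult_left_mono) auto
    then show "norm (\<bar>c\<bar> ^ k * Gamma a / G (Suc k)) \<le> Gamma a * ((\<bar>c\<bar> + 1) ^ Suc k / G (Suc k))"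
      using G(1)[of "Suc k"] G(2) by (simp add: abs_mult mult_ac)
  qed
  ultimately have summ: "summable (\<lambda>k. LINT t:{0<..<1}|lborel. norm (?f k t))" by simp
  note S = set_integral_sums[OF int sums abs summ]
  let ?I = "LINT t:{0<..<1}|lborel. (1 - t) powr (a - 1) * u (x * t)"
  show "set_integrable lborel {0<..<1} (\<lambda>t. (1 - t) powr (a - 1) * u (x * t))"
    by (rule S(1))
  have "(LINT t:{0<..<1}|lborel. ?f k t) = c ^ k * Gamma a / G (Suc k)" for k
    using B(2)[of k] G(1)[of k] by (simp add: Beta)
  with S(2) have "(\<lambda>k. c ^ k * Gamma a / G (Suc k)) sums ?I" by simp
  from sums_mult[OF this, of "c / Gamma a"]
  have "(\<lambda>k. c ^ Suc k / G (Suc k)) sums (c / Gamma a * ?I)"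
    using G(2) by simp
  then have "(\<lambda>k. c ^ k / G k) sums (c / Gamma a * ?I + 1)"
    using sums_Suc_iff[of "\<lambda>k. c ^ k / G k"] by (simp add: G_def)
  with u_sums[OF x] have "u x = c / Gamma a * ?I + 1"
    unfolding c_def G_def by (rule sums_unique2)
  then show "u x = 1 - lam / Gamma a * (x powr a * ?I)"
    by (simp add: c_def)
qed

lemma u_Volterra:
  assumes x: "x > 0"
  shows "set_integrable lborel {0<..<x} (\<lambda>y. (x - y) powr (a - 1) * u y)"
    and "u x = 1 - lam / Gamma a * (LINT y:{0<..<x}|lborel. (x - y) powr (a - 1) * u y)"
proof -
  let ?f = "\<lambda>y. indicator {0<..<x} y *\<^sub>R ((x - y) powr (a - 1) * u y)"
  have eq: "?f (0 + x * t) = x powr (a - 1) * (indicator {0<..<1} t *\<^sub>R ((1 - t) powr (a - 1) * u (x * t)))" for t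
  proof -
    have "indicator {0<..<x} (x * t) = (indicator {0<..<1} t :: real)"
      using x by (auto simp: indicator_def zero_less_mult_iff)
    moreover have "(x - x * t) powr (a - 1) = x powr (a - 1) * (1 - t) powr (a - 1)" if "t \<in> {0<..<1}"
      using x that by (subst powr_mult[symmetric]) (auto simp: algebra_simps)
    ultimately show ?thesis by (auto simp: indicator_def)
  qed
  have "integrable lborel (\<lambda>t. ?f (0 + x * t))"
    unfolding eq using u_Volterra_unit(1)[of x] x by (simp add: set_integrable_def)
  then show "set_integrable lborel {0<..<x} (\<lambda>y. (x - y) powr (a - 1) * u y)"
    using lborel_integrable_real_affine_iff[of x ?f 0] x by (simp add: set_integrable_def)
  have "(LINT y|lborel. ?f y) = x * (x powr (a - 1) * (LINT t:{0<..<1}|lborel. (1 - t) powr (a - 1) * u (x * t)))"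
    using lborel_integral_real_affine[of x ?f 0] x unfolding eq
    by (simp add: set_lebesgue_integral_def)
  also have "\<dots> = x powr a * (LINT t:{0<..<1}|lborel. (1 - t) powr (a - 1) * u (x * t))"
    using x by (simp add: powr_diff)
  finally show "u x = 1 - lam / Gamma a * (LINT y:{0<..<x}|lborel. (x - y) powr (a - 1) * u y)"
    using u_Volterra_unit(2)[of x] x by (simp add: set_lebesgue_integral_def)
qed

lemma kernel_integral:
  assumes "c < x"
  shows "set_integrable lborel {c<..<x} (\<lambda>y. (x - y) powr (a - 1))"
    and "(LINT y:{c<..<x}|lborel. (x - y) powr (a - 1)) = (x - c) powr a / a"
proof -
  let ?f = "\<lambda>y. indicator {c<..<x} y *\<^sub>R (x - y) powr (a - 1)"
  have "((\<lambda>t. t powr (a - 1)) has_integral ((x - c) powr a / a)) {0<..<x - c}"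
    using has_integral_powr_from_0[of "a - 1" "x - c"] a assms
    by (simp add: has_integral_Icc_iff_Ioo)
  from set_integral_of_nonneg_has_integral[OF this]
  have *: "set_integrable lborel {0<..<x - c} (\<lambda>t. t powr (a - 1))"
    "(LINT t:{0<..<x - c}|lborel. t powr (a - 1)) = (x - c) powr a / a" by auto
  have eq: "?f (x + (- 1) * t) = indicator {0<..<x - c} t *\<^sub>R t powr (a - 1)" for t
    by (auto simp: indicator_def)
  show "set_integrable lborel {c<..<x} (\<lambda>y. (x - y) powr (a - 1))"
    using lborel_integrable_real_affine_iff[of "-1" ?f x] *(1) unfolding eq
    by (simp add: set_integrable_def)
  show "(LINT y:{c<..<x}|lborel. (x - y) powr (a - 1)) = (x - c) powr a / a"
    using lborel_integral_real_affine[of "-1" ?f x] *(2) unfolding eq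
    by (simp add: set_lebesgue_integral_def)
qed

text \<open>At the first zero \<open>x0\<close>, compare the Volterra equations at \<open>x0\<close> and at an earlier point \<open>x1\<close>.
  The kernel \<open>s\<^sup>a\<^sup>-\<^sup>1\<close> decreases, so the memory of \<open>[0, x1]\<close> counts less at \<open>x0\<close> than at \<open>x1\<close>;
  only the contribution of \<open>[x1, x0]\<close> can push \<open>u\<close> down. If \<open>x1\<close> maximises \<open>u\<close> over a short
  interval before \<open>x0\<close>, that contribution is too small to bring \<open>u(x1) > 0\<close> down to \<open>0\<close>.\<close>

lemma u_pos:
  assumes "x \<ge> 0"
  shows "u x > 0"
proof (rule ccontr)
  assume neg: "\<not> u x > 0"
  define Z where "Z = {x \<in> {0..}. u x \<le> 0}"
  define x0 where "x0 = Inf Z"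
  have Z: "closed Z" "Z \<noteq> {}" "bdd_below Z"
  proof -
    show "closed Z"
      unfolding Z_def by (intro continuous_on_closed_Collect_le continuous_intros)
    show "Z \<noteq> {}" using assms neg by (auto simp: Z_def)
    show "bdd_below Z" by (auto simp: Z_def intro!: bdd_belowI[of _ 0])
  qed
  have x0: "x0 \<in> Z" unfolding x0_def by (intro closed_contains_Inf Z)
  then have x0': "x0 \<ge> 0" "u x0 \<le> 0" by (auto simp: Z_def)
  have "x0 \<noteq> 0" using x0' u_0 by auto
  then have x0_pos: "x0 > 0" using x0' by simp
  have before: "u y > 0" if "0 \<le> y" "y < x0" for y
    using that cInf_lower[OF _ Z(3), of y] by (force simp: Z_def x0_def)
  define K where "K = lam / Gamma a"
  have K: "K > 0" using lam a by (simp add: K_def Gamma_real_pos)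
  obtain e where e: "e > 0" "e < x0" "K * e powr a / a < 1"
  proof -
    define e where "e = min (x0 / 2) ((a / (2 * K)) powr (1 / a))"
    have e: "e > 0" "e < x0"
      using x0_pos K a by (auto simp: e_def min_less_iff_disj)
    have "e powr a \<le> ((a / (2 * K)) powr (1 / a)) powr a"
      using a e by (intro powr_mono2) (auto simp: e_def)
    also have "\<dots> = a / (2 * K)"
      using a K by (simp add: powr_powr)
    finally have "K * e powr a / a \<le> 1 / 2"
      using a K by (simp add: field_simps)
    then have "K * e powr a / a < 1" by linarith
    with e show ?thesis using that by blast
  qed
  obtain x1 where x1: "x1 \<in> {x0 - e..x0}" "\<And>y. y \<in> {x0 - e..x0} \<Longrightarrow> u y \<le> u x1"
  proof -
    have "continuous_on {x0 - e..x0} u"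
      by (rule continuous_on_subset[OF continuous_on_u]) (use e in auto)
    from continuous_attains_sup[OF _ _ this] e that show ?thesis by auto
  qed
  have u1: "u x1 > 0" using x1(2)[of "x0 - e"] before[of "x0 - e"] e by simp
  then have "x1 \<noteq> x0" using x0' by auto
  then have x1': "0 < x1" "x1 < x0" using x1 e by auto
  have "(LINT y:{0<..<x0}|lborel. (x0 - y) powr (a - 1) * u y)
      \<le> (LINT y:{0<..<x1}|lborel. (x1 - y) powr (a - 1) * u y)
        + (LINT y:{x1<..<x0}|lborel. u x1 * (x0 - y) powr (a - 1))"
    unfolding set_lebesgue_integral_def
  proof (subst Bochner_Integration.integral_add[symmetric])
    show i1: "integrable lborel (\<lambda>y. indicator {0<..<x1} y *\<^sub>R ((x1 - y) powr (a - 1) * u y))"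
      using u_Volterra(1)[OF x1'(1)] by (simp add: set_integrable_def)
    show i2: "integrable lborel (\<lambda>y. indicator {x1<..<x0} y *\<^sub>R (u x1 * (x0 - y) powr (a - 1)))"
      using set_integrable_mult_right[OF kernel_integral(1)[OF x1'(2)], of "u x1"]
      by (simp add: set_integrable_def)
    show "(LINT y|lborel. indicator {0<..<x0} y *\<^sub>R ((x0 - y) powr (a - 1) * u y)) \<le>
       (LINT y|lborel. indicator {0<..<x1} y *\<^sub>R ((x1 - y) powr (a - 1) * u y)
           + indicator {x1<..<x0} y *\<^sub>R (u x1 * (x0 - y) powr (a - 1)))"
    proof (rule integral_mono_AE)
      show "integrable lborel (\<lambda>y. indicator {0<..<x0} y *\<^sub>R ((x0 - y) powr (a - 1) * u y))"
        using u_Volterra(1)[OF x0_pos] by (simp add: set_integrable_def)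
      show "AE y in lborel. indicator {0<..<x0} y *\<^sub>R ((x0 - y) powr (a - 1) * u y)
          \<le> indicator {0<..<x1} y *\<^sub>R ((x1 - y) powr (a - 1) * u y)
           + indicator {x1<..<x0} y *\<^sub>R (u x1 * (x0 - y) powr (a - 1))"
        using AE_lborel_singleton[of x1]
      proof eventually_elim
        case (elim y)
        consider "y \<le> 0 \<or> y \<ge> x0" | "0 < y" "y < x1" | "x1 < y" "y < x0" using elim by linarith
        then show ?case
        proof cases
          case 2
          have "(x0 - y) powr (a - 1) \<le> (x1 - y) powr (a - 1)"
            using 2 x1' a by (intro powr_mono2') auto
          then show ?thesis using 2 x1' before[of y] by (auto intro!: mult_right_mono)
        next
          case 3
          then show ?thesis using x1 e x1(2)[of y] by (auto simp: mult.commute intro!: mult_left_mono)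
        qed (use x1' in auto)
      qed
    qed (use i1 i2 in auto)
  qed
  also have "(LINT y:{x1<..<x0}|lborel. u x1 * (x0 - y) powr (a - 1)) = u x1 * ((x0 - x1) powr a / a)"
    using kernel_integral(2)[OF x1'(2)] by simp
  finally have "K * (LINT y:{0<..<x0}|lborel. (x0 - y) powr (a - 1) * u y)
      \<le> K * ((LINT y:{0<..<x1}|lborel. (x1 - y) powr (a - 1) * u y) + u x1 * ((x0 - x1) powr a / a))"
    using K by (intro mult_left_mono) auto
  then have "1 - u x0 \<le> 1 - u x1 + u x1 * (K * (x0 - x1) powr a / a)"
    using u_Volterra(2)[OF x0_pos] u_Volterra(2)[OF x1'(1)]
    by (simp add: K_def[symmetric] distrib_left mult_ac)
  then have "u x0 \<ge> u x1 - u x1 * (K * (x0 - x1) powr a / a)" by simp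
  moreover have "K * (x0 - x1) powr a / a \<le> K * e powr a / a"
    using K a x1' x1 e by (intro divide_right_mono mult_left_mono powr_mono2) auto
  then have "u x1 * (K * (x0 - x1) powr a / a) < u x1 * 1"
    using e u1 by (intro mult_strict_left_mono) auto
  ultimately show False using x0' by simp
qed

lemma u_le_1:
  assumes "x \<ge> 0"
  shows "u x \<le> 1"
proof -
  have "(LINT t:{0<..<1}|lborel. (1 - t) powr (a - 1) * u (x * t)) \<ge> 0"
    unfolding set_lebesgue_integral_def
    using assms by (intro integral_nonneg_AE AE_I2) (auto simp: indicator_def intro!: mult_nonneg_nonneg less_imp_le[OF u_pos])
  then show ?thesis
    using u_Volterra_unit(2)[OF assms] lam a by (simp add: Gamma_real_pos less_imp_le)
qed

text \<open>Pointwise decay of \<open>u\<close> is of order \<open>x\<^sup>-\<^sup>a\<close>; a bound in the mean suffices for integrability and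
  follows from the Volterra equation by bounding the kernel below by its value at the far end.\<close>

lemma u_mean_bound:
  assumes x: "x > 0"
  shows "set_integrable lborel {0<..<x} u"
    and "(LINT y:{0<..<x}|lborel. u y) \<le> Gamma a / lam * x powr (1 - a)"
proof -
  show int: "set_integrable lborel {0<..<x} u"
  proof (rule set_integrable_bound[where f = "\<lambda>_. 1 :: real"])
    show "set_integrable lborel {0<..<x} (\<lambda>_. 1 :: real)"
      using x by (simp add: set_integrable_def integrable_real_indicator)
    show "set_borel_measurable lborel {0<..<x} u"
      unfolding set_borel_measurable_def by measurable
    show "AE y in lborel. y \<in> {0<..<x} \<longrightarrow> norm (u y) \<le> norm (1::real)"
      using u_le_1 u_pos by (intro AE_I2) (auto simp: abs_of_pos less_imp_le)
  qed
  have "x powr (a - 1) * (LINT y:{0<..<x}|lborel. u y) \<le> (LINT y:{0<..<x}|lborel. (x - y) powr (a - 1) * u y)"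
    unfolding set_integral_mult_right[symmetric]
  proof (rule set_integral_mono)
    fix y assume y: "y \<in> {0<..<x}"
    show "x powr (a - 1) * u y \<le> (x - y) powr (a - 1) * u y"
      using y a u_pos[of y] by (intro mult_right_mono powr_mono2') auto
  qed (use int u_Volterra(1)[OF x] in \<open>auto intro!: set_integrable_mult_right\<close>)
  also have "\<dots> \<le> Gamma a / lam"
  proof -
    have "lam / Gamma a * (LINT y:{0<..<x}|lborel. (x - y) powr (a - 1) * u y) \<le> 1"
      using u_Volterra(2)[OF x] u_pos[of x] x by linarith
    then show ?thesis
      using lam Gamma_real_pos[OF a(1)] by (simp add: field_simps)
  qed
  finally have "x powr (1 - a) * (x powr (a - 1) * (LINT y:{0<..<x}|lborel. u y)) \<le> x powr (1 - a) * (Gamma a / lam)"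
    by (intro mult_left_mono) auto
  then show "(LINT y:{0<..<x}|lborel. u y) \<le> Gamma a / lam * x powr (1 - a)"
    using x by (simp add: mult.assoc[symmetric] powr_add[symmetric] mult.commute)
qed


text \<open>Write \<open>x\<^sup>-\<^sup>p\<close> as the integral of \<open>p y\<^sup>-\<^sup>p\<^sup>-\<^sup>1\<close> over \<open>y > x\<close> and exchange the integrations:
  the bound on the mean of \<open>u\<close> then leaves the convergent integral of \<open>y\<^sup>-\<^sup>p\<^sup>-\<^sup>a\<close>.\<close>

lemma u_tail_integrable:
  assumes p: "p > 1 - a"
  shows "set_integrable lborel {1..} (\<lambda>x. x powr (- p) * u x)"
proof -
  define C where "C = Gamma a / lam"
  define h where "h x y = ennreal (indicator {1..} x * u x) * ennreal (indicator {x<..} y * (p * y powr (- p - 1)))" for x y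
  have p0: "p > 0" using p a by simp
  have C: "C > 0" using lam a by (simp add: C_def Gamma_real_pos)
  have u1: "0 \<le> indicator {1..} x * u x" for x
    using u_pos[of x] by (auto simp: indicator_def)
  have meas: "(\<lambda>(x, y). h x y) \<in> borel_measurable (lborel \<Otimes>\<^sub>M lborel)"
  proof -
    have eq: "(\<lambda>(x, y). h x y) = (\<lambda>z. ennreal (indicator {1..} (fst z) * u (fst z)) *
        ennreal ((if fst z < snd z then 1 else 0) * (p * snd z powr (- p - 1))))"
      by (auto simp: h_def indicator_def fun_eq_iff)
    show ?thesis unfolding eq by measurable
  qed
  have inner_y: "(\<integral>\<^sup>+ y. h x y \<partial>lborel) = ennreal (indicator {1..} x * (x powr (- p) * u x))" for x
  proof (cases "x \<ge> 1")
    case True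
    have "((\<lambda>y. p * y powr (- p - 1)) has_integral p * (- (x powr (- p - 1 + 1)) / (- p - 1 + 1))) {x..}"
      using True p0 by (intro has_integral_mult_right has_integral_powr_to_inf) auto
    from nn_integral_has_integral_lebesgue[OF _ this] True p0
    have *: "(\<integral>\<^sup>+ y. ennreal (indicator {x..} y * (p * y powr (- p - 1))) \<partial>lborel) = ennreal (x powr (- p))"
      by (simp add: field_simps)
    have "(\<integral>\<^sup>+ y. h x y \<partial>lborel)
        = ennreal (u x) * (\<integral>\<^sup>+ y. ennreal (indicator {x<..} y * (p * y powr (- p - 1))) \<partial>lborel)"
      using True by (simp add: h_def nn_integral_cmult)
    also have "(\<integral>\<^sup>+ y. ennreal (indicator {x<..} y * (p * y powr (- p - 1))) \<partial>lborel)
        = (\<integral>\<^sup>+ y. ennreal (indicator {x..} y * (p * y powr (- p - 1))) \<partial>lborel)"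
      using AE_lborel_singleton[of x]
      by (intro nn_integral_cong_AE) (auto simp: indicator_def elim!: eventually_mono)
    finally show ?thesis
      using True u_pos[of x] by (simp add: * ennreal_mult'[symmetric] mult.commute)
  qed (simp add: h_def)
  have inner_x: "(\<integral>\<^sup>+ x. h x y \<partial>lborel) \<le> ennreal (indicator {1..} y * (p * C * y powr (- p - a)))" for y
  proof (cases "y \<ge> 1")
    case True
    have "(\<integral>\<^sup>+ x. h x y \<partial>lborel) \<le> (\<integral>\<^sup>+ x. ennreal (p * y powr (- p - 1)) * ennreal (indicator {0<..<y} x * u x) \<partial>lborel)"
      by (intro nn_integral_mono) (auto simp: h_def indicator_def mult.commute)
    also have "\<dots> = ennreal (p * y powr (- p - 1)) * (\<integral>\<^sup>+ x. ennreal (indicator {0<..<y} x * u x) \<partial>lborel)"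
      by (simp add: nn_integral_cmult)
    also have "(\<integral>\<^sup>+ x. ennreal (indicator {0<..<y} x * u x) \<partial>lborel) = ennreal (LINT x:{0<..<y}|lborel. u x)"
      using u_mean_bound(1)[of y] True u_pos unfolding set_lebesgue_integral_def set_integrable_def
      by (subst nn_integral_eq_integral) (auto simp: indicator_def less_imp_le intro!: AE_I2)
    also have "ennreal (p * y powr (- p - 1)) * \<dots> \<le> ennreal (p * y powr (- p - 1)) * ennreal (C * y powr (1 - a))"
      using u_mean_bound(2)[of y] True by (intro mult_left_mono ennreal_leI) (auto simp: C_def)
    also have "\<dots> = ennreal (p * C * y powr (- p - a))"
      using p0 C True by (simp add: ennreal_mult'[symmetric] powr_add[symmetric] mult_ac minus_diff_commute)
    finally show ?thesis using True by simp
  next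
    case False
    then have "h x y = 0" for x by (auto simp: h_def indicator_def)
    then show ?thesis by simp
  qed
  have "(\<integral>\<^sup>+ x. ennreal (indicator {1..} x * (x powr (- p) * u x)) \<partial>lborel) = (\<integral>\<^sup>+ x. \<integral>\<^sup>+ y. h x y \<partial>lborel \<partial>lborel)"
    by (simp add: inner_y)
  also have "\<dots> = (\<integral>\<^sup>+ y. \<integral>\<^sup>+ x. h x y \<partial>lborel \<partial>lborel)"
    using lborel_pair.Fubini'[OF meas] by simp
  also have "\<dots> \<le> (\<integral>\<^sup>+ y. ennreal (indicator {1..} y * (p * C * y powr (- p - a))) \<partial>lborel)"
    by (intro nn_integral_mono inner_x)
  also have "\<dots> = ennreal (p * C * (- (1 powr (- p - a + 1)) / (- p - a + 1)))"
    using p p0 C by (intro nn_integral_has_integral_lebesgue has_integral_mult_right has_integral_powr_to_inf) auto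
  also have "\<dots> < \<infinity>" by simp
  finally have fin: "(\<integral>\<^sup>+ x. ennreal (indicator {1..} x * (x powr (- p) * u x)) \<partial>lborel) < \<infinity>" .
  have "norm (indicator {1..} x *\<^sub>R (x powr (- p) * u x)) = indicator {1..} x * (x powr (- p) * u x)" for x
    using u_pos[of x] by (auto simp: indicator_def)
  with fin show ?thesis
    unfolding set_integrable_def integrable_iff_bounded by simp
qed

text \<open>The Levy density of one half-line up to its factor \<open>\<delta>\<close>. Multiplication by \<open>x\<close> lowers \<open>g\<close>
  by one, which is why the parameter is kept free.\<close>

definition W :: "real \<Rightarrow> real \<Rightarrow> real" where
  "W g x = x powr (- g - 1) * u x"

lemma measurable_W [measurable]: "W g \<in> borel_measurable borel"
  unfolding W_def by measurable

lemma W_nonneg: "x > 0 \<Longrightarrow> 0 \<le> W g x"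
  using u_pos[of x] by (simp add: W_def)

lemma W_shift: "x > 0 \<Longrightarrow> x * W g x = W (g - 1) x"
  by (simp add: W_def powr_diff powr_minus field_simps)

text \<open>Near \<open>0\<close> this needs \<open>g < 1\<close>, at infinity the decay of \<open>u\<close> and \<open>g > - a\<close>. Applied to
  \<open>g - 1\<close> it also serves the weight \<open>min(x, x\<^sup>2)\<close>.\<close>

lemma W_integrable:
  assumes g: "- a < g" "g < 1"
  shows "set_integrable lborel {0<..} (\<lambda>x. min 1 x * W g x)"
proof -
  have "set_integrable lborel {0<..<1} (\<lambda>x. x powr (- g))"
    by (rule set_integral_of_nonneg_has_integral)
       (use has_integral_powr_from_0[of "- g" 1] g in \<open>auto simp: has_integral_Icc_iff_Ioo\<close>)
  moreover have "set_integrable lborel {1..} (\<lambda>x. x powr (- (g + 1)) * u x)"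
    using g by (intro u_tail_integrable) auto
  ultimately have "integrable lborel (\<lambda>x. indicator {0<..<1} x *\<^sub>R x powr (- g)
      + indicator {1..} x *\<^sub>R (x powr (- (g + 1)) * u x))"
    unfolding set_integrable_def by (rule Bochner_Integration.integrable_add)
  then show ?thesis
    unfolding set_integrable_def
  proof (rule Bochner_Integration.integrable_bound)
    show "AE x in lborel. norm (indicat_real {0<..} x *\<^sub>R (min 1 x * W g x)) \<le>
        norm (indicator {0<..<1} x *\<^sub>R x powr (- g) + indicator {1..} x *\<^sub>R (x powr (- (g + 1)) * u x))"
    proof (intro AE_I2)
      fix x :: real
      consider "x \<le> 0" | "0 < x" "x < 1" | "x \<ge> 1" by linarith
      then show "norm (indicat_real {0<..} x *\<^sub>R (min 1 x * W g x)) \<le>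
        norm (indicator {0<..<1} x *\<^sub>R x powr (- g) + indicator {1..} x *\<^sub>R (x powr (- (g + 1)) * u x))"
      proof cases
        case 2
        then have "min 1 x * W g x = x powr (- g) * u x"
          by (simp add: W_def powr_diff powr_minus field_simps)
        moreover have "x powr (- g) * u x \<le> x powr (- g) * 1"
          using 2 u_le_1[of x] by (intro mult_left_mono) auto
        ultimately show ?thesis using 2 u_pos[of x] by simp
      next
        case 3
        then show ?thesis using u_pos[of x] by (simp add: W_def)
      qed simp
    qed
  qed measurable
qed

end

section \<open>Compensated Laplace integrals\<close>

lemma Gamma_set_integral:
  fixes s \<sigma> :: real
  assumes s: "s > 0" and \<sigma>: "\<sigma> > 0"
  shows "set_integrable lborel {0<..} (\<lambda>x. x powr (s - 1) * exp (- \<sigma> * x))"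
    and "(LINT x:{0<..}|lborel. x powr (s - 1) * exp (- \<sigma> * x)) = Gamma s * \<sigma> powr (- s)"
proof -
  let ?f = "\<lambda>t. indicator {0<..} t *\<^sub>R (t powr (s - 1) / exp t)"
  have "((\<lambda>t. t powr (s - 1) / exp t) has_integral Gamma s) {0<..}"
  proof -
    have "((\<lambda>t. if t \<in> {0<..} then t powr (s - 1) / exp t else 0) has_integral Gamma s) {0..}"
      by (rule has_integral_spike[OF _ _ Gamma_integral_real[OF s], of "{0}"]) auto
    then show ?thesis by (subst (asm) has_integral_restrict) auto
  qed
  from set_integral_of_nonneg_has_integral[OF this]
  have 1: "integrable lborel ?f" "(LINT t|lborel. ?f t) = Gamma s"
    by (auto simp: set_integrable_def set_lebesgue_integral_def)
  have eq: "?f (0 + \<sigma> * x) = \<sigma> powr (s - 1) * (indicator {0<..} x *\<^sub>R (x powr (s - 1) * exp (- \<sigma> * x)))" for x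
    using \<sigma> by (auto simp: indicator_def powr_mult exp_minus field_simps zero_less_mult_iff)
  have "integrable lborel (\<lambda>x. ?f (0 + \<sigma> * x))"
    using 1 \<sigma> by (subst lborel_integrable_real_affine_iff) auto
  then show "set_integrable lborel {0<..} (\<lambda>x. x powr (s - 1) * exp (- \<sigma> * x))"
    unfolding eq using \<sigma> by (simp add: set_integrable_def)
  have "Gamma s = \<sigma> * (\<sigma> powr (s - 1) * (LINT x:{0<..}|lborel. x powr (s - 1) * exp (- \<sigma> * x)))"
    using lborel_integral_real_affine[of \<sigma> ?f 0] \<sigma> 1(2) unfolding eq
    by (simp add: set_lebesgue_integral_def)
  also have "\<dots> = \<sigma> powr s * (LINT x:{0<..}|lborel. x powr (s - 1) * exp (- \<sigma> * x))"
    using \<sigma> by (simp add: powr_diff)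
  finally show "(LINT x:{0<..}|lborel. x powr (s - 1) * exp (- \<sigma> * x)) = Gamma s * \<sigma> powr (- s)"
    using \<sigma> by (simp add: powr_minus field_simps)
qed

lemma norm_exp_minus_1_le:
  fixes w :: complex
  assumes "Re w \<le> 0"
  shows "norm (exp w - 1) \<le> norm w"
proof -
  have "norm (exp w - exp 0) \<le> 1 * norm (w - 0)"
  proof (rule field_differentiable_bound[where S = "{w. Re w \<le> 0}" and f' = exp])
    show "convex {w. Re w \<le> 0}" by (rule convex_halfspace_Re_le)
  qed (use assms in \<open>auto intro: DERIV_exp has_field_derivative_at_within\<close>)
  then show ?thesis by simp
qed

lemma norm_exp_minus_1_minus_le:
  fixes w :: complex
  assumes "Re w \<le> 0"
  shows "norm (exp w - 1 - w) \<le> norm w ^ 2"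
proof -
  have "norm ((exp w - w) - (exp 0 - 0)) \<le> norm w * norm (w - 0)"
  proof (rule field_differentiable_bound[where S = "{v. Re v \<le> 0} \<inter> cball 0 (norm w)" and f' = "\<lambda>v. exp v - 1"])
    show "convex ({v. Re v \<le> 0} \<inter> cball 0 (norm w))"
      by (intro convex_Int convex_halfspace_Re_le convex_cball)
    show "norm (exp v - 1) \<le> norm w" if "v \<in> {v. Re v \<le> 0} \<inter> cball 0 (norm w)" for v
      using that norm_exp_minus_1_le[of v] by simp
  qed (use assms in \<open>auto intro!: derivative_eq_intros\<close>)
  then show ?thesis by (simp add: power2_eq_square algebra_simps)
qed

lemma norm_exp_diff_1_bound:
  assumes "Re \<zeta> \<ge> 0" "x \<ge> 0"
  shows "norm (exp (- \<zeta> * of_real x) - 1) \<le> (2 + norm \<zeta>) * min 1 x"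
proof -
  have "norm (exp (- \<zeta> * of_real x) - 1) \<le> norm \<zeta> * x"
    using norm_exp_minus_1_le[of "- \<zeta> * of_real x"] assms by (simp add: norm_mult)
  moreover have "norm (exp (- \<zeta> * of_real x) - 1) \<le> 1 + 1"
    by (rule order_trans[OF norm_triangle_ineq4]) (use assms in auto)
  moreover have "norm \<zeta> * x \<le> (2 + norm \<zeta>) * x" "2 \<le> 2 + norm \<zeta>"
    using assms by (auto intro!: mult_right_mono)
  ultimately have "norm (exp (- \<zeta> * of_real x) - 1) \<le> (2 + norm \<zeta>) * x"
    "norm (exp (- \<zeta> * of_real x) - 1) \<le> 2 + norm \<zeta>" by linarith+
  then show ?thesis by (cases "x \<le> 1") simp_all
qed

lemma norm_exp_diff_1_linear_bound:
  assumes "Re \<zeta> \<ge> 0" "x \<ge> 0"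
  shows "norm (exp (- \<zeta> * of_real x) - 1 + \<zeta> * of_real x) \<le> (2 * norm \<zeta> + norm \<zeta> ^ 2) * (x * min 1 x)"
proof -
  have 1: "norm (exp (- \<zeta> * of_real x) - 1 + \<zeta> * of_real x) \<le> norm \<zeta> ^ 2 * x ^ 2"
    using norm_exp_minus_1_minus_le[of "- \<zeta> * of_real x"] assms by (simp add: norm_mult power_mult_distrib)
  have 2: "norm (exp (- \<zeta> * of_real x) - 1 + \<zeta> * of_real x) \<le> 2 * norm \<zeta> * x"
    unfolding mult_2 distrib_right using norm_exp_minus_1_le[of "- \<zeta> * of_real x"] assms
    by (intro order_trans[OF norm_triangle_ineq] add_mono) (auto simp: norm_mult)
  show ?thesis
  proof (cases "x \<le> 1")
    case True
    have "norm \<zeta> ^ 2 * x ^ 2 \<le> (2 * norm \<zeta> + norm \<zeta> ^ 2) * x ^ 2"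
      by (intro mult_right_mono) auto
    then show ?thesis using 1 True by (simp add: power2_eq_square)
  next
    case False
    have "2 * norm \<zeta> * x \<le> (2 * norm \<zeta> + norm \<zeta> ^ 2) * x"
      using assms by (intro mult_right_mono) auto
    from order_trans[OF 2 this] show ?thesis using False by simp
  qed
qed

text \<open>A convex neighbourhood of a point of the half-plane on which the Laplace integrands have a
  common bound.\<close>

lemma half_ball_subset:
  assumes "Re \<zeta> > 0" "w \<in> ball \<zeta> (Re \<zeta> / 2)"
  shows "Re w > Re \<zeta> / 2" "norm w \<le> norm \<zeta> + Re \<zeta> / 2"
proof -
  have "\<bar>Re \<zeta> - Re w\<bar> < Re \<zeta> / 2"
    using assms abs_Re_le_cmod[of "\<zeta> - w"] by (simp add: dist_norm)
  then show "Re w > Re \<zeta> / 2" using assms by linarith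
  show "norm w \<le> norm \<zeta> + Re \<zeta> / 2"
    using assms norm_triangle_sub[of w \<zeta>] by (simp add: dist_norm norm_minus_commute)
qed

context relaxation
begin

text \<open>The Laplace integral of \<open>W g\<close> without compensation and with compensation of first and second
  order. They converge for \<open>g < 0\<close>, for \<open>- a < g < 1\<close> and for \<open>1 - a < g < 2\<close>, respectively, and each
  derivative is the preceding one with \<open>g\<close> lowered by one and the sign changed.\<close>

definition G :: "real \<Rightarrow> complex \<Rightarrow> complex" where
  "G g \<zeta> = (LINT x:{0<..}|lborel. exp (- \<zeta> * of_real x) * of_real (W g x))"

definition J1 :: "real \<Rightarrow> complex \<Rightarrow> complex" where
  "J1 g \<zeta> = (LINT x:{0<..}|lborel. (exp (- \<zeta> * of_real x) - 1) * of_real (W g x))"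

definition J2 :: "real \<Rightarrow> complex \<Rightarrow> complex" where
  "J2 g \<zeta> = (LINT x:{0<..}|lborel. (exp (- \<zeta> * of_real x) - 1 + \<zeta> * of_real x) * of_real (W g x))"

lemma W_exp_integrable:
  assumes "g < 0" "\<sigma> > 0"
  shows "set_integrable lborel {0<..} (\<lambda>x. exp (- \<sigma> * x) * W g x)"
proof (rule set_integrable_bound)
  show "set_integrable lborel {0<..} (\<lambda>x. x powr (- g - 1) * exp (- \<sigma> * x))"
    using Gamma_set_integral(1)[of "- g" \<sigma>] assms by simp
  show "set_borel_measurable lborel {0<..} (\<lambda>x. exp (- \<sigma> * x) * W g x)"
    unfolding set_borel_measurable_def by measurable
  show "AE x in lborel. x \<in> {0<..} \<longrightarrow> norm (exp (- \<sigma> * x) * W g x) \<le> norm (x powr (- g - 1) * exp (- \<sigma> * x))"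
  proof (intro AE_I2 impI)
    fix x :: real assume "x \<in> {0<..}"
    then have "u x \<le> 1" "0 < u x" using u_le_1[of x] u_pos[of x] by auto
    then show "norm (exp (- \<sigma> * x) * W g x) \<le> norm (x powr (- g - 1) * exp (- \<sigma> * x))"
      by (simp add: W_def abs_mult mult_left_le)
  qed
qed

lemma J1_integrable:
  assumes "- a < g" "g < 1" "Re \<zeta> \<ge> 0"
  shows "set_integrable lborel {0<..} (\<lambda>x. (exp (- \<zeta> * of_real x) - 1) * of_real (W g x))"
proof (rule set_integrable_bound)
  show "set_integrable lborel {0<..} (\<lambda>x. (2 + norm \<zeta>) * (min 1 x * W g x))"
    using W_integrable[OF assms(1,2)] by (rule set_integrable_mult_right)
  show "AE x in lborel. x \<in> {0<..} \<longrightarrow> norm ((exp (- \<zeta> * of_real x) - 1) * of_real (W g x))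
      \<le> norm ((2 + norm \<zeta>) * (min 1 x * W g x))"
  proof (intro AE_I2 impI)
    fix x :: real assume x: "x \<in> {0<..}"
    have "norm (exp (- \<zeta> * of_real x) - 1) * W g x \<le> (2 + norm \<zeta>) * min 1 x * W g x"
      using norm_exp_diff_1_bound[of \<zeta> x] W_nonneg[of x g] x assms(3) by (intro mult_right_mono) auto
    then show "norm ((exp (- \<zeta> * of_real x) - 1) * of_real (W g x))
      \<le> norm ((2 + norm \<zeta>) * (min 1 x * W g x))"
      using x W_nonneg[of x g] by (simp add: norm_mult abs_mult mult.assoc)
  qed
qed (simp add: set_borel_measurable_def)

lemma J2_integrable:
  assumes "1 - a < g" "g < 2" "Re \<zeta> \<ge> 0"
  shows "set_integrable lborel {0<..} (\<lambda>x. (exp (- \<zeta> * of_real x) - 1 + \<zeta> * of_real x) * of_real (W g x))"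
proof (rule set_integrable_bound)
  show "set_integrable lborel {0<..} (\<lambda>x. (2 * norm \<zeta> + norm \<zeta> ^ 2) * (min 1 x * W (g - 1) x))"
    using assms by (intro set_integrable_mult_right W_integrable) auto
  show "AE x in lborel. x \<in> {0<..} \<longrightarrow> norm ((exp (- \<zeta> * of_real x) - 1 + \<zeta> * of_real x) * of_real (W g x))
      \<le> norm ((2 * norm \<zeta> + norm \<zeta> ^ 2) * (min 1 x * W (g - 1) x))"
  proof (intro AE_I2 impI)
    fix x :: real assume x: "x \<in> {0<..}"
    have "norm (exp (- \<zeta> * of_real x) - 1 + \<zeta> * of_real x) * W g x
        \<le> (2 * norm \<zeta> + norm \<zeta> ^ 2) * (x * min 1 x) * W g x"
      using norm_exp_diff_1_linear_bound[of \<zeta> x] W_nonneg[of x g] x assms(3) by (intro mult_right_mono) auto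
    then show "norm ((exp (- \<zeta> * of_real x) - 1 + \<zeta> * of_real x) * of_real (W g x))
      \<le> norm ((2 * norm \<zeta> + norm \<zeta> ^ 2) * (min 1 x * W (g - 1) x))"
      using x W_nonneg[of x g] by (simp add: W_shift[symmetric] norm_mult abs_mult mult_ac)
  qed
qed (simp add: set_borel_measurable_def)

lemma J1_has_field_derivative:
  assumes g: "- a < g" "g < 1" and \<zeta>: "Re \<zeta> > 0"
  shows "(J1 g has_field_derivative - G (g - 1) \<zeta>) (at \<zeta>)"
proof -
  let ?S = "ball \<zeta> (Re \<zeta> / 2)"
  have "((\<lambda>w. LINT x|lborel. indicator {0<..} x *\<^sub>R ((exp (- w * of_real x) - 1) * of_real (W g x)))
      has_field_derivative (LINT x|lborel. indicator {0<..} x *\<^sub>R (- of_real x * exp (- \<zeta> * of_real x) * of_real (W g x)))) (at \<zeta>)"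
  proof (rule has_field_derivative_integral_dominated[where S = ?S
        and h = "\<lambda>x. indicator {0<..} x *\<^sub>R (exp (- (Re \<zeta> / 2) * x) * W (g - 1) x)"])
    fix w assume "w \<in> ?S"
    note w = half_ball_subset[OF \<zeta> this]
    show "integrable lborel (\<lambda>x. indicator {0<..} x *\<^sub>R ((exp (- w * of_real x) - 1) * of_real (W g x)))"
      using J1_integrable[OF g, of w] w \<zeta> by (simp add: set_integrable_def)
    fix x :: real
    show "((\<lambda>w. indicator {0<..} x *\<^sub>R ((exp (- w * of_real x) - 1) * of_real (W g x)))
      has_field_derivative indicator {0<..} x *\<^sub>R (- of_real x * exp (- w * of_real x) * of_real (W g x))) (at w)"
      by (auto intro!: derivative_eq_intros simp: indicator_def)
    have "exp (- (Re w * x)) * W (g - 1) x \<le> exp (- (Re \<zeta> / 2 * x)) * W (g - 1) x" if "x > 0"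
      using w that W_nonneg[of x] by (intro mult_right_mono) auto
    then show "norm (indicator {0<..} x *\<^sub>R (- of_real x * exp (- w * of_real x) * of_real (W g x)))
      \<le> indicator {0<..} x *\<^sub>R (exp (- (Re \<zeta> / 2) * x) * W (g - 1) x)"
      using W_nonneg[of x g] by (auto simp: indicator_def norm_mult W_shift[symmetric] mult_ac)
  next
    show "integrable lborel (\<lambda>x. indicator {0<..} x *\<^sub>R (exp (- (Re \<zeta> / 2) * x) * W (g - 1) x))"
      using W_exp_integrable[of "g - 1" "Re \<zeta> / 2"] g \<zeta> by (simp add: set_integrable_def)
  qed (use \<zeta> in auto)
  also have "(LINT x|lborel. indicator {0<..} x *\<^sub>R (- of_real x * exp (- \<zeta> * of_real x) * of_real (W g x)))
      = (LINT x|lborel. - (indicator {0<..} x *\<^sub>R (exp (- \<zeta> * of_real x) * of_real (W (g - 1) x))))"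
    by (intro Bochner_Integration.integral_cong) (auto simp: indicator_def W_shift[symmetric])
  also have "\<dots> = - G (g - 1) \<zeta>"
    by (simp add: G_def set_lebesgue_integral_def)
  finally show ?thesis
    by (simp add: J1_def[abs_def] set_lebesgue_integral_def)
qed

lemma J2_has_field_derivative:
  assumes g: "1 - a < g" "g < 2" and \<zeta>: "Re \<zeta> > 0"
  shows "(J2 g has_field_derivative - J1 (g - 1) \<zeta>) (at \<zeta>)"
proof -
  let ?S = "ball \<zeta> (Re \<zeta> / 2)"
  define C where "C = 2 + (norm \<zeta> + Re \<zeta> / 2)"
  have "((\<lambda>w. LINT x|lborel. indicator {0<..} x *\<^sub>R ((exp (- w * of_real x) - 1 + w * of_real x) * of_real (W g x)))
      has_field_derivative (LINT x|lborel. indicator {0<..} x *\<^sub>R (- (of_real x * (exp (- \<zeta> * of_real x) - 1)) * of_real (W g x)))) (at \<zeta>)"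
  proof (rule has_field_derivative_integral_dominated[where S = ?S
        and h = "\<lambda>x. C * (indicator {0<..} x *\<^sub>R (min 1 x * W (g - 1) x))"])
    fix w assume "w \<in> ?S"
    note w = half_ball_subset[OF \<zeta> this]
    show "integrable lborel (\<lambda>x. indicator {0<..} x *\<^sub>R ((exp (- w * of_real x) - 1 + w * of_real x) * of_real (W g x)))"
      using J2_integrable[OF g, of w] w \<zeta> by (simp add: set_integrable_def)
    fix x :: real
    show "((\<lambda>w. indicator {0<..} x *\<^sub>R ((exp (- w * of_real x) - 1 + w * of_real x) * of_real (W g x)))
      has_field_derivative indicator {0<..} x *\<^sub>R (- (of_real x * (exp (- w * of_real x) - 1)) * of_real (W g x))) (at w)"
      by (auto intro!: derivative_eq_intros simp: indicator_def algebra_simps)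
    have "norm (exp (- w * of_real x) - 1) * W (g - 1) x \<le> C * min 1 x * W (g - 1) x" if "x > 0"
    proof (intro mult_right_mono)
      have "norm (exp (- w * of_real x) - 1) \<le> (2 + norm w) * min 1 x"
        using w \<zeta> that by (intro norm_exp_diff_1_bound) auto
      also have "\<dots> \<le> C * min 1 x" using w that by (intro mult_right_mono) (auto simp: C_def)
      finally show "norm (exp (- w * of_real x) - 1) \<le> C * min 1 x" .
    qed (use W_nonneg that in auto)
    then show "norm (indicator {0<..} x *\<^sub>R (- (of_real x * (exp (- w * of_real x) - 1)) * of_real (W g x)))
      \<le> C * (indicator {0<..} x *\<^sub>R (min 1 x * W (g - 1) x))"
      using W_nonneg[of x g] by (auto simp: indicator_def norm_mult W_shift[symmetric] mult_ac)
  next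
    show "integrable lborel (\<lambda>x. C * (indicator {0<..} x *\<^sub>R (min 1 x * W (g - 1) x)))"
      using W_integrable[of "g - 1"] g by (simp add: set_integrable_def)
  qed (use \<zeta> in auto)
  also have "(LINT x|lborel. indicator {0<..} x *\<^sub>R (- (of_real x * (exp (- \<zeta> * of_real x) - 1)) * of_real (W g x)))
      = (LINT x|lborel. - (indicator {0<..} x *\<^sub>R ((exp (- \<zeta> * of_real x) - 1) * of_real (W (g - 1) x))))"
    by (intro Bochner_Integration.integral_cong) (auto simp: indicator_def W_shift[symmetric])
  also have "\<dots> = - J1 (g - 1) \<zeta>"
    by (simp add: J1_def set_lebesgue_integral_def)
  finally show ?thesis
    by (simp add: J2_def[abs_def] set_lebesgue_integral_def)
qed

text \<open>The exponent of the law lives on the imaginary axis, the boundary of the half-plane of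
  holomorphy; continuity up to the boundary lets it be reached from inside. The factor
  \<open>(2 + norm \<zeta>)\<^sup>2\<close> covers the bounds for both orders of compensation.\<close>

lemma continuous_on_dominated_closed_half_plane:
  fixes k :: "complex \<Rightarrow> real \<Rightarrow> complex" and v :: "real \<Rightarrow> real"
  assumes cont: "\<And>x. x > 0 \<Longrightarrow> continuous_on UNIV (\<lambda>\<zeta>. k \<zeta> x)"
    and meas: "\<And>\<zeta>. k \<zeta> \<in> borel_measurable borel"
    and bound: "\<And>\<zeta> x. Re \<zeta> \<ge> 0 \<Longrightarrow> x > 0 \<Longrightarrow> norm (k \<zeta> x) \<le> (2 + norm \<zeta>) ^ 2 * v x"
    and v: "set_integrable lborel {0<..} v" "\<And>x. x > 0 \<Longrightarrow> 0 \<le> v x"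
  shows "continuous_on {\<zeta>. 0 \<le> Re \<zeta>} (\<lambda>\<zeta>. LINT x:{0<..}|lborel. k \<zeta> x)"
  unfolding continuous_on_def
proof
  fix z :: complex assume z: "z \<in> {\<zeta>. 0 \<le> Re \<zeta>}"
  let ?S = "{\<zeta>. 0 \<le> Re \<zeta>} \<inter> ball z 1"
  have "((\<lambda>\<zeta>. LINT x|lborel. indicator {0<..} x *\<^sub>R k \<zeta> x) \<longlongrightarrow> (LINT x|lborel. indicator {0<..} x *\<^sub>R k z x)) (at z within ?S)"
  proof (rule tendsto_integral_dominated_within[where h = "\<lambda>x. (3 + norm z) ^ 2 * (indicator {0<..} x *\<^sub>R v x)"])
    fix x :: real
    have "((\<lambda>\<zeta>. k \<zeta> x) \<longlongrightarrow> k z x) (at z within ?S)" if "x > 0"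
      using cont[OF that] by (auto simp: continuous_on_def intro: tendsto_within_subset[of _ _ _ UNIV])
    then show "((\<lambda>\<zeta>. indicator {0<..} x *\<^sub>R k \<zeta> x) \<longlongrightarrow> indicator {0<..} x *\<^sub>R k z x) (at z within ?S)"
      by (cases "x > 0") auto
    fix \<zeta> assume \<zeta>: "\<zeta> \<in> ?S"
    have "norm \<zeta> \<le> norm z + 1"
      using \<zeta> norm_triangle_sub[of \<zeta> z] by (simp add: dist_norm norm_minus_commute)
    then have "(2 + norm \<zeta>) ^ 2 * v x \<le> (3 + norm z) ^ 2 * v x" if "x > 0"
      using v(2)[OF that] by (intro mult_right_mono power_mono) auto
    then show "norm (indicator {0<..} x *\<^sub>R k \<zeta> x) \<le> (3 + norm z) ^ 2 * (indicator {0<..} x *\<^sub>R v x)"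
      using bound[of \<zeta> x] \<zeta> by (force simp: indicator_def)
  next
    show "integrable lborel (\<lambda>x. (3 + norm z) ^ 2 * (indicator {0<..} x *\<^sub>R v x))"
      using v(1) by (simp add: set_integrable_def)
  qed (use meas in auto)
  moreover have "at z within ?S = at z within {\<zeta>. 0 \<le> Re \<zeta>}"
    by (rule at_within_nhd[of _ "ball z 1"]) auto
  ultimately show "((\<lambda>\<zeta>. LINT x:{0<..}|lborel. k \<zeta> x) \<longlongrightarrow> (LINT x:{0<..}|lborel. k z x)) (at z within {\<zeta>. 0 \<le> Re \<zeta>})"
    by (simp add: set_lebesgue_integral_def)
qed

lemma continuous_on_J1:
  assumes g: "- a < g" "g < 1"
  shows "continuous_on {\<zeta>. 0 \<le> Re \<zeta>} (J1 g)"
  unfolding J1_def[abs_def]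
proof (rule continuous_on_dominated_closed_half_plane)
  show "set_integrable lborel {0<..} (\<lambda>x. min 1 x * W g x)" by (rule W_integrable[OF g])
  fix \<zeta> :: complex and x :: real assume \<zeta>: "Re \<zeta> \<ge> 0" and x: "x > 0"
  have "norm (exp (- \<zeta> * of_real x) - 1) \<le> (2 + norm \<zeta>) * min 1 x"
    using norm_exp_diff_1_bound[of \<zeta> x] \<zeta> x by simp
  also have "\<dots> \<le> (2 + norm \<zeta>) ^ 2 * min 1 x"
    using x power_increasing[of 1 2 "2 + norm \<zeta>"] by (intro mult_right_mono) auto
  finally show "norm ((exp (- \<zeta> * of_real x) - 1) * of_real (W g x)) \<le> (2 + norm \<zeta>) ^ 2 * (min 1 x * W g x)"
    using W_nonneg[OF x, of g] by (simp add: norm_mult mult_right_mono mult.assoc[symmetric])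
qed (auto intro!: continuous_intros mult_nonneg_nonneg W_nonneg)

lemma continuous_on_J2:
  assumes g: "1 - a < g" "g < 2"
  shows "continuous_on {\<zeta>. 0 \<le> Re \<zeta>} (J2 g)"
  unfolding J2_def[abs_def]
proof (rule continuous_on_dominated_closed_half_plane)
  show "set_integrable lborel {0<..} (\<lambda>x. min 1 x * W (g - 1) x)"
    using g by (intro W_integrable) auto
  fix \<zeta> :: complex and x :: real assume \<zeta>: "Re \<zeta> \<ge> 0" and x: "x > 0"
  have "norm (exp (- \<zeta> * of_real x) - 1 + \<zeta> * of_real x) \<le> (2 * norm \<zeta> + norm \<zeta> ^ 2) * (x * min 1 x)"
    using norm_exp_diff_1_linear_bound[of \<zeta> x] \<zeta> x by simp
  also have "\<dots> \<le> (2 + norm \<zeta>) ^ 2 * (x * min 1 x)"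
    using x by (intro mult_right_mono) (auto simp: power2_eq_square algebra_simps)
  finally have "norm (exp (- \<zeta> * of_real x) - 1 + \<zeta> * of_real x) * W g x \<le> (2 + norm \<zeta>) ^ 2 * (x * min 1 x) * W g x"
    using W_nonneg[OF x, of g] by (intro mult_right_mono) auto
  then show "norm ((exp (- \<zeta> * of_real x) - 1 + \<zeta> * of_real x) * of_real (W g x)) \<le> (2 + norm \<zeta>) ^ 2 * (min 1 x * W (g - 1) x)"
    using W_nonneg[OF x, of g] x by (simp add: norm_mult W_shift[symmetric] mult_ac)
qed (auto intro!: continuous_intros mult_nonneg_nonneg W_nonneg)

lemma J1_0 [simp]: "J1 g 0 = 0" and J2_0 [simp]: "J2 g 0 = 0"
  by (simp_all add: J1_def J2_def)

text \<open>The coefficients of \<open>Gamma(- g)\<close> times the series of \<open>R21 1 (- g) 1 a\<close>.\<close>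

definition c :: "real \<Rightarrow> nat \<Rightarrow> real" where
  "c g k = Gamma (a * real k - g) / Gamma (a * real k + 1)"

text \<open>Integrate the Mittag-Leffler series term by term. Absolute convergence holds only where the
  resulting series converges absolutely, that is for large \<open>t\<close>.\<close>

lemma G_sums:
  assumes g: "g < 0" and t: "t > 0"
    and summable: "summable (\<lambda>k. c g k * (lam * t powr (- a)) ^ k)"
  shows "(\<lambda>k. of_real (t powr g * (c g k * (- lam * t powr (- a)) ^ k))) sums G g (of_real t)"
proof -
  define \<Gamma> where "\<Gamma> k = Gamma (a * real k + 1)" for k
  have \<Gamma>: "\<Gamma> k > 0" for k
    using a by (auto simp: \<Gamma>_def intro!: Gamma_real_pos add_nonneg_pos)
  have s: "a * real k - g > 0" for k
    using less_le_trans[OF g, of "a * real k"] a by simp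
  let ?f = "\<lambda>k x. (- lam) ^ k / \<Gamma> k * (x powr (a * real k - g - 1) * exp (- t * x))"
  note I = Gamma_set_integral[OF s t]
  have val: "d ^ k / \<Gamma> k * (Gamma (a * real k - g) * t powr - (a * real k - g))
      = t powr g * (c g k * (d * t powr (- a)) ^ k)" for d k
  proof -
    have "t powr - (a * real k - g) = t powr g * (t powr (- a)) ^ k"
      using t powr_powr[of t "- a" "real k"] by (simp add: powr_realpow powr_add[symmetric])
    then show ?thesis by (simp add: c_def \<Gamma>_def power_mult_distrib)
  qed
  have pw: "x powr (a * real k - g - 1) = x powr (- g - 1) * (x powr a) ^ k" if "x > 0" for x k
    using that powr_powr[of x a "real k"]
    by (simp add: powr_realpow powr_add[symmetric] algebra_simps)
  have "(\<lambda>k. LINT x:{0<..}|lborel. ?f k x) sums (LINT x:{0<..}|lborel. exp (- t * x) * W g x)"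
  proof (rule set_integral_sums(2))
    show "set_integrable lborel {0<..} (?f k)" for k
      using I(1) by (rule set_integrable_mult_right)
    fix x :: real assume "x \<in> {0<..}"
    then have x: "x > 0" by simp
    have eq: "?f k x = exp (- t * x) * x powr (- g - 1) * ((- lam * x powr a) ^ k / \<Gamma> k)" for k
      unfolding pw[OF x] by (simp add: power_mult_distrib[symmetric])
    show "(\<lambda>k. ?f k x) sums (exp (- t * x) * W g x)"
      unfolding eq unfolding W_def mult.assoc[symmetric] unfolding \<Gamma>_def
      using x by (intro sums_mult u_sums) auto
    have "norm (?f k x) = exp (- t * x) * x powr (- g - 1) * ((lam * x powr a) ^ k / \<Gamma> k)" for k
      unfolding eq using \<Gamma>[of k] lam by (simp add: abs_mult power_abs)
    then show "summable (\<lambda>k. norm (?f k x))"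
      unfolding \<Gamma>_def by (simp only:) (intro summable_mult summable_mittag_leffler a)
  next
    have "(LINT x:{0<..}|lborel. norm (?f k x)) = t powr g * (c g k * (lam * t powr (- a)) ^ k)" for k
    proof -
      have "(LINT x:{0<..}|lborel. norm (?f k x))
          = (LINT x:{0<..}|lborel. lam ^ k / \<Gamma> k * (x powr (a * real k - g - 1) * exp (- t * x)))"
        using \<Gamma>[of k] lam by (intro set_lebesgue_integral_cong) (auto simp: abs_mult power_abs)
      also have "\<dots> = t powr g * (c g k * (lam * t powr (- a)) ^ k)"
        unfolding val[symmetric] using I(2) by (simp only: set_integral_mult_right)
      finally show ?thesis .
    qed
    then show "summable (\<lambda>k. LINT x:{0<..}|lborel. norm (?f k x))"
      using summable_mult[OF summable] by simp
  qed
  moreover have "(LINT x:{0<..}|lborel. ?f k x) = t powr g * (c g k * (- lam * t powr (- a)) ^ k)" for k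
    unfolding val[symmetric] using I(2) by (simp only: set_integral_mult_right)
  ultimately have "(\<lambda>k. t powr g * (c g k * (- lam * t powr (- a)) ^ k)) sums (LINT x:{0<..}|lborel. exp (- t * x) * W g x)"
    by simp
  then have "(\<lambda>k. complex_of_real (t powr g * (c g k * (- lam * t powr (- a)) ^ k)))
      sums of_real (LINT x:{0<..}|lborel. exp (- t * x) * W g x)"
    by (simp only: sums_of_real_iff)
  also have "of_real (LINT x:{0<..}|lborel. exp (- t * x) * W g x) = G g (of_real t)"
    by (simp add: G_def set_integral_complex_of_real[symmetric] exp_of_real[symmetric])
  finally show ?thesis .
qed

end

section \<open>The analytic continuation of the hypergeometric series\<close>

abbreviation cut_plane :: "complex set" where
  "cut_plane \<equiv> - complex_of_real ` {1..}"

lemma open_cut_plane: "open cut_plane"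
  by (intro open_Compl closed_injective_linear_image) (auto simp: linear_of_real inj_of_real)

lemma connected_cut_plane: "connected cut_plane"
proof (rule starlike_imp_connected)
  show "starlike cut_plane"
    unfolding starlike_def
  proof (intro bexI[of _ 0] ballI subsetI)
    fix w v :: complex assume w: "w \<in> cut_plane" and "v \<in> closed_segment 0 w"
    then obtain s where s: "0 \<le> s" "s \<le> 1" "v = of_real s * w"
      by (auto simp: closed_segment_def scaleR_conv_of_real)
    show "v \<in> cut_plane"
    proof
      assume "v \<in> complex_of_real ` {1..}"
      then obtain r where r: "r \<ge> 1" "of_real s * w = of_real r" using s by auto
      then have "s \<noteq> 0" by auto
      then have "w = of_real (r / s)" using r by (simp add: field_simps)
      moreover have "r / s \<in> {1..}" using r s \<open>s \<noteq> 0\<close> by (simp add: field_simps)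
      ultimately show False using w by blast
    qed
  qed auto
qed

lemma unit_ball_subset_cut_plane: "ball 0 1 \<subseteq> cut_plane"
  by auto

lemma one_minus_scaled_nonzero:
  assumes "w \<in> cut_plane" "0 \<le> s" "s \<le> 1"
  shows "1 - w * complex_of_real s \<noteq> 0"
proof
  assume *: "1 - w * complex_of_real s = 0"
  then have "s \<noteq> 0" by auto
  then have "w = of_real (1 / s)" using * by (simp add: field_simps)
  moreover have "1 / s \<in> {1..}" using assms \<open>s \<noteq> 0\<close> by simp
  ultimately show False using assms(1) by blast
qed

text \<open>A bound on the kernel \<open>1 / (1 - v s)\<close>, uniform in \<open>s\<close> and local in \<open>v\<close>, by compactness.\<close>

lemma one_minus_scaled_bounded_below:
  assumes w: "w \<in> cut_plane"
  obtains r d where "r > 0" "d > 0" "ball w r \<subseteq> cut_plane"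
    "\<And>v s. v \<in> ball w r \<Longrightarrow> 0 \<le> s \<Longrightarrow> s \<le> 1 \<Longrightarrow> d \<le> norm (1 - v * complex_of_real s)"
proof -
  obtain r where r: "r > 0" "cball w r \<subseteq> cut_plane"
    using open_contains_cball[of cut_plane] open_cut_plane w by blast
  let ?K = "cball w r \<times> {0..1::real}"
  have "compact ?K" "?K \<noteq> {}" using r by (auto intro: compact_Times)
  moreover have "continuous_on ?K (\<lambda>p. norm (1 - fst p * complex_of_real (snd p)))"
    by (intro continuous_intros)
  ultimately obtain p where p: "p \<in> ?K"
    "\<And>q. q \<in> ?K \<Longrightarrow> norm (1 - fst p * complex_of_real (snd p)) \<le> norm (1 - fst q * complex_of_real (snd q))"
    using continuous_attains_inf[of ?K "\<lambda>p. norm (1 - fst p * complex_of_real (snd p))"] by blast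
  have "1 - fst p * complex_of_real (snd p) \<noteq> 0"
    using p(1) r(2) by (intro one_minus_scaled_nonzero) auto
  then have "norm (1 - fst p * complex_of_real (snd p)) > 0" by simp
  moreover have "norm (1 - fst p * complex_of_real (snd p)) \<le> norm (1 - v * complex_of_real s)"
    if "v \<in> ball w r" "0 \<le> s" "s \<le> 1" for v s
    using p(2)[of "(v, s)"] that by auto
  ultimately show ?thesis
    using that[of r] r ball_subset_cball by blast
qed

context relaxation
begin

text \<open>The continuation of \<open>Gamma(- g) R21 1 (- g) 1 a\<close> to the cut plane. For \<open>a k > g\<close> the
  coefficient \<open>c g k\<close> is a Beta integral divided by \<open>Gamma(1 + g)\<close>; the terms from \<open>n\<close> on are summed as a
  geometric series under that integral, the earlier ones are kept as a polynomial. Any \<open>n\<close> with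
  \<open>a n > g\<close> gives the same function, the least one shows its behaviour at infinity.\<close>

definition R :: "real \<Rightarrow> nat \<Rightarrow> complex \<Rightarrow> complex" where
  "R g n w = (\<Sum>k<n. of_real (c g k) * w ^ k) + w ^ n / of_real (Gamma (1 + g)) *
     (LINT t:{0<..<1}|lborel. of_real (t powr (a * real n - g - 1) * (1 - t) powr g) / (1 - w * of_real (t powr a)))"

lemma R_holomorphic:
  assumes g: "- 1 < g" "g < a * real n"
  shows "R g n holomorphic_on cut_plane"
proof -
  define b where "b t = t powr (a * real n - g - 1) * (1 - t) powr g" for t
  have b: "set_integrable lborel {0<..<1} b"
    using Beta_set_integral(1)[of "a * real n - g" "1 + g"] g by (simp add: b_def[abs_def])
  have [measurable]: "b \<in> borel_measurable borel" unfolding b_def by measurable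
  have b0: "b t \<ge> 0" for t by (simp add: b_def)
  have T: "0 \<le> t powr a" "t powr a \<le> 1" if "t \<in> {0<..<1}" for t
    using that a powr_mono2[of a t 1] by auto
  have "(\<lambda>w. LINT t:{0<..<1}|lborel. of_real (b t) / (1 - w * of_real (t powr a))) field_differentiable (at z)"
    if z: "z \<in> cut_plane" for z
  proof -
    obtain r d where rd: "r > 0" "d > 0" "ball z r \<subseteq> cut_plane"
      "\<And>v s. v \<in> ball z r \<Longrightarrow> 0 \<le> s \<Longrightarrow> s \<le> 1 \<Longrightarrow> d \<le> norm (1 - v * complex_of_real s)"
      using one_minus_scaled_bounded_below[OF z] by blast
    have "((\<lambda>w. LINT t|lborel. indicator {0<..<1} t *\<^sub>R (of_real (b t) / (1 - w * of_real (t powr a))))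
      has_field_derivative (LINT t|lborel. indicator {0<..<1} t *\<^sub>R
          (of_real (b t) * of_real (t powr a) / (1 - z * of_real (t powr a)) ^ 2))) (at z)"
    proof (rule has_field_derivative_integral_dominated[where S = "ball z r"
          and h = "\<lambda>t. (1 / d ^ 2) * (indicator {0<..<1} t *\<^sub>R b t)"])
      show "integrable lborel (\<lambda>t. (1 / d ^ 2) * (indicator {0<..<1} t *\<^sub>R b t))"
        using b by (simp add: set_integrable_def)
      fix w assume w: "w \<in> ball z r"
      show "integrable lborel (\<lambda>t. indicator {0<..<1} t *\<^sub>R (of_real (b t) / (1 - w * of_real (t powr a))))"
      proof (rule Bochner_Integration.integrable_bound)
        show "integrable lborel (\<lambda>t. (1 / d) * (indicator {0<..<1} t *\<^sub>R b t))"
          using b by (simp add: set_integrable_def)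
        show "AE t in lborel. norm (indicator {0<..<1} t *\<^sub>R (of_real (b t) / (1 - w * of_real (t powr a))))
            \<le> norm ((1 / d) * (indicator {0<..<1} t *\<^sub>R b t))"
        proof (rule AE_I2)
          fix t :: real
          show "norm (indicator {0<..<1} t *\<^sub>R (of_real (b t) / (1 - w * of_real (t powr a))))
            \<le> norm ((1 / d) * (indicator {0<..<1} t *\<^sub>R b t))"
          proof (cases "t \<in> {0<..<1}")
            case True
            then have "b t / norm (1 - w * of_real (t powr a)) \<le> b t / d"
              using rd(2) rd(4)[OF w T[OF True]] b0[of t]
              by (intro divide_left_mono) (auto intro!: mult_pos_pos)
            then show ?thesis using True b0[of t] rd(2) by (simp add: norm_divide)
          qed simp
        qed
      qed measurable
      fix t :: real
      show "((\<lambda>w. indicator {0<..<1} t *\<^sub>R (of_real (b t) / (1 - w * of_real (t powr a))))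
        has_field_derivative indicator {0<..<1} t *\<^sub>R
          (of_real (b t) * of_real (t powr a) / (1 - w * of_real (t powr a)) ^ 2)) (at w)"
      proof (cases "t \<in> {0<..<1}")
        case True
        then have "1 - w * complex_of_real (t powr a) \<noteq> 0"
          using rd(2) rd(4)[OF w T[OF True]] by auto
        then show ?thesis
          using True by (auto intro!: derivative_eq_intros simp: power2_eq_square)
      qed simp
      show "norm (indicator {0<..<1} t *\<^sub>R
          (of_real (b t) * of_real (t powr a) / (1 - w * of_real (t powr a)) ^ 2))
        \<le> (1 / d ^ 2) * (indicator {0<..<1} t *\<^sub>R b t)"
      proof (cases "t \<in> {0<..<1}")
        case True
        have "b t * t powr a / norm (1 - w * of_real (t powr a)) ^ 2 \<le> b t * 1 / d ^ 2"
          using rd(2) rd(4)[OF w T[OF True]] b0[of t] T[OF True]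
          by (intro frac_le mult_left_mono power_mono) auto
        then show ?thesis using True b0[of t] by (simp add: norm_divide norm_mult norm_power)
      qed simp
    qed (use rd in auto)
    then show ?thesis
      by (auto simp: set_lebesgue_integral_def field_differentiable_def)
  qed
  then have "(\<lambda>w. LINT t:{0<..<1}|lborel. of_real (b t) / (1 - w * of_real (t powr a))) holomorphic_on cut_plane"
    by (auto simp: holomorphic_on_def intro: field_differentiable_at_within)
  then show ?thesis
    unfolding R_def[abs_def] b_def by (intro holomorphic_intros) auto
qed

lemma R_sums:
  assumes g: "- 1 < g" "g < a * real n" and w: "norm w < 1"
  shows "(\<lambda>k. of_real (c g k) * w ^ k) sums R g n w"
proof -
  let ?b = "\<lambda>j t. t powr (a * real (j + n) - g - 1) * (1 - t) powr (1 + g - 1)"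
  have p: "a * real (j + n) - g > 0" for j
    using less_le_trans[OF g(2), of "a * real (j + n)"] a by simp
  note B = Beta_set_integral[OF p, of "1 + g"]
  have val: "Beta (a * real (j + n) - g) (1 + g) = Gamma (1 + g) * c g (j + n)" for j
    by (simp add: Beta_def c_def)
  let ?f = "\<lambda>j t. w ^ j * complex_of_real (?b j t)"
  have bj: "?b j t = ?b 0 t * (t powr a) ^ j" if "t \<in> {0<..<1}" for j t
    using that powr_powr[of t a "real j"]
    by (simp add: powr_realpow powr_add[symmetric] algebra_simps)
  have T: "0 \<le> t powr a" "t powr a \<le> 1" if "t \<in> {0<..<1}" for t
    using that a powr_mono2[of a t 1] by auto
  have wT: "norm (w * of_real (t powr a)) < 1" if "t \<in> {0<..<1}" for t
    using T[OF that] w mult_left_le[of "t powr a" "norm w"] by (simp add: norm_mult)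
  have eq: "?f j t = of_real (?b 0 t) * (w * of_real (t powr a)) ^ j" if "t \<in> {0<..<1}" for j t
    unfolding bj[OF that, of j] by (simp add: power_mult_distrib)
  have int: "set_integrable lborel {0<..<1} (?f j)" for j
    using B(1)[of j] g by (intro set_integrable_mult_right) (simp del: of_real_mult add: set_integrable_def scaleR_conv_of_real of_real_mult[symmetric])
  have "(\<lambda>j. LINT t:{0<..<1}|lborel. ?f j t) sums
      (LINT t:{0<..<1}|lborel. of_real (?b 0 t) / (1 - w * of_real (t powr a)))"
  proof (rule set_integral_sums(2)[OF int])
    fix t :: real assume t: "t \<in> {0<..<1}"
    show "(\<lambda>j. ?f j t) sums (of_real (?b 0 t) / (1 - w * of_real (t powr a)))"
      unfolding eq[OF t] using sums_mult[OF geometric_sums[OF wT[OF t]], of "of_real (?b 0 t)"] by simp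
    show "summable (\<lambda>j. norm (?f j t))"
      unfolding eq[OF t] norm_mult norm_power using wT[OF t]
      by (intro summable_mult summable_geometric) (simp add: norm_mult)
  next
    have "norm (LINT t:{0<..<1}|lborel. norm (?f j t)) \<le> Beta (a * real (0 + n) - g) (1 + g) * norm w ^ j" for j
    proof -
      have "(LINT t:{0<..<1}|lborel. norm (?f j t)) = (LINT t:{0<..<1}|lborel. norm w ^ j * ?b j t)"
        by (intro set_lebesgue_integral_cong) (auto simp: norm_mult norm_power)
      also have "\<dots> = norm w ^ j * (LINT t:{0<..<1}|lborel. ?b j t)"
        by simp
      finally have "(LINT t:{0<..<1}|lborel. norm (?f j t)) = norm w ^ j * (LINT t:{0<..<1}|lborel. ?b j t)" .
      moreover have "0 \<le> (LINT t:{0<..<1}|lborel. ?b j t)"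
        unfolding set_lebesgue_integral_def by (intro integral_nonneg_AE AE_I2) (auto simp: indicator_def)
      moreover have "(LINT t:{0<..<1}|lborel. ?b j t) \<le> (LINT t:{0<..<1}|lborel. ?b 0 t)"
      proof (rule set_integral_mono)
        fix t :: real assume t: "t \<in> {0<..<1}"
        show "?b j t \<le> ?b 0 t"
          unfolding bj[OF t, of j] using T[OF t] by (intro mult_left_le power_le_one) auto
      qed (use B(1)[of j] B(1)[of 0] g in auto)
      ultimately show ?thesis
        using B(2)[of 0] g by (simp add: abs_mult mult.commute mult_left_mono)
    qed
    moreover have "summable (\<lambda>j. Beta (a * real (0 + n) - g) (1 + g) * norm w ^ j)"
      using w by (intro summable_mult summable_geometric) simp
    ultimately show "summable (\<lambda>j. LINT t:{0<..<1}|lborel. norm (?f j t))"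
      by (rule summable_comparison_test'[where N = 0, rotated])
  qed
  moreover have "(LINT t:{0<..<1}|lborel. ?f j t) = w ^ j * of_real (Gamma (1 + g) * c g (j + n))" for j
    unfolding val[symmetric] set_integral_mult_right set_integral_complex_of_real using B(2)[of j] g by simp
  ultimately have "(\<lambda>j. w ^ j * of_real (Gamma (1 + g) * c g (j + n))) sums
      (LINT t:{0<..<1}|lborel. of_real (?b 0 t) / (1 - w * of_real (t powr a)))"
    by (simp only:)
  from sums_mult[OF this, of "w ^ n / of_real (Gamma (1 + g))"]
  have "(\<lambda>j. of_real (c g (j + n)) * w ^ (j + n)) sums
      (w ^ n / of_real (Gamma (1 + g)) * (LINT t:{0<..<1}|lborel. of_real (?b 0 t) / (1 - w * of_real (t powr a))))"
    using Gamma_real_pos[of "1 + g"] g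
    by (simp add: power_add mult_ac less_imp_neq[of 0, THEN not_sym])
  then show ?thesis
    by (subst (asm) sums_iff_shift) (simp add: R_def add.commute)
qed

text \<open>The value that defines \<open>R21\<close> exists by the explicit continuation and is unique by the identity
  theorem.\<close>

lemma R21_eq_R:
  assumes g: "- 1 < g" "g < a * real n" "- g \<notin> \<int>\<^sub>\<le>\<^sub>0" and w: "w \<in> cut_plane"
  shows "of_real (Gamma (- g)) * R21 1 (of_real (- g)) 1 a w = R g n w"
proof -
  have Gam: "Gamma (- g) \<noteq> 0" using g(3) by (simp add: Gamma_eq_zero_iff)
  have coeff: "R21_coeff 1 (of_real (- g)) 1 a k = of_real (c g k / Gamma (- g))" for k
  proof -
    have "Gamma (of_real (- g) + complex_of_real a * of_nat k) = of_real (Gamma (a * real k - g))"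
      "Gamma (1 + complex_of_real a * of_nat k) = of_real (Gamma (a * real k + 1))"
      by (simp_all add: Gamma_complex_of_real[symmetric] add.commute)
    moreover have "Gamma (complex_of_real (- g)) = of_real (Gamma (- g))"
      by (rule Gamma_complex_of_real)
    ultimately show ?thesis
      by (simp add: R21_coeff_def c_def pochhammer_fact[symmetric])
  qed
  let ?P = "\<lambda>f. f holomorphic_on cut_plane \<and>
     (\<forall>u. norm u < 1 \<longrightarrow> (\<lambda>k. R21_coeff 1 (of_real (- g)) 1 a k * u ^ k) sums f u)"
  let ?f = "\<lambda>w. R g n w / of_real (Gamma (- g))"
  have f: "?P ?f"
  proof (intro conjI allI impI)
    show "?f holomorphic_on cut_plane"
      using R_holomorphic[OF g(1,2)] Gam by (intro holomorphic_intros) auto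
    fix v :: complex assume "norm v < 1"
    from sums_divide[OF R_sums[OF g(1,2) this], of "of_real (Gamma (- g))"]
    show "(\<lambda>k. R21_coeff 1 (of_real (- g)) 1 a k * v ^ k) sums ?f v"
      unfolding coeff by (simp add: field_simps)
  qed
  have unique: "f w = ?f w" if "?P f" for f
  proof -
    have "f w - ?f w = 0"
    proof (rule analytic_continuation[where f = "\<lambda>w. f w - ?f w" and S = cut_plane and U = "ball 0 1" and \<xi> = 0])
      show "(\<lambda>w. f w - ?f w) holomorphic_on cut_plane"
        using that f by (intro holomorphic_on_diff) auto
      show "f v - ?f v = 0" if "v \<in> ball 0 1" for v
        using that \<open>?P f\<close> f sums_unique2 by (metis (no_types, lifting) dist_0_norm mem_ball right_minus_eq)
      show "(0 :: complex) islimpt ball 0 1" by (simp add: islimpt_ball)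
    qed (use w open_cut_plane connected_cut_plane unit_ball_subset_cut_plane in auto)
    then show ?thesis by simp
  qed
  have "R21 1 (of_real (- g)) 1 a w = ?f w"
    unfolding R21_def
  proof (rule the_equality)
    show "\<exists>f. f holomorphic_on cut_plane \<and>
        (\<forall>u. norm u < 1 \<longrightarrow> (\<lambda>k. R21_coeff 1 (of_real (- g)) 1 a k * u ^ k) sums f u) \<and> ?f w = f w"
      using f by blast
    show "v = ?f w" if "\<exists>f. f holomorphic_on cut_plane \<and>
        (\<forall>u. norm u < 1 \<longrightarrow> (\<lambda>k. R21_coeff 1 (of_real (- g)) 1 a k * u ^ k) sums f u) \<and> v = f w" for v
      using that unique by blast
  qed
  then show ?thesis using Gam by simp
qed

end

section \<open>Identification up to a constant\<close>

text \<open>The scheme behind all closed forms: agreement of the derivatives at large real points fixes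
  \<open>J - \<Phi>\<close> up to a constant on the half-plane, the limit at \<open>0\<close> along the positive reals determines the
  constant, and continuity extends the identity to the boundary.\<close>

lemma eq_of_derivative_eq_at_large_reals:
  fixes J J' \<Phi> :: "complex \<Rightarrow> complex"
  assumes J: "continuous_on {\<zeta>. 0 \<le> Re \<zeta>} J" "J 0 = 0"
      "\<And>\<zeta>. Re \<zeta> > 0 \<Longrightarrow> (J has_field_derivative J' \<zeta>) (at \<zeta>)"
    and \<Phi>: "\<Phi> holomorphic_on right_half_plane"
    and T: "T > 0" "\<And>t. t > T \<Longrightarrow> (\<Phi> has_field_derivative J' (of_real t)) (at (of_real t))"
    and L: "((\<lambda>t. \<Phi> (of_real t)) \<longlongrightarrow> L) (at_right 0)"
    and \<zeta>: "Re \<zeta> \<ge> 0" "isCont \<Phi> \<zeta>"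
  shows "J \<zeta> = \<Phi> \<zeta> - L"
proof -
  have "J holomorphic_on right_half_plane"
    using J(3) open_right_half_plane
    by (auto simp: holomorphic_on_open)
  then have hol: "(\<lambda>\<zeta>. J \<zeta> - \<Phi> \<zeta>) holomorphic_on right_half_plane"
    using \<Phi> by (intro holomorphic_intros)
  obtain k where k: "\<And>\<zeta>. Re \<zeta> > 0 \<Longrightarrow> J \<zeta> - \<Phi> \<zeta> = k"
  proof (rule constant_of_deriv_zero_at_large_reals[OF hol T(1)])
    fix t assume t: "t > T"
    then have "((\<lambda>\<zeta>. J \<zeta> - \<Phi> \<zeta>) has_field_derivative J' (of_real t) - J' (of_real t)) (at (of_real t))"
      using T by (intro DERIV_diff J(3)) auto
    then show "deriv (\<lambda>\<zeta>. J \<zeta> - \<Phi> \<zeta>) (of_real t) = 0"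
      by (simp add: DERIV_imp_deriv)
  qed auto
  have lim: "((\<lambda>t. J (\<xi> + of_real t)) \<longlongrightarrow> J \<xi>) (at_right 0)" if "Re \<xi> \<ge> 0" for \<xi>
  proof (rule continuous_on_tendsto_compose[OF J(1)])
    show "((\<lambda>t. \<xi> + of_real t) \<longlongrightarrow> \<xi>) (at_right 0)"
      by (auto intro!: tendsto_eq_intros)
    show "\<forall>\<^sub>F t in at_right 0. \<xi> + of_real t \<in> {\<zeta>. 0 \<le> Re \<zeta>}"
      using that eventually_at_right_less[of 0] by (auto elim!: eventually_mono)
  qed (use that in auto)
  \<comment> \<open>The constant is found at 0, the value at the boundary point by approaching it from the right.\<close>
  have "((\<lambda>t. J (0 + of_real t) - \<Phi> (of_real t)) \<longlongrightarrow> J 0 - L) (at_right 0)"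
    by (intro tendsto_diff lim L) auto
  moreover have "\<forall>\<^sub>F t in at_right 0. J (0 + of_real t) - \<Phi> (of_real t) = k"
    using eventually_at_right_less[of 0] by eventually_elim (simp add: k)
  ultimately have "((\<lambda>_::real. k) \<longlongrightarrow> J 0 - L) (at_right 0)"
    by (rule Lim_transform_eventually)
  then have kL: "k = - L"
    using J(2) by (simp add: tendsto_const_iff)
  have "((\<lambda>t. J (\<zeta> + of_real t) - \<Phi> (\<zeta> + of_real t)) \<longlongrightarrow> J \<zeta> - \<Phi> \<zeta>) (at_right 0)"
  proof (intro tendsto_diff lim \<zeta>(1))
    show "((\<lambda>t. \<Phi> (\<zeta> + of_real t)) \<longlongrightarrow> \<Phi> \<zeta>) (at_right 0)"
      by (rule isCont_tendsto_compose[OF \<zeta>(2)]) (auto intro!: tendsto_eq_intros)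
  qed
  moreover have "\<forall>\<^sub>F t in at_right 0. J (\<zeta> + of_real t) - \<Phi> (\<zeta> + of_real t) = k"
    using eventually_at_right_less[of 0] by eventually_elim (use \<zeta>(1) in \<open>simp add: k\<close>)
  ultimately have "((\<lambda>_::real. k) \<longlongrightarrow> J \<zeta> - \<Phi> \<zeta>) (at_right 0)"
    by (rule Lim_transform_eventually)
  then show ?thesis
    using kL by (simp add: tendsto_const_iff algebra_simps)
qed

text \<open>Since \<open>a < 1\<close>, the power maps the closed right half-plane into a sector strictly inside the open
  one; the argument of \<open>R21\<close> therefore stays off the cut.\<close>

lemma Re_powr_pos:
  fixes \<zeta> :: complex and a :: real
  assumes "Re \<zeta> \<ge> 0" "\<zeta> \<noteq> 0" "0 < a" "a < 1"
  shows "Re (\<zeta> powr of_real a) > 0"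
proof -
  have "\<bar>Im (Ln \<zeta>)\<bar> \<le> pi / 2" using assms Re_Ln_pos_le[of \<zeta>] by simp
  then have "\<bar>a * Im (Ln \<zeta>)\<bar> \<le> a * (pi / 2)"
    using assms by (simp add: abs_mult)
  also have "\<dots> < 1 * (pi / 2)" using assms by (intro mult_strict_right_mono) auto
  finally have "cos (a * Im (Ln \<zeta>)) > 0" by (intro cos_gt_zero_pi) auto
  then show ?thesis using assms by (simp add: powr_def Re_exp)
qed

lemma not_nonpos_Reals_of_Re_nonneg:
  "Re \<zeta> \<ge> 0 \<Longrightarrow> \<zeta> \<noteq> 0 \<Longrightarrow> \<zeta> \<notin> \<real>\<^sub>\<le>\<^sub>0"
  by (auto simp: complex_nonpos_Reals_iff complex_eq_iff)

context relaxation
begin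

text \<open>The argument of \<open>R21\<close> and the principal part \<open>Gamma(- g) \<zeta>\<^sup>g R21(arg \<zeta>)\<close> of the exponent, as
  functions of \<open>\<zeta> = - s \<i> z\<close>.\<close>

definition arg :: "complex \<Rightarrow> complex" where
  "arg \<zeta> = - of_real lam / \<zeta> powr of_real a"

definition F :: "real \<Rightarrow> nat \<Rightarrow> complex \<Rightarrow> complex" where
  "F g n \<zeta> = \<zeta> powr of_real g * R g n (arg \<zeta>)"

lemma arg_in_cut_plane:
  assumes "Re \<zeta> \<ge> 0" "\<zeta> \<noteq> 0"
  shows "arg \<zeta> \<in> cut_plane"
proof
  let ?p = "\<zeta> powr of_real a"
  assume "arg \<zeta> \<in> complex_of_real ` {1..}"
  then obtain r where r: "r \<ge> 1" "arg \<zeta> = of_real r" by auto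
  have p: "Re ?p > 0" using assms a by (intro Re_powr_pos)
  then have "?p \<noteq> 0" by auto
  then have "of_real r * ?p = - of_real lam" using r(2) by (simp add: arg_def field_simps)
  then have "Re (of_real r * ?p) = Re (- of_real lam)" by simp
  then have "r * Re ?p = - lam" by simp
  then show False using p r lam mult_pos_pos[of r "Re ?p"] by auto
qed

lemma arg_has_field_derivative:
  assumes "Re \<zeta> \<ge> 0" "\<zeta> \<noteq> 0"
  shows "(arg has_field_derivative - of_real a * arg \<zeta> / \<zeta>) (at \<zeta>)"
proof -
  have "\<zeta> \<notin> \<real>\<^sub>\<le>\<^sub>0" using assms by (rule not_nonpos_Reals_of_Re_nonneg)
  then show ?thesis
    unfolding arg_def[abs_def]
    using assms by (auto intro!: derivative_eq_intros simp: powr_diff field_simps power2_eq_square)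
qed

lemma F_has_field_derivative:
  assumes g: "- 1 < g" "g < a * real n" and \<zeta>: "Re \<zeta> \<ge> 0" "\<zeta> \<noteq> 0"
  shows "(F g n has_field_derivative
    \<zeta> powr (of_real (g - 1)) * (of_real g * R g n (arg \<zeta>) - of_real a * (arg \<zeta> * deriv (R g n) (arg \<zeta>)))) (at \<zeta>)"
proof -
  have \<zeta>': "\<zeta> \<notin> \<real>\<^sub>\<le>\<^sub>0" using \<zeta> by (rule not_nonpos_Reals_of_Re_nonneg)
  have "(R g n has_field_derivative deriv (R g n) (arg \<zeta>)) (at (arg \<zeta>))"
    using holomorphic_derivI[OF R_holomorphic[OF g] open_cut_plane arg_in_cut_plane[OF \<zeta>]] .
  from DERIV_chain2[OF this arg_has_field_derivative[OF \<zeta>]]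
  have "((\<lambda>\<zeta>. R g n (arg \<zeta>)) has_field_derivative deriv (R g n) (arg \<zeta>) * (- of_real a * arg \<zeta> / \<zeta>)) (at \<zeta>)" .
  from DERIV_mult[OF has_field_derivative_powr[OF \<zeta>', of "of_real g"] this]
  show ?thesis
    unfolding F_def[abs_def] 
    by (rule DERIV_cong) (use \<zeta> in \<open>simp add: powr_diff field_simps\<close>)
qed

lemma F_holomorphic:
  assumes "- 1 < g" "g < a * real n"
  shows "F g n holomorphic_on right_half_plane"
  unfolding holomorphic_on_open[OF open_right_half_plane]
  using F_has_field_derivative[OF assms] by (metis (lifting) less_eq_real_def mem_Collect_eq zero_complex.sel(1) less_irrefl)

lemma isCont_F:
  assumes "- 1 < g" "g < a * real n" "Re \<zeta> \<ge> 0" "\<zeta> \<noteq> 0"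
  shows "isCont (F g n) \<zeta>"
  using F_has_field_derivative[OF assms] by (rule DERIV_isCont)

text \<open>By \<open>(a k - g) Gamma(a k - g) = Gamma(a k - (g - 1))\<close>, differentiating the principal part
  termwise lowers \<open>g\<close> by one.\<close>

lemma R_deriv_sums:
  assumes g: "- 1 < g" "g < a * real n" "\<And>k. a * real k - g \<notin> \<int>\<^sub>\<le>\<^sub>0" and w: "norm w < 1"
  shows "(\<lambda>k. of_real (c (g - 1) k) * w ^ k) sums (- (of_real g * R g n w - of_real a * (w * deriv (R g n) w)))"
proof -
  let ?c = "\<lambda>k. complex_of_real (c g k)"
  have sm: "summable (\<lambda>k. ?c k * z ^ k)" if "norm z < 1" for z
    using R_sums[OF g(1,2) that] by (simp add: sums_iff)
  have "((\<lambda>z. \<Sum>k. ?c k * z ^ k) has_field_derivative (\<Sum>k. diffs ?c k * w ^ k)) (at w)"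
    by (rule termdiffs_strong'[OF sm w])
  then have "(R g n has_field_derivative (\<Sum>k. diffs ?c k * w ^ k)) (at w)"
  proof (rule has_field_derivative_transform_within_open[where S = "ball 0 1"])
    show "(\<Sum>k. ?c k * z ^ k) = R g n z" if "z \<in> ball 0 1" for z
      using R_sums[OF g(1,2), of z] that by (simp add: sums_iff)
  qed (use w in auto)
  then have D: "deriv (R g n) w = (\<Sum>k. diffs ?c k * w ^ k)" by (rule DERIV_imp_deriv)
  have "summable (\<lambda>k. diffs ?c k * w ^ k)"
    by (rule termdiff_converges[OF w sm])
  then have "(\<lambda>k. of_nat k * ?c k * w ^ (k - Suc 0)) sums deriv (R g n) w"
    unfolding D by (rule diffs_equiv)
  from sums_mult[OF this, of w]
  have "(\<lambda>k. w * (of_nat k * ?c k * w ^ (k - Suc 0))) sums (w * deriv (R g n) w)" .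
  moreover have "w * (of_nat k * ?c k * w ^ (k - Suc 0)) = of_nat k * ?c k * w ^ k" for k
    by (cases k) auto
  ultimately have "(\<lambda>k. of_nat k * ?c k * w ^ k) sums (w * deriv (R g n) w)" by simp
  from sums_minus[OF sums_diff[OF sums_mult[OF R_sums[OF g(1,2) w], of "of_real g"] sums_mult[OF this, of "of_real a"]]]
  have "(\<lambda>k. - (of_real g * (?c k * w ^ k) - of_real a * (of_nat k * ?c k * w ^ k)))
      sums (- (of_real g * R g n w - of_real a * (w * deriv (R g n) w)))" .
  moreover have "- (of_real g * (?c k * w ^ k) - of_real a * (of_nat k * ?c k * w ^ k)) = of_real (c (g - 1) k) * w ^ k" for k
  proof -
    have "c (g - 1) k = (a * real k - g) * c g k"
      using Gamma_plus1[OF g(3)[of k]] by (simp add: c_def algebra_simps)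
    then have "of_real (c (g - 1) k) = (of_real a * of_nat k - of_real g) * ?c k"
      by simp
    then show ?thesis by (simp only:) (simp add: algebra_simps)
  qed
  ultimately show ?thesis by simp
qed

lemma large_real:
  assumes "t > lam powr (1 / a)"
  shows "t > 0" "lam * t powr (- a) < 1" "arg (of_real t) = of_real (- lam * t powr (- a))"
    "norm (arg (of_real t)) < 1"
proof -
  show t: "t > 0" using assms by (rule le_less_trans[OF powr_ge_zero])
  have "(lam powr (1 / a)) powr a < t powr a"
    using assms a by (intro powr_less_mono2) auto
  then have "lam < t powr a" using a lam by (simp add: powr_powr)
  then show *: "lam * t powr (- a) < 1" using t by (simp add: powr_minus field_simps)
  show **: "arg (of_real t) = of_real (- lam * t powr (- a))"
    using t by (simp add: arg_def powr_of_real[symmetric] powr_minus field_simps)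
  show "norm (arg (of_real t)) < 1"
    unfolding ** norm_of_real using * lam by (simp add: abs_mult)
qed

lemma F_deriv_large_real:
  assumes g: "- 1 < g" "g < a * real n" "\<And>k. a * real k - g \<notin> \<int>\<^sub>\<le>\<^sub>0" and t: "t > lam powr (1 / a)"
    and S: "(\<lambda>k. of_real (c (g - 1) k) * arg (of_real t) ^ k) sums S"
  shows "(F g n has_field_derivative - (of_real t powr of_real (g - 1) * S)) (at (of_real t))"
proof -
  note large = large_real[OF t]
  have "S = - (of_real g * R g n (arg (of_real t)) - of_real a * (arg (of_real t) * deriv (R g n) (arg (of_real t))))"
    using S R_deriv_sums[OF g large(4)] by (rule sums_unique2)
  then show ?thesis
    using F_has_field_derivative[OF g(1,2), of "of_real t"] large(1)
    by (simp only: minus_minus mult_minus_right minus_mult_right[symmetric]) simp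
qed

text \<open>The derivative of the principal part is the negative of the series for \<open>g - 1\<close>. For \<open>g < 1\<close>
  that series is the Laplace integral \<open>G (g - 1)\<close>, which matches the derivative of \<open>J1 g\<close>.\<close>

lemma F_deriv_eq_G:
  assumes g: "- 1 < g" "g < 1" "g < a * real n" "\<And>k. a * real k - g \<notin> \<int>\<^sub>\<le>\<^sub>0" and t: "t > lam powr (1 / a)"
  shows "(F g n has_field_derivative - G (g - 1) (of_real t)) (at (of_real t))"
proof -
  note large = large_real[OF t]
  let ?r = "lam * t powr (- a)"
  have r: "norm (complex_of_real ?r) < 1" using large(2) lam by (simp only: norm_of_real) simp
  have "summable (\<lambda>k. of_real (c (g - 1) k) * complex_of_real ?r ^ k)"
    using R_deriv_sums[OF g(1,3,4) r] by (simp add: sums_iff)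
  then have "summable (\<lambda>k. complex_of_real (c (g - 1) k * ?r ^ k))" by simp
  then have "summable (\<lambda>k. c (g - 1) k * ?r ^ k)" by (simp only: summable_of_real_iff)
  from G_sums[OF _ large(1) this] g
  have *: "(\<lambda>k. of_real (t powr (g - 1) * (c (g - 1) k * (- lam * t powr (- a)) ^ k))) sums G (g - 1) (of_real t)"
    by simp
  from R_deriv_sums[OF g(1,3,4) large(4)] obtain S
    where S: "(\<lambda>k. of_real (c (g - 1) k) * arg (of_real t) ^ k) sums S" by blast
  have "(\<lambda>k. of_real (t powr (g - 1) * (c (g - 1) k * (- lam * t powr (- a)) ^ k))) sums (of_real (t powr (g - 1)) * S)"
    using sums_mult[OF S, of "of_real (t powr (g - 1))"] unfolding large(3) by simp
  with * have "G (g - 1) (of_real t) = of_real (t powr (g - 1)) * S" by (rule sums_unique2)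
  moreover have "complex_of_real t powr of_real (g - 1) = of_real (t powr (g - 1))"
    using large(1) by (intro powr_of_real) auto
  ultimately show ?thesis
    using F_deriv_large_real[OF g(1,3,4) t S] by simp
qed

lemma F_deriv_eq_F:
  assumes g: "0 < g" "g < a * real n" "\<And>k. a * real k - g \<notin> \<int>\<^sub>\<le>\<^sub>0" "g - 1 < a * real n'" and t: "t > lam powr (1 / a)"
  shows "(F g n has_field_derivative - F (g - 1) n' (of_real t)) (at (of_real t))"
  using F_deriv_large_real[OF _ g(2,3) t R_sums[OF _ g(4) large_real(4)[OF t]]] g(1)
  by (simp add: F_def)

end

section \<open>Behaviour at the origin\<close>

context relaxation
begin

lemma Mellin_integrable:
  assumes b: "0 < b" "b < a"
  shows "set_integrable lborel {0<..} (\<lambda>v. v powr (b - 1) / (1 + lam * v powr a))"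
proof -
  have "set_integrable lborel {0<..<1} (\<lambda>x. x powr (b - 1))"
    by (rule set_integral_of_nonneg_has_integral)
       (use has_integral_powr_from_0[of "b - 1" 1] b in \<open>auto simp: has_integral_Icc_iff_Ioo\<close>)
  moreover have "set_integrable lborel {1..} (\<lambda>x. (1 / lam) * x powr (b - 1 - a))"
    by (intro set_integrable_mult_right, rule set_integral_of_nonneg_has_integral[OF has_integral_powr_to_inf])
       (use b in auto)
  ultimately have "integrable lborel (\<lambda>x. indicator {0<..<1} x *\<^sub>R x powr (b - 1)
      + indicator {1..} x *\<^sub>R ((1 / lam) * x powr (b - 1 - a)))"
    unfolding set_integrable_def by (rule Bochner_Integration.integrable_add)
  then show ?thesis
    unfolding set_integrable_def
  proof (rule Bochner_Integration.integrable_bound)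
    show "AE x in lborel. norm (indicat_real {0<..} x *\<^sub>R (x powr (b - 1) / (1 + lam * x powr a))) \<le>
        norm (indicator {0<..<1} x *\<^sub>R x powr (b - 1) + indicator {1..} x *\<^sub>R ((1 / lam) * x powr (b - 1 - a)))"
    proof (intro AE_I2)
      fix x :: real
      have den: "1 + lam * x powr a \<ge> 1" "1 + lam * x powr a \<ge> lam * x powr a" using lam by auto
      consider "x \<le> 0" | "0 < x" "x < 1" | "x \<ge> 1" by linarith
      then show "norm (indicat_real {0<..} x *\<^sub>R (x powr (b - 1) / (1 + lam * x powr a))) \<le>
        norm (indicator {0<..<1} x *\<^sub>R x powr (b - 1) + indicator {1..} x *\<^sub>R ((1 / lam) * x powr (b - 1 - a)))"
      proof cases
        case 2
        have "x powr (b - 1) / (1 + lam * x powr a) \<le> x powr (b - 1) / 1"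
          using den by (intro divide_left_mono) auto
        then show ?thesis using 2 den by simp
      next
        case 3
        have "x powr (b - 1) / (1 + lam * x powr a) \<le> x powr (b - 1) / (lam * x powr a)"
          using den lam 3 by (intro divide_left_mono mult_pos_pos) (auto intro: less_le_trans[OF zero_less_one])
        also have "\<dots> = (1 / lam) * x powr (b - 1 - a)"
          using 3 by (simp add: powr_diff)
        finally show ?thesis using 3 den lam by simp
      qed simp
    qed
  qed measurable
qed

text \<open>The substitution \<open>s = lam v\<^sup>a / (1 + lam v\<^sup>a)\<close> produces \<open>Beta(\<sigma>, 1 - \<sigma>)\<close> with \<open>\<sigma> = b / a\<close>, which
  the reflection formula evaluates. This is where the sine in \<open>ell\<close> comes from.\<close>

lemma Mellin_value:
  assumes b: "0 < b" "b < a"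
  shows "(LINT v:{0<..}|lborel. v powr (b - 1) / (1 + lam * v powr a))
    = lam powr (- b / a) / a * (pi / sin (pi * (b / a)))"
proof -
  define \<sigma> where "\<sigma> = b / a"
  have \<sigma>: "0 < \<sigma>" "\<sigma> < 1" using a b by (auto simp: \<sigma>_def)
  define q where "q v = lam * v powr a / (1 + lam * v powr a)" for v
  define q' where "q' v = lam * a * v powr (a - 1) / (1 + lam * v powr a) ^ 2" for v
  define f where "f s = s powr (\<sigma> - 1) * (1 - s) powr (1 - \<sigma> - 1)" for s :: real
  have den: "1 + lam * v powr a > 0" for v using lam by (intro add_pos_nonneg) auto
  have q01: "0 < q v" "q v < 1" if "v > 0" for v
    using that lam den[of v] by (auto simp: q_def field_simps)
  have fq: "f (q v) * q' v = (lam powr \<sigma> * a) * (v powr (b - 1) / (1 + lam * v powr a))" if v: "v > 0" for v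
  proof -
    define D where "D = 1 + lam * v powr a"
    have D: "D > 0" using den[of v] by (simp add: D_def)
    have "1 - q v = 1 / D" using D by (simp add: q_def D_def field_simps)
    then have "f (q v) = (lam * v powr a) powr (\<sigma> - 1) / D powr (\<sigma> - 1) * (1 / D powr (- \<sigma>))"
      using v lam D by (simp add: f_def q_def D_def[symmetric] powr_divide)
    also have "\<dots> = lam powr (\<sigma> - 1) * v powr (b - a) * D"
    proof -
      have "a * (\<sigma> - 1) = b - a" using a by (simp add: \<sigma>_def field_simps)
      then have 1: "(lam * v powr a) powr (\<sigma> - 1) = lam powr (\<sigma> - 1) * v powr (b - a)"
        using v lam by (simp add: powr_mult powr_powr)
      have "D powr (\<sigma> - 1) * D powr (- \<sigma>) = 1 / D"
        using D by (simp add: powr_diff powr_minus_divide)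
      then have 2: "1 / D powr (\<sigma> - 1) * (1 / D powr (- \<sigma>)) = D" by simp
      have "lam powr (\<sigma> - 1) * v powr (b - a) / D powr (\<sigma> - 1) * (1 / D powr (- \<sigma>))
          = lam powr (\<sigma> - 1) * v powr (b - a) * (1 / D powr (\<sigma> - 1) * (1 / D powr (- \<sigma>)))" by simp
      then show ?thesis unfolding 1 2 .
    qed
    finally have "f (q v) * q' v = lam powr (\<sigma> - 1) * lam * a * (v powr (b - a) * v powr (a - 1)) / D"
      using D by (simp add: q'_def D_def[symmetric] power2_eq_square field_simps)
    also have "lam powr (\<sigma> - 1) * lam = lam powr \<sigma>" using lam by (simp add: powr_diff)
    also have "v powr (b - a) * v powr (a - 1) = v powr (b - 1)" using v by (simp add: powr_add[symmetric])
    finally show ?thesis by (simp add: D_def)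
  qed
  have lim0: "(q \<longlongrightarrow> 0) (at_right 0)"
  proof -
    have "((\<lambda>v. v powr a) \<longlongrightarrow> 0) (at_right 0)"
      by (rule tendsto_zero_powrI[of _ _ _ a]) (use a in \<open>auto simp: eventually_at_right_less eventually_at_filter\<close>)
    then have "((\<lambda>v. lam * v powr a / (1 + lam * v powr a)) \<longlongrightarrow> lam * 0 / (1 + lam * 0)) (at_right 0)"
      by (intro tendsto_intros) auto
    then show ?thesis by (simp add: q_def[abs_def])
  qed
  have lim1: "(q \<longlongrightarrow> 1) at_top"
  proof -
    have "((\<lambda>v. 1 / (1 + lam * v powr a)) \<longlongrightarrow> 0) at_top"
      using lam a by real_asymp
    then have "((\<lambda>v. 1 - 1 / (1 + lam * v powr a)) \<longlongrightarrow> 1 - 0) at_top" by (intro tendsto_intros)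
    moreover have "(\<lambda>v. 1 - 1 / (1 + lam * v powr a)) = q"
      using den by (auto simp: q_def fun_eq_iff field_simps less_imp_neq[THEN not_sym])
    ultimately show ?thesis by simp
  qed
  have int: "set_integrable lborel (einterval 0 \<infinity>) (\<lambda>v. f (q v) * q' v)"
  proof -
    have "set_integrable lborel {0<..} (\<lambda>v. (lam powr \<sigma> * a) * (v powr (b - 1) / (1 + lam * v powr a)))"
      by (rule set_integrable_mult_right[OF Mellin_integrable[OF b]])
    moreover have "(\<lambda>v. indicator (einterval 0 \<infinity>) v *\<^sub>R (f (q v) * q' v))
        = (\<lambda>v. indicator {0<..} v *\<^sub>R ((lam powr \<sigma> * a) * (v powr (b - 1) / (1 + lam * v powr a))))"
      by (auto simp: fun_eq_iff fq einterval_def indicator_def)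
    ultimately show ?thesis
      unfolding set_integrable_def by simp
  qed
  have "(LBINT s=0..1. f s) = (LBINT v=0..\<infinity>. f (q v) * q' v)"
  proof (rule interval_integral_substitution_nonneg(2)[where g = q and g' = q'])
    fix v assume v: "0 < ereal v" "ereal v < \<infinity>"
    then have v0: "v > 0" by simp
    show "DERIV q v :> q' v"
      unfolding q_def[abs_def] q'_def using v0 den[of v]
      by (auto intro!: derivative_eq_intros simp: power2_eq_square field_simps)
    show "isCont f (q v)"
      unfolding f_def[abs_def] using q01[OF v0] by (intro continuous_intros) auto
    show "isCont q' v"
      unfolding q'_def[abs_def] using v0 den[of v] by (intro continuous_intros) auto
    show "0 \<le> f (q v)" by (simp add: f_def)
  next
    fix v :: real
    show "0 \<le> q' v" using lam a by (simp add: q'_def)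
  next
    show "((ereal \<circ> q \<circ> real_of_ereal) \<longlongrightarrow> 0) (at_right 0)"
      using lim0 by (simp add: ereal_tendsto_simps zero_ereal_def)
    show "((ereal \<circ> q \<circ> real_of_ereal) \<longlongrightarrow> 1) (at_left \<infinity>)"
      using lim1 by (simp add: ereal_tendsto_simps one_ereal_def)
  qed (use int in auto)
  moreover have "(LBINT s=0..1. f s) = Beta \<sigma> (1 - \<sigma>)"
    using Beta_set_integral(2)[of \<sigma> "1 - \<sigma>"] \<sigma>
    by (simp add: f_def interval_lebesgue_integral_def einterval_eq_Icc zero_ereal_def one_ereal_def)
  moreover have "(LBINT v=0..\<infinity>. f (q v) * q' v)
      = (lam powr \<sigma> * a) * (LINT v:{0<..}|lborel. v powr (b - 1) / (1 + lam * v powr a))"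
  proof -
    have "(LBINT v=0..\<infinity>. f (q v) * q' v) = (LINT v:{0<..}|lborel. f (q v) * q' v)"
      by (simp add: interval_lebesgue_integral_def einterval_def)
         (simp add: greaterThan_def zero_ereal_def)
    also have "\<dots> = (LINT v:{0<..}|lborel. (lam powr \<sigma> * a) * (v powr (b - 1) / (1 + lam * v powr a)))"
      by (intro set_lebesgue_integral_cong) (auto simp: fq)
    finally show ?thesis by (simp only: set_integral_mult_right)
  qed
  moreover have "Beta \<sigma> (1 - \<sigma>) = pi / sin (pi * \<sigma>)"
  proof -
    have "complex_of_real (Gamma \<sigma> * Gamma (1 - \<sigma>)) = of_real (pi / sin (pi * \<sigma>))"
      using Gamma_reflection_complex[of "of_real \<sigma>"]
      by (simp add: Gamma_complex_of_real[symmetric] sin_of_real[symmetric])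
    then have "Gamma \<sigma> * Gamma (1 - \<sigma>) = pi / sin (pi * \<sigma>)" by (simp only: of_real_eq_iff)
    then show ?thesis by (simp add: Beta_def)
  qed
  ultimately have "lam powr \<sigma> * a * (LINT v:{0<..}|lborel. v powr (b - 1) / (1 + lam * v powr a)) = pi / sin (pi * \<sigma>)"
    by simp
  moreover have "lam powr \<sigma> * a \<noteq> 0" using lam a by simp
  ultimately have "(LINT v:{0<..}|lborel. v powr (b - 1) / (1 + lam * v powr a)) = pi / sin (pi * \<sigma>) / (lam powr \<sigma> * a)"
    by (metis nonzero_mult_div_cancel_left)
  then show ?thesis
    by (simp add: \<sigma>_def powr_minus_divide)
qed

text \<open>Substituting \<open>s = t v\<close> turns the integrand into \<open>v\<^sup>b\<^sup>-\<^sup>1 (1 - t v)\<^sup>g / (1 + lam v\<^sup>a)\<close>, whose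
  limit is the Mellin integrand. For \<open>g < 0\<close> the factor \<open>(1 - t v)\<^sup>g\<close> is singular at the moving end
  point \<open>v = 1 / t\<close>, so the part with \<open>s > 1/2\<close> is split off; it is of order \<open>t\<^sup>a\<^sup>-\<^sup>b\<close>.\<close>

lemma scaled_Beta_tendsto:
  assumes b: "0 < b" "b < a" and g: "- 1 < g"
  shows "((\<lambda>t. t powr (- b) * (LINT s:{0<..<1}|lborel. s powr (b - 1) * (1 - s) powr g / (1 + lam * t powr (- a) * s powr a)))
    \<longlongrightarrow> (LINT v:{0<..}|lborel. v powr (b - 1) / (1 + lam * v powr a))) (at_right 0)"
proof -
  let ?f = "\<lambda>t s. s powr (b - 1) * (1 - s) powr g / (1 + lam * t powr (- a) * s powr a)"
  define k where "k v = v powr (b - 1) / (1 + lam * v powr a)" for v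
  have k0: "0 \<le> k v" for v
    unfolding k_def using lam by (intro divide_nonneg_nonneg add_nonneg_nonneg mult_nonneg_nonneg) auto
  have [measurable]: "k \<in> borel_measurable borel" unfolding k_def by measurable
  have B: "set_integrable lborel {0<..<1} (\<lambda>s. s powr (b - 1) * (1 - s) powr g)"
    using Beta_set_integral(1)[of b "1 + g"] b g by simp
  have den: "1 + lam * t powr (- a) * s powr a \<ge> 1" for t s using lam by simp
  have f_le: "\<bar>?f t s\<bar> \<le> s powr (b - 1) * (1 - s) powr g" for t s
  proof -
    have "?f t s \<le> s powr (b - 1) * (1 - s) powr g / 1"
      using den by (intro divide_left_mono mult_nonneg_nonneg) (auto intro: less_le_trans[OF zero_less_one])
    moreover have "0 \<le> ?f t s" using den[of t s] by (intro divide_nonneg_nonneg mult_nonneg_nonneg) auto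
    ultimately show ?thesis by (simp only: abs_of_nonneg div_by_1)
  qed
  have f_int: "set_integrable lborel A (?f t)" if "A \<in> sets borel" "A \<subseteq> {0<..<1}" for A t
  proof (rule set_integrable_bound)
    show "set_integrable lborel A (\<lambda>s. s powr (b - 1) * (1 - s) powr g)"
      by (rule set_integrable_subset[OF B _ that(2)]) (use that(1) in simp)
    show "set_borel_measurable lborel A (?f t)"
      unfolding set_borel_measurable_def using that by measurable
    show "AE s in lborel. s \<in> A \<longrightarrow> norm (?f t s) \<le> norm (s powr (b - 1) * (1 - s) powr g)"
      using f_le by (intro AE_I2) simp
  qed
  have near_1: "((\<lambda>t. t powr (- b) * (LINT s:{1/2<..<1}|lborel. ?f t s)) \<longlongrightarrow> 0) (at_right 0)"
  proof (rule tendsto_sandwich)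
    let ?B = "LINT s:{1/2<..<1}|lborel. s powr (b - 1) * (1 - s) powr g"
    have B': "set_integrable lborel {1/2<..<1} (\<lambda>s. s powr (b - 1) * (1 - s) powr g)"
      by (rule set_integrable_subset[OF B]) auto
    show "\<forall>\<^sub>F t in at_right 0. 0 \<le> t powr (- b) * (LINT s:{1/2<..<1}|lborel. ?f t s)"
    proof (intro always_eventually allI mult_nonneg_nonneg)
      fix t :: real
      show "0 \<le> (LINT s:{1/2<..<1}|lborel. ?f t s)"
        unfolding set_lebesgue_integral_def
        using den by (intro integral_nonneg_AE AE_I2 scaleR_nonneg_nonneg divide_nonneg_nonneg mult_nonneg_nonneg)
          (auto intro: order_trans[OF zero_le_one])
    qed auto
    show "\<forall>\<^sub>F t in at_right 0. t powr (- b) * (LINT s:{1/2<..<1}|lborel. ?f t s) \<le> 2 / lam * ?B * t powr (a - b)"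
      using eventually_at_right_less[of 0]
    proof eventually_elim
      case (elim t)
      have "(LINT s:{1/2<..<1}|lborel. ?f t s) \<le> (LINT s:{1/2<..<1}|lborel. (2 / lam * t powr a) * (s powr (b - 1) * (1 - s) powr g))"
      proof (rule set_integral_mono)
        fix s :: real assume s: "s \<in> {1/2<..<1}"
        have "s powr a \<ge> s powr 1" using s a by (intro powr_mono') auto
        then have "s powr a \<ge> 1 / 2" using s by simp
        then have "lam * t powr (- a) * s powr a \<ge> lam * t powr (- a) * (1 / 2)"
          using lam by (intro mult_left_mono) auto
        then have "1 + lam * t powr (- a) * s powr a \<ge> lam * t powr (- a) / 2" by simp
        then have "?f t s \<le> s powr (b - 1) * (1 - s) powr g / (lam * t powr (- a) / 2)"
          using lam elim by (intro divide_left_mono mult_pos_pos mult_nonneg_nonneg)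
              (auto intro: less_le_trans[OF zero_less_one den])
        then show "?f t s \<le> (2 / lam * t powr a) * (s powr (b - 1) * (1 - s) powr g)"
          using elim lam by (simp add: powr_minus field_simps)
      next
        show "set_integrable lborel {1/2<..<1} (?f t)" by (rule f_int) auto
      qed (use B' in \<open>intro set_integrable_mult_right\<close>)
      then have "t powr (- b) * (LINT s:{1/2<..<1}|lborel. ?f t s) \<le> t powr (- b) * ((2 / lam * t powr a) * ?B)"
        by (intro mult_left_mono) auto
      also have "\<dots> = 2 / lam * ?B * t powr (a - b)"
        using elim by (simp add: powr_diff powr_minus field_simps)
      finally show ?case .
    qed
    have "((\<lambda>t::real. t powr (a - b)) \<longlongrightarrow> 0) (at_right 0)"
      by (rule tendsto_zero_powrI[of _ _ _ "a - b"]) (use b in \<open>auto simp: eventually_at_filter\<close>)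
    then show "((\<lambda>t. 2 / lam * ?B * t powr (a - b)) \<longlongrightarrow> 0) (at_right 0)"
      by (rule tendsto_mult_right_zero)
  qed simp
  have near_0: "((\<lambda>t. t powr (- b) * (LINT s:{0<..1/2}|lborel. ?f t s)) \<longlongrightarrow> (LINT v:{0<..}|lborel. k v)) (at_right 0)"
  proof -
    let ?h = "\<lambda>t v. (if 0 < v \<and> t * v \<le> 1/2 then (1 - t * v) powr g * k v else 0)"
    have "((\<lambda>t. LINT v|lborel. ?h t v) \<longlongrightarrow> (LINT v|lborel. indicator {0<..} v *\<^sub>R k v)) (at_right 0)"
    proof (rule tendsto_integral_dominated_within[where h = "\<lambda>v. 2 powr \<bar>g\<bar> * (indicator {0<..} v *\<^sub>R k v)"])
      fix v :: real
      show "((\<lambda>t. ?h t v) \<longlongrightarrow> indicator {0<..} v *\<^sub>R k v) (at_right 0)"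
      proof (cases "v > 0")
        case True
        have "((\<lambda>t. (1 - t * v) powr g * k v) \<longlongrightarrow> (1 - 0 * v) powr g * k v) (at_right 0)"
          by (intro tendsto_intros) auto
        moreover have "\<forall>\<^sub>F t in at_right 0. (1 - t * v) powr g * k v = ?h t v"
        proof -
          have "\<forall>\<^sub>F t in at_right 0. t < 1 / (2 * v)"
            using True by (intro eventually_at_rightI[of 0 "1 / (2 * v)"]) auto
          then show ?thesis by eventually_elim (use True in \<open>auto simp: field_simps\<close>)
        qed
        ultimately show ?thesis using True by (auto intro: Lim_transform_eventually)
      qed simp
      fix t :: real assume t: "t \<in> {0<..}"
      have "(1 - t * v) powr g \<le> 2 powr \<bar>g\<bar>" if "0 < v" "t * v \<le> 1/2"
      proof (cases "g \<ge> 0")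
        case True
        then have "(1 - t * v) powr g \<le> 1" using that t by (intro powr_le1) auto
        also have "1 \<le> 2 powr \<bar>g\<bar>" by (intro ge_one_powr_ge_zero) auto
        finally show ?thesis .
      next
        case False
        then have "(1 - t * v) powr g \<le> (1/2) powr g" using that t by (intro powr_mono2') auto
        then show ?thesis using False by (simp add: powr_divide powr_minus_divide)
      qed
      then show "norm (?h t v) \<le> 2 powr \<bar>g\<bar> * (indicator {0<..} v *\<^sub>R k v)"
        using k0[of v] by (auto simp: abs_mult intro!: mult_right_mono)
    next
      show "integrable lborel (\<lambda>v. 2 powr \<bar>g\<bar> * (indicator {0<..} v *\<^sub>R k v))"
        using Mellin_integrable[OF b] unfolding set_integrable_def k_def[symmetric]
        by (rule integrable_mult_right)
    qed measurable
    moreover have "\<forall>\<^sub>F t in at_right 0. (LINT v|lborel. ?h t v) = t powr (- b) * (LINT s:{0<..1/2}|lborel. ?f t s)"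
      using eventually_at_right_less[of 0]
    proof eventually_elim
      case (elim t)
      have eq: "indicator {0<..1/2} (0 + t * v) *\<^sub>R ?f t (0 + t * v) = t powr (b - 1) * ?h t v" for v
      proof (cases "0 < v \<and> t * v \<le> 1/2")
        case True
        have D: "1 + lam * t powr (- a) * (t * v) powr a = 1 + lam * v powr a"
          using elim True by (simp add: powr_mult powr_minus)
        have P: "(t * v) powr (b - 1) = t powr (b - 1) * v powr (b - 1)"
          using elim True by (simp add: powr_mult)
        have "?f t (t * v) = t powr (b - 1) * ((1 - t * v) powr g * k v)"
          unfolding D P k_def by simp
        then show ?thesis using True elim by simp
      next
        case False
        then show ?thesis using elim by (auto simp: indicator_def zero_less_mult_iff)
      qed
      have "(LINT s:{0<..1/2}|lborel. ?f t s) = t * (t powr (b - 1) * (LINT v|lborel. ?h t v))"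
        using lborel_integral_real_affine[of t "\<lambda>s. indicator {0<..1/2} s *\<^sub>R ?f t s" 0] elim
        unfolding eq by (simp add: set_lebesgue_integral_def)
      then show ?case using elim by (simp add: powr_diff powr_minus)
    qed
    ultimately show ?thesis
      unfolding set_lebesgue_integral_def by (rule Lim_transform_eventually)
  qed
  have "((\<lambda>t. t powr (- b) * (LINT s:{0<..1/2}|lborel. ?f t s) + t powr (- b) * (LINT s:{1/2<..<1}|lborel. ?f t s))
      \<longlongrightarrow> (LINT v:{0<..}|lborel. k v) + 0) (at_right 0)"
    by (intro tendsto_add near_0 near_1)
  moreover have "(LINT s:{0<..<1}|lborel. ?f t s) = (LINT s:{0<..1/2}|lborel. ?f t s) + (LINT s:{1/2<..<1}|lborel. ?f t s)" for t
  proof -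
    have "{0<..<1} = {0<..1/2} \<union> {1/2<..<1::real}" by auto
    then show ?thesis
      by (simp only:) (rule set_integral_Un; (rule f_int)?; auto)
  qed
  ultimately show ?thesis by (simp add: distrib_left k_def)
qed

end

context relaxation
begin

text \<open>The sine vanishes exactly when \<open>g / a\<close> is an integer. Otherwise the rounded-up quotient is the
  least admissible order in the definition of \<open>R\<close>.\<close>

lemma exists_order:
  assumes g: "- a < g" and sn: "sin (- pi * g / a) \<noteq> 0"
  obtains n :: nat where "a * (real n - 1) < g" "g < a * real n"
proof -
  have "g / a > - 1" using g a by (simp add: field_simps)
  then have "\<lceil>g / a\<rceil> \<ge> 0" by linarith
  define n where "n = nat \<lceil>g / a\<rceil>"
  have n: "real n = of_int \<lceil>g / a\<rceil>" using \<open>\<lceil>g / a\<rceil> \<ge> 0\<close> by (simp add: n_def)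
  have "g / a \<noteq> real n"
  proof
    assume "g / a = real n"
    then have "g = a * real n" using a by (simp add: field_simps)
    then have "- pi * g / a = - (pi * real n)" using a by simp
    then show False using sn by simp
  qed
  then have "real n - 1 < g / a" "g / a < real n" unfolding n by linarith+
  then show ?thesis using that a by (simp add: field_simps)
qed

lemma no_pole:
  assumes g: "- a < g" "g < 1" and sn: "sin (- pi * g / a) \<noteq> 0"
  shows "a * real k - g \<notin> \<int>\<^sub>\<le>\<^sub>0"
proof
  assume "a * real k - g \<in> \<int>\<^sub>\<le>\<^sub>0"
  then obtain j where j: "a * real k - g = - real j" by (auto elim: nonpos_Ints_cases')
  have "j = 0"
  proof (rule ccontr)
    assume "j \<noteq> 0"
    then have "real j \<ge> 1" by simp
    moreover have "a * real k \<ge> 0" using a by simp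
    ultimately show False using j g by linarith
  qed
  then have "- pi * g / a = - (pi * real k)" using j a by (simp add: field_simps)
  then show False using sn by simp
qed

text \<open>With the least admissible order \<open>n\<close>, the powers \<open>t\<^sup>g\<^sup>-\<^sup>a\<^sup>k\<close> with \<open>k < n\<close> tend to \<open>0\<close>, and the
  Beta integral, scaled by \<open>t\<^sup>g\<^sup>-\<^sup>a\<^sup>n\<close>, tends to a Mellin integral. The signs from \<open>(- lam)\<^sup>n\<close> and from
  shifting the sine by \<open>n \<pi>\<close> cancel.\<close>

lemma F_tendsto_ell:
  assumes g: "- a < g" and sn: "sin (- pi * g / a) \<noteq> 0"
    and n: "a * (real n - 1) < g" "g < a * real n"
  shows "((\<lambda>t. F g n (of_real t)) \<longlongrightarrow> of_real (ell g a lam)) (at_right 0)"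
proof -
  define b where "b = a * real n - g"
  have b: "0 < b" "b < a" using n by (auto simp: b_def algebra_simps)
  have g1: "- 1 < g" using g a by simp
  let ?I = "\<lambda>t. LINT s:{0<..<1}|lborel. s powr (b - 1) * (1 - s) powr g / (1 + lam * t powr (- a) * s powr a)"
  let ?K = "LINT v:{0<..}|lborel. v powr (b - 1) / (1 + lam * v powr a)"
  have "((\<lambda>t. (\<Sum>k<n. c g k * (- lam) ^ k * t powr (g - a * real k)) + (- lam) ^ n / Gamma (1 + g) * (t powr (- b) * ?I t))
      \<longlongrightarrow> (\<Sum>k<n. c g k * (- lam) ^ k * 0) + (- lam) ^ n / Gamma (1 + g) * ?K) (at_right 0)"
  proof (intro tendsto_add tendsto_sum tendsto_mult tendsto_const scaled_Beta_tendsto b g1)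
    fix k assume "k \<in> {..<n}"
    then have "real k \<le> real n - 1" by simp
    then have "a * real k \<le> a * (real n - 1)" using a by (intro mult_left_mono) auto
    then have "g - a * real k > 0" using n by simp
    then show "((\<lambda>t. t powr (g - a * real k)) \<longlongrightarrow> 0) (at_right 0)"
      by (intro tendsto_zero_powrI[of _ _ _ "g - a * real k"]) (auto simp: eventually_at_filter)
  qed
  also have "(\<Sum>k<n. c g k * (- lam) ^ k * 0) + (- lam) ^ n / Gamma (1 + g) * ?K = ell g a lam"
  proof -
    have "sin (pi * (b / a)) = (- 1) ^ n * sin (- pi * g / a)"
    proof -
      have "pi * (b / a) = - pi * g / a + pi * real n"
        using a by (simp add: b_def field_simps)
      then have "sin (pi * (b / a)) = sin (- pi * g / a) * cos (pi * real n)"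
        by (simp only: sin_add sin_npi2 cos_npi2 mult_zero_right add_0_right)
      then show ?thesis by (simp only: cos_npi2 mult.commute)
    qed
    moreover have "lam powr (- b / a) = lam powr (g / a) / lam ^ n"
    proof -
      have "- b / a = g / a - real n" using a by (simp add: b_def field_simps)
      then show ?thesis using lam by (simp add: powr_diff powr_realpow)
    qed
    moreover have "(- lam) ^ n = (- 1) ^ n * lam ^ n" by (simp add: power_mult_distrib[symmetric])
    moreover have "(- 1 :: real) ^ n * (- 1) ^ n = 1" by (simp add: power_mult_distrib[symmetric])
    ultimately show ?thesis
      using lam a sn Gamma_real_pos[of "1 + g"] g1 unfolding Mellin_value[OF b] ell_def
      by (auto simp: field_simps)
  qed
  finally have "((\<lambda>t. complex_of_real ((\<Sum>k<n. c g k * (- lam) ^ k * t powr (g - a * real k)) + (- lam) ^ n / Gamma (1 + g) * (t powr (- b) * ?I t)))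
      \<longlongrightarrow> of_real (ell g a lam)) (at_right 0)"
    by (rule tendsto_of_real)
  moreover have "\<forall>\<^sub>F t in at_right 0. complex_of_real ((\<Sum>k<n. c g k * (- lam) ^ k * t powr (g - a * real k)) + (- lam) ^ n / Gamma (1 + g) * (t powr (- b) * ?I t)) = F g n (of_real t)"
    using eventually_at_right_less[of 0]
  proof eventually_elim
    case (elim t)
    have arg: "arg (of_real t) = of_real (- lam * t powr (- a))"
      using elim by (simp add: arg_def powr_of_real[symmetric] powr_minus field_simps)
    have pw: "t powr g * (- lam * t powr (- a)) ^ k = (- lam) ^ k * t powr (g - a * real k)" for k
    proof -
      have "(- lam * t powr (- a)) ^ k = (- lam) ^ k * (t powr (- a)) ^ k"
        by (rule power_mult_distrib)
      also have "(t powr (- a)) ^ k = t powr (- (a * real k))"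
        using elim powr_powr[of t "- a" "real k"] by (simp add: powr_realpow)
      finally show ?thesis by (simp add: powr_add[symmetric])
    qed
    have int: "(LINT s:{0<..<1}|lborel. complex_of_real (s powr (a * real n - g - 1) * (1 - s) powr g) / (1 - arg (of_real t) * of_real (s powr a))) = of_real (?I t)"
      unfolding arg set_integral_complex_of_real[symmetric] by (simp add: b_def)
    have "F g n (of_real t) = of_real (t powr g * ((\<Sum>k<n. c g k * (- lam * t powr (- a)) ^ k) + (- lam * t powr (- a)) ^ n / Gamma (1 + g) * ?I t))"
      unfolding F_def R_def int using elim unfolding arg by (simp add: powr_of_real)
    also have "t powr g * ((\<Sum>k<n. c g k * (- lam * t powr (- a)) ^ k) + (- lam * t powr (- a)) ^ n / Gamma (1 + g) * ?I t)
        = (\<Sum>k<n. c g k * (t powr g * (- lam * t powr (- a)) ^ k)) + (t powr g * (- lam * t powr (- a)) ^ n) / Gamma (1 + g) * ?I t"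
      by (simp add: distrib_left sum_distrib_left mult_ac)
    also have "\<dots> = (\<Sum>k<n. c g k * (- lam) ^ k * t powr (g - a * real k)) + (- lam) ^ n / Gamma (1 + g) * (t powr (- b) * ?I t)"
      unfolding pw by (simp add: b_def mult_ac)
    finally show ?case by simp
  qed
  ultimately show ?thesis by (rule Lim_transform_eventually)
qed

section \<open>Closed forms on one half-line\<close>

lemma J1_eq:
  assumes g: "- a < g" "g < 1" and sn: "sin (- pi * g / a) \<noteq> 0"
    and n: "a * (real n - 1) < g" "g < a * real n"
    and \<zeta>: "Re \<zeta> \<ge> 0" "\<zeta> \<noteq> 0"
  shows "J1 g \<zeta> = F g n \<zeta> - of_real (ell g a lam)"
proof -
  have g1: "- 1 < g" using g a by simp
  show ?thesis
  proof (rule eq_of_derivative_eq_at_large_reals[where J = "J1 g" and \<Phi> = "F g n" and J' = "\<lambda>\<zeta>. - G (g - 1) \<zeta>"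
          and T = "lam powr (1 / a)"])
    show "lam powr (1 / a) > 0" using lam by simp
    show "(F g n has_field_derivative - G (g - 1) (of_real t)) (at (of_real t))" if "t > lam powr (1 / a)" for t
      using g1 g(2) n(2) no_pole[OF g sn] that by (rule F_deriv_eq_G)
  qed (use g g1 n \<zeta> in \<open>auto intro: continuous_on_J1 J1_has_field_derivative F_holomorphic F_tendsto_ell[OF g(1) sn n] isCont_F\<close>)
qed

text \<open>The derivative of \<open>J2 g\<close> is \<open>- J1 (g - 1)\<close>, whose closed form is already known; its constant
  \<open>ell (g - 1)\<close> integrates to the linear term.\<close>

lemma J2_eq:
  assumes g: "1 - a < g" "g < 2" and sn: "sin (- pi * g / a) \<noteq> 0" "sin (- pi * (g - 1) / a) \<noteq> 0"
    and poles: "\<And>k. a * real k - g \<notin> \<int>\<^sub>\<le>\<^sub>0"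
    and n: "a * (real n - 1) < g" "g < a * real n"
    and \<zeta>: "Re \<zeta> \<ge> 0" "\<zeta> \<noteq> 0"
  shows "J2 g \<zeta> = F g n \<zeta> - of_real (ell g a lam) + \<zeta> * of_real (ell (g - 1) a lam)"
proof -
  have g1: "0 < g" using g a by simp
  obtain n' where n': "a * (real n' - 1) < g - 1" "g - 1 < a * real n'"
    using exists_order[of "g - 1"] g sn(2) by auto
  let ?\<Phi> = "\<lambda>\<zeta>. F g n \<zeta> + \<zeta> * of_real (ell (g - 1) a lam)"
  have "J2 g \<zeta> = ?\<Phi> \<zeta> - of_real (ell g a lam)"
  proof (rule eq_of_derivative_eq_at_large_reals[where J = "J2 g" and \<Phi> = ?\<Phi> and J' = "\<lambda>\<zeta>. - J1 (g - 1) \<zeta>"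
          and T = "lam powr (1 / a)"])
    show "lam powr (1 / a) > 0" using lam by simp
    show "(?\<Phi> has_field_derivative - J1 (g - 1) (of_real t)) (at (of_real t))" if t: "t > lam powr (1 / a)" for t
    proof -
      have "J1 (g - 1) (of_real t) = F (g - 1) n' (of_real t) - of_real (ell (g - 1) a lam)"
        using g sn(2) n' large_real(1)[OF t] by (intro J1_eq) auto
      moreover have "(?\<Phi> has_field_derivative - F (g - 1) n' (of_real t) + 1 * of_real (ell (g - 1) a lam)) (at (of_real t))"
        by (intro DERIV_add F_deriv_eq_F[OF g1 n(2) poles n'(2) t] DERIV_cmult_right DERIV_ident)
      ultimately show ?thesis by simp
    qed
    show "((\<lambda>t. ?\<Phi> (of_real t)) \<longlongrightarrow> of_real (ell g a lam)) (at_right 0)"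
    proof -
      have "((\<lambda>t. F g n (of_real t)) \<longlongrightarrow> of_real (ell g a lam)) (at_right 0)"
        using g1 a sn n by (intro F_tendsto_ell) auto
      moreover have "((\<lambda>t. complex_of_real t * of_real (ell (g - 1) a lam)) \<longlongrightarrow> of_real 0 * of_real (ell (g - 1) a lam)) (at_right 0)"
        by (intro tendsto_intros)
      ultimately show ?thesis using tendsto_add by fastforce
    qed
    show "?\<Phi> holomorphic_on right_half_plane"
      using g1 n by (intro holomorphic_intros F_holomorphic) auto
    show "isCont ?\<Phi> \<zeta>"
      using g1 n \<zeta> by (intro continuous_intros isCont_F) auto
  qed (use g \<zeta> in \<open>auto intro: continuous_on_J2 J2_has_field_derivative\<close>)
  then show ?thesis by simp
qed

text \<open>At \<open>g = - 1\<close> all coefficients are \<open>1\<close> and the series is geometric; this is the classical Laplace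
  transform of the Mittag-Leffler function.\<close>

lemma G_minus_1_large_real:
  assumes t: "t > lam powr (1 / a)"
  shows "G (- 1) (of_real t) = of_real t powr (of_real a - 1) / (of_real t powr of_real a + of_real lam)"
proof -
  note large = large_real[OF t]
  have "Gamma (a * real k + 1) > 0" for k
    using a by (intro Gamma_real_pos add_nonneg_pos) auto
  then have c: "c (- 1) k = 1" for k by (simp add: c_def less_imp_neq[THEN not_sym])
  have r: "\<bar>lam * t powr (- a)\<bar> < 1" using large(2) lam by (simp add: abs_mult)
  have "summable (\<lambda>k. c (- 1) k * (lam * t powr (- a)) ^ k)"
    using r unfolding c by simp
  from G_sums[OF _ large(1) this]
  have *: "(\<lambda>k. of_real (t powr (- 1) * (- lam * t powr (- a)) ^ k)) sums G (- 1) (of_real t)"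
    by (simp add: c)
  have "(\<lambda>k. t powr (- 1) * (- lam * t powr (- a)) ^ k) sums (t powr (- 1) * (1 / (1 - (- lam * t powr (- a)))))"
    using r by (intro sums_mult geometric_sums) (simp add: abs_mult)
  then have "(\<lambda>k. complex_of_real (t powr (- 1) * (- lam * t powr (- a)) ^ k)) sums of_real (t powr (- 1) * (1 / (1 - (- lam * t powr (- a)))))"
    by (simp only: sums_of_real_iff)
  with * have "G (- 1) (of_real t) = of_real (t powr (- 1) * (1 / (1 - (- lam * t powr (- a)))))"
    by (rule sums_unique2)
  also have "t powr (- 1) * (1 / (1 - (- lam * t powr (- a)))) = t powr (a - 1) / (t powr a + lam)"
  proof -
    have "t powr a > 0" using large(1) by simp
    then show ?thesis
      using large(1) lam by (simp add: powr_diff powr_minus field_simps)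
  qed
  also have "of_real (t powr (a - 1) / (t powr a + lam)) = complex_of_real t powr (of_real a - 1) / (of_real t powr of_real a + of_real lam)"
    using large(1) powr_of_real[of t "a - 1"] powr_of_real[of t a] by simp
  finally show ?thesis .
qed

lemma J1_0_eq:
  assumes \<zeta>: "Re \<zeta> \<ge> 0" "\<zeta> \<noteq> 0"
  shows "J1 0 \<zeta> = of_real (1 / a) * Ln (of_real lam / (\<zeta> powr of_real a + of_real lam))"
proof -
  let ?q = "\<lambda>\<zeta>. of_real lam / (\<zeta> powr of_real a + of_real lam)"
  let ?\<Phi> = "\<lambda>\<zeta>. of_real (1 / a) * Ln (?q \<zeta>)"
  have den: "Re (\<zeta> powr of_real a + of_real lam) > 0" if "Re \<zeta> \<ge> 0" "\<zeta> \<noteq> 0" for \<zeta>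
    using Re_powr_pos[OF that a] lam by simp
  have q: "?q \<zeta> \<notin> \<real>\<^sub>\<le>\<^sub>0" if "Re \<zeta> \<ge> 0" "\<zeta> \<noteq> 0" for \<zeta>
  proof -
    have "Re (?q \<zeta>) > 0"
      using den[OF that] lam by (simp add: Re_divide_of_real Re_divide complex_eq_iff power2_eq_square[symmetric] sum_power2_gt_zero_iff)
    then show ?thesis by (auto simp: complex_nonpos_Reals_iff)
  qed
  have deriv: "(?\<Phi> has_field_derivative - (\<zeta> powr (of_real a - 1) / (\<zeta> powr of_real a + of_real lam))) (at \<zeta>)"
    if z: "Re \<zeta> \<ge> 0" "\<zeta> \<noteq> 0" for \<zeta>
  proof -
    have nz: "\<zeta> powr of_real a + of_real lam \<noteq> 0" using den[OF z] by (auto simp: complex_eq_iff)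
    have "\<zeta> \<notin> \<real>\<^sub>\<le>\<^sub>0" using z by (rule not_nonpos_Reals_of_Re_nonneg)
    then have "((\<lambda>\<zeta>. \<zeta> powr of_real a + of_real lam) has_field_derivative of_real a * \<zeta> powr (of_real a - 1) + 0) (at \<zeta>)"
      by (intro DERIV_add has_field_derivative_powr DERIV_const)
    from DERIV_cmult[OF DERIV_chain2[OF has_field_derivative_Ln[OF q[OF z]] DERIV_divide[OF DERIV_const this nz]], of "of_real (1 / a)"]
    show ?thesis
    proof (rule DERIV_cong)
      have "of_real (1 / a) * (inverse (of_real lam / D) * ((0 * D - of_real lam * (of_real a * P + 0)) / (D * D))) = - (P / D)"
        if "D \<noteq> 0" for D P :: complex
        using that a lam by (simp add: field_simps)
      from this[OF nz] show "of_real (1 / a) * (inverse (?q \<zeta>) * ((0 * (\<zeta> powr of_real a + of_real lam)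
          - of_real lam * (of_real a * \<zeta> powr (of_real a - 1) + 0))
            / ((\<zeta> powr of_real a + of_real lam) * (\<zeta> powr of_real a + of_real lam))))
        = - (\<zeta> powr (of_real a - 1) / (\<zeta> powr of_real a + of_real lam))" .
    qed
  qed
  have "J1 0 \<zeta> = ?\<Phi> \<zeta> - 0"
  proof (rule eq_of_derivative_eq_at_large_reals[where J = "J1 0" and \<Phi> = ?\<Phi> and J' = "\<lambda>\<zeta>. - G (0 - 1) \<zeta>"
          and T = "lam powr (1 / a)"])
    show "lam powr (1 / a) > 0" using lam by simp
    show "(?\<Phi> has_field_derivative - G (0 - 1) (of_real t)) (at (of_real t))" if t: "t > lam powr (1 / a)" for t
      using deriv[of "of_real t"] large_real(1)[OF t] by (simp add: G_minus_1_large_real[OF t])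
    show "?\<Phi> holomorphic_on right_half_plane"
      unfolding holomorphic_on_open[OF open_right_half_plane] 
    proof (intro ballI exI)
      fix z assume "z \<in> right_half_plane"
      then show "(?\<Phi> has_field_derivative - (z powr (of_real a - 1) / (z powr of_real a + of_real lam))) (at z)"
        by (intro deriv) auto
    qed
    show "isCont ?\<Phi> \<zeta>" using deriv[OF \<zeta>] by (rule DERIV_isCont)
    show "((\<lambda>t. ?\<Phi> (of_real t)) \<longlongrightarrow> 0) (at_right 0)"
    proof -
      have "((\<lambda>t. t powr a) \<longlongrightarrow> 0) (at_right 0)"
        by (rule tendsto_zero_powrI[of _ _ _ a]) (use a in \<open>auto simp: eventually_at_filter\<close>)
      then have "((\<lambda>t. of_real (1 / a) * Ln (of_real lam / (of_real (t powr a) + of_real lam))) \<longlongrightarrow>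
          of_real (1 / a) * Ln (of_real lam / (of_real 0 + of_real lam))) (at_right 0)"
        using lam by (intro tendsto_intros) auto
      moreover have "\<forall>\<^sub>F t in at_right 0. complex_of_real (1 / a) * Ln (of_real lam / (of_real (t powr a) + of_real lam)) = ?\<Phi> (of_real t)"
        using eventually_at_right_less[of 0] by eventually_elim (simp add: powr_of_real)
      ultimately have "((\<lambda>t. ?\<Phi> (of_real t)) \<longlongrightarrow> of_real (1 / a) * Ln (of_real lam / (of_real 0 + of_real lam))) (at_right 0)"
        by (rule Lim_transform_eventually)
      then show ?thesis using lam by simp
    qed
  qed (use a \<zeta> J1_has_field_derivative[of 0] in \<open>auto intro: continuous_on_J1\<close>)
  then show ?thesis by simp
qed

end

lemma iz_pow_eq_powr:
  assumes s: "s = 1 \<or> s = - 1" and z: "z \<noteq> 0"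
  shows "iz_pow s a z = (- of_real s * \<i> * of_real z) powr of_real a"
proof -
  define \<theta> where "\<theta> = - s * sgn z * (pi / 2)"
  have \<theta>: "\<theta> = pi / 2 \<or> \<theta> = - (pi / 2)" using s z by (auto simp: \<theta>_def sgn_real_def)
  have "exp (of_real (ln \<bar>z\<bar>) + \<i> * of_real \<theta>) = - of_real s * \<i> * of_real z"
  proof -
    have "exp (of_real (ln \<bar>z\<bar>) + \<i> * of_real \<theta>) = of_real \<bar>z\<bar> * cis \<theta>"
      using z by (simp add: exp_add exp_of_real cis_conv_exp)
    also have "\<dots> = - of_real s * \<i> * of_real z"
      using s z by (auto simp: \<theta>_def sgn_real_def complex_eq_iff abs_if)
    finally show ?thesis .
  qed
  then have "Ln (- of_real s * \<i> * of_real z) = of_real (ln \<bar>z\<bar>) + \<i> * of_real \<theta>"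
    using Ln_unique[of "of_real (ln \<bar>z\<bar>) + \<i> * of_real \<theta>"] \<theta> pi_gt_zero by fastforce
  moreover have "- of_real s * \<i> * complex_of_real z \<noteq> 0" using s z by auto
  ultimately have "(- of_real s * \<i> * of_real z) powr of_real a = exp (of_real (a * ln \<bar>z\<bar>) + \<i> * of_real (a * \<theta>))"
    by (simp add: powr_def algebra_simps)
  also have "\<dots> = of_real (\<bar>z\<bar> powr a) * cis (a * \<theta>)"
    using z by (simp add: exp_add cis_conv_exp powr_def exp_of_real[symmetric])
  also have "cis (a * \<theta>) = of_real (cos (a * pi / 2)) - of_real s * \<i> * of_real (sin (a * pi / 2)) * of_real (sgn z)"
    using s z by (auto simp: \<theta>_def sgn_real_def complex_eq_iff)
  finally show ?thesis by (simp add: iz_pow_def)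
qed

lemma integral_eq_sum_of_half_lines:
  fixes f :: "real \<Rightarrow> 'b::{banach,second_countable_topology}"
  assumes f: "set_integrable lborel {0<..} f" "set_integrable lborel {0<..} (\<lambda>x. f (- x))" and "f 0 = 0"
  shows "(LINT x|lborel. f x) = (LINT x:{0<..}|lborel. f x) + (LINT x:{0<..}|lborel. f (- x))"
proof -
  let ?g = "\<lambda>x. indicator {..<0} x *\<^sub>R f x"
  have eq: "?g (0 + (- 1) * x) = indicator {0<..} x *\<^sub>R f (- x)" for x
    by (auto simp: indicator_def)
  have "integrable lborel ?g"
    using lborel_integrable_real_affine_iff[of "- 1" ?g 0] f(2) unfolding eq by (simp add: set_integrable_def)
  moreover have "(LINT x|lborel. ?g x) = (LINT x:{0<..}|lborel. f (- x))"
    using lborel_integral_real_affine[of "- 1" ?g 0] unfolding eq by (simp add: set_lebesgue_integral_def)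
  moreover have "f x = indicator {0<..} x *\<^sub>R f x + ?g x" for x
    using \<open>f 0 = 0\<close> by (cases x "0::real" rule: linorder_cases) auto
  then have "(LINT x|lborel. f x) = (LINT x|lborel. indicator {0<..} x *\<^sub>R f x + ?g x)" by simp
  ultimately show ?thesis
    using f(1) by (simp add: set_integrable_def set_lebesgue_integral_def)
qed

context relaxation
begin

text \<open>The contribution of one half-line with the truncation at \<open>x < 1\<close> of the Levy--Khintchine
  formula, in the variable \<open>\<zeta> = - s \<i> z\<close>. It differs from \<open>J1\<close> and \<open>J2\<close> by \<open>\<zeta>\<close> times the mean over the
  small and minus \<open>\<zeta>\<close> times the mean over the large jumps, respectively.\<close>

definition K :: "real \<Rightarrow> complex \<Rightarrow> complex" where
  "K g \<zeta> = (LINT x:{0<..}|lborel.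
     (exp (- \<zeta> * of_real x) - 1 + \<zeta> * of_real x * of_bool (x < 1)) * of_real (W g x))"

lemma mean_near_integrable:
  assumes "- a < g" "g < 1"
  shows "set_integrable lborel {0<..<1} (\<lambda>x. x * W g x)"
proof -
  have "set_integrable lborel {0<..<1} (\<lambda>x. min 1 x * W g x)"
    by (rule set_integrable_subset[OF W_integrable[OF assms]]) auto
  then show ?thesis
    by (subst set_integrable_cong[OF refl refl, of _ _ "\<lambda>x. min 1 x * W g x"]) auto
qed

lemma mean_far_integrable:
  assumes "1 - a < g" "g < 2"
  shows "set_integrable lborel {1<..} (\<lambda>x. x * W g x)"
proof -
  have "set_integrable lborel {1<..} (\<lambda>x. min 1 x * W (g - 1) x)"
    by (rule set_integrable_subset[OF W_integrable]) (use assms in auto)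
  then show ?thesis
    by (subst set_integrable_cong[OF refl refl, of _ _ "\<lambda>x. min 1 x * W (g - 1) x"]) (auto simp: W_shift)
qed

lemma K_eq_J1:
  assumes g: "- a < g" "g < 1" and \<zeta>: "Re \<zeta> \<ge> 0"
  shows "set_integrable lborel {0<..} (\<lambda>x. (exp (- \<zeta> * of_real x) - 1 + \<zeta> * of_real x * of_bool (x < 1)) * of_real (W g x))"
    and "K g \<zeta> = J1 g \<zeta> + \<zeta> * of_real (LINT x:{0<..<1}|lborel. x * W g x)"
proof -
  let ?h = "\<lambda>x. indicator {0<..} x *\<^sub>R ((exp (- \<zeta> * of_real x) - 1) * of_real (W g x))"
  let ?k = "\<lambda>x. \<zeta> * of_real (indicator {0<..<1} x *\<^sub>R (x * W g x))"
  have h: "integrable lborel ?h" using J1_integrable[OF g \<zeta>] by (simp only: set_integrable_def)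
  have k: "integrable lborel ?k"
    using mean_near_integrable[OF g] unfolding set_integrable_def
    by (intro integrable_mult_right integrable_of_real)
  have eq: "indicator {0<..} x *\<^sub>R ((exp (- \<zeta> * of_real x) - 1 + \<zeta> * of_real x * of_bool (x < 1)) * of_real (W g x)) = ?h x + ?k x" for x
    by (auto simp: indicator_def algebra_simps)
  show "set_integrable lborel {0<..} (\<lambda>x. (exp (- \<zeta> * of_real x) - 1 + \<zeta> * of_real x * of_bool (x < 1)) * of_real (W g x))"
    unfolding set_integrable_def eq using h k by (rule Bochner_Integration.integrable_add)
  have "K g \<zeta> = (LINT x|lborel. ?h x) + (LINT x|lborel. ?k x)"
    unfolding K_def set_lebesgue_integral_def eq using h k by (rule Bochner_Integration.integral_add)
  also have "(LINT x|lborel. ?k x) = \<zeta> * of_real (LINT x:{0<..<1}|lborel. x * W g x)"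
    unfolding set_lebesgue_integral_def integral_mult_right_zero integral_complex_of_real ..
  finally show "K g \<zeta> = J1 g \<zeta> + \<zeta> * of_real (LINT x:{0<..<1}|lborel. x * W g x)"
    by (simp add: J1_def set_lebesgue_integral_def)
qed

lemma K_eq_J2:
  assumes g: "1 - a < g" "g < 2" and \<zeta>: "Re \<zeta> \<ge> 0"
  shows "set_integrable lborel {0<..} (\<lambda>x. (exp (- \<zeta> * of_real x) - 1 + \<zeta> * of_real x * of_bool (x < 1)) * of_real (W g x))"
    and "K g \<zeta> = J2 g \<zeta> - \<zeta> * of_real (LINT x:{1<..}|lborel. x * W g x)"
proof -
  let ?f = "\<lambda>x. indicator {0<..} x *\<^sub>R ((exp (- \<zeta> * of_real x) - 1 + \<zeta> * of_real x * of_bool (x < 1)) * of_real (W g x))"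
  let ?h = "\<lambda>x. indicator {0<..} x *\<^sub>R ((exp (- \<zeta> * of_real x) - 1 + \<zeta> * of_real x) * of_real (W g x))"
  let ?k = "\<lambda>x. \<zeta> * of_real (indicator {1<..} x *\<^sub>R (x * W g x))"
  have h: "integrable lborel ?h" using J2_integrable[OF g \<zeta>] by (simp only: set_integrable_def)
  have k: "integrable lborel ?k"
    using mean_far_integrable[OF g] unfolding set_integrable_def
    by (intro integrable_mult_right integrable_of_real)
  have eq: "AE x in lborel. ?h x - ?k x = ?f x"
    using AE_lborel_singleton[of 1] by eventually_elim (auto simp: indicator_def algebra_simps)
  have meas: "?f \<in> borel_measurable lborel" by measurable
  have hk: "integrable lborel (\<lambda>x. ?h x - ?k x)" using h k by (rule Bochner_Integration.integrable_diff)
  show "set_integrable lborel {0<..} (\<lambda>x. (exp (- \<zeta> * of_real x) - 1 + \<zeta> * of_real x * of_bool (x < 1)) * of_real (W g x))"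
    unfolding set_integrable_def by (rule integrable_cong_AE_imp[OF hk meas]) (use eq in \<open>auto elim: eventually_mono\<close>)
  have "K g \<zeta> = (LINT x|lborel. ?h x - ?k x)"
    unfolding K_def set_lebesgue_integral_def
    by (rule integral_cong_AE[OF meas]) (use hk eq in \<open>auto elim: eventually_mono\<close>)
  also have "\<dots> = (LINT x|lborel. ?h x) - (LINT x|lborel. ?k x)"
    using h k by (rule Bochner_Integration.integral_diff)
  also have "(LINT x|lborel. ?k x) = \<zeta> * of_real (LINT x:{1<..}|lborel. x * W g x)"
    unfolding set_lebesgue_integral_def integral_mult_right_zero integral_complex_of_real ..
  finally show "K g \<zeta> = J2 g \<zeta> - \<zeta> * of_real (LINT x:{1<..}|lborel. x * W g x)"
    by (simp add: J2_def set_lebesgue_integral_def)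
qed

lemma K_integrable:
  assumes "0 \<le> g" "g < 2" "Re \<zeta> \<ge> 0"
  shows "set_integrable lborel {0<..} (\<lambda>x. (exp (- \<zeta> * of_real x) - 1 + \<zeta> * of_real x * of_bool (x < 1)) * of_real (W g x))"
proof (cases "g < 1")
  case True then show ?thesis using assms a by (intro K_eq_J1(1)) auto
next
  case False then show ?thesis using assms a by (intro K_eq_J2(1)) auto
qed

lemma continuous_on_K:
  assumes g: "0 \<le> g" "g < 2"
  shows "continuous_on {\<zeta>. 0 \<le> Re \<zeta>} (K g)"
proof (cases "g < 1")
  case True
  then have "continuous_on {\<zeta>. 0 \<le> Re \<zeta>} (\<lambda>\<zeta>. J1 g \<zeta> + \<zeta> * of_real (LINT x:{0<..<1}|lborel. x * W g x))"
    using g a by (intro continuous_intros continuous_on_J1) auto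
  then show ?thesis
    by (rule continuous_on_eq) (use True g a K_eq_J1(2)[of g] in auto)
next
  case False
  then have "continuous_on {\<zeta>. 0 \<le> Re \<zeta>} (\<lambda>\<zeta>. J2 g \<zeta> - \<zeta> * of_real (LINT x:{1<..}|lborel. x * W g x))"
    using g a by (intro continuous_intros continuous_on_J2) auto
  then show ?thesis
    by (rule continuous_on_eq) (use False g a K_eq_J2(2)[of g] in auto)
qed

lemma F_eq_R21:
  assumes "- 1 < g" "g < a * real n" "- g \<notin> \<int>\<^sub>\<le>\<^sub>0" "s = 1 \<or> s = - 1" "z \<noteq> 0"
  shows "F g n (- of_real s * \<i> * of_real z)
    = of_real (Gamma (- g)) * iz_pow s g z * R21 1 (of_real (- g)) 1 a (of_real (- lam) / iz_pow s a z)"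
proof -
  let ?\<zeta> = "- of_real s * \<i> * complex_of_real z"
  have "?\<zeta> \<noteq> 0" "Re ?\<zeta> \<ge> 0" using assms by auto
  then have "arg ?\<zeta> \<in> cut_plane" by (intro arg_in_cut_plane)
  from R21_eq_R[OF assms(1-3) this] show ?thesis
    using iz_pow_eq_powr[OF assms(4,5)] by (simp add: F_def arg_def mult_ac)
qed

text \<open>On the line \<open>a + g = 1\<close>, where the mean of the large jumps would diverge, \<open>ell (g - 1)\<close> has a
  pole.\<close>

lemma high_defined_imp_ne_1:
  assumes "high_defined g a"
  shows "a + g \<noteq> 1"
proof
  assume "a + g = 1"
  then have "g - 1 = - a" by simp
  then have "- pi * (g - 1) / a = pi" using a by simp
  then show False using assms by (simp add: high_defined_def ell_defined_def)
qed

text \<open>The hypotheses \<open>near\<close> and \<open>far\<close> express the means of a density \<open>m\<close> on the half-line of sign \<open>s\<close>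
  through \<open>W g\<close>, each only in the range of \<open>g\<close> where the regime in question uses it.\<close>

lemma half_line_part_eq:
  assumes s: "s = 1 \<or> s = - 1" and z: "z \<noteq> 0" and g: "0 \<le> g" "g < 2"
    and defined: "half_line_defined g a"
    and near: "g < 1 \<Longrightarrow> (LINT x:{x. \<bar>x\<bar> < 1 \<and> s * x > 0}|lborel. x * m x) = s * \<delta> * (LINT x:{0<..<1}|lborel. x * W g x)"
    and far: "1 - a < g \<Longrightarrow> (LINT x:{x. \<bar>x\<bar> > 1 \<and> s * x > 0}|lborel. x * m x) = s * \<delta> * (LINT x:{1<..}|lborel. x * W g x)"
  shows "half_line_part s m g a lam \<delta> z = of_real \<delta> * K g (- of_real s * \<i> * of_real z)"
proof -
  define \<zeta> where "\<zeta> = - of_real s * \<i> * complex_of_real z"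
  have \<zeta>: "Re \<zeta> \<ge> 0" "\<zeta> \<noteq> 0" using s z by (auto simp: \<zeta>_def)
  have iz: "iz_pow s a z = \<zeta> powr of_real a" unfolding \<zeta>_def by (rule iz_pow_eq_powr[OF s z])
  consider "g = 0" | "g \<noteq> 0" "a + g < 1" | "g \<noteq> 0" "a + g \<ge> 1" by linarith
  then show ?thesis
  proof cases
    case 1
    have "K 0 \<zeta> = of_real (1 / a) * Ln (of_real lam / (\<zeta> powr of_real a + of_real lam))
        + \<zeta> * of_real (LINT x:{0<..<1}|lborel. x * W 0 x)"
      using K_eq_J1(2)[of 0 \<zeta>] J1_0_eq[OF \<zeta>] \<zeta> a by simp
    then have K: "K g \<zeta> = of_real (1 / a) * Ln (of_real lam / (\<zeta> powr of_real a + of_real lam))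
        + \<zeta> * of_real (LINT x:{0<..<1}|lborel. x * W 0 x)" by (simp only: 1)
    show ?thesis
      using 1 near unfolding \<zeta>_def[symmetric] K
      by (simp add: half_line_part_def term_log_def iz \<zeta>_def algebra_simps)
  next
    case 2
    then have low: "- g \<notin> \<int>\<^sub>\<le>\<^sub>0" "sin (- pi * g / a) \<noteq> 0"
      using defined by (auto simp: half_line_defined_def low_defined_def ell_defined_def)
    have g': "- a < g" "- 1 < g" "g < 1" using 2 g a by auto
    obtain n where n: "a * (real n - 1) < g" "g < a * real n"
      using exists_order[OF g'(1) low(2)] by auto
    have "K g \<zeta> = F g n \<zeta> - of_real (ell g a lam) + \<zeta> * of_real (LINT x:{0<..<1}|lborel. x * W g x)"
      using K_eq_J1(2)[OF g'(1,3) \<zeta>(1)] J1_eq[OF g'(1,3) low(2) n \<zeta>] by simp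
    also have "F g n \<zeta> = of_real (Gamma (- g)) * iz_pow s g z * R21 1 (of_real (- g)) 1 a (of_real (- lam) / iz_pow s a z)"
      unfolding \<zeta>_def by (rule F_eq_R21[OF g'(2) n(2) low(1) s z])
    finally have K: "K g \<zeta> = of_real (Gamma (- g)) * iz_pow s g z * R21 1 (of_real (- g)) 1 a (of_real (- lam) / iz_pow s a z)
        - of_real (ell g a lam) + \<zeta> * of_real (LINT x:{0<..<1}|lborel. x * W g x)" .
    show ?thesis
      using 2 near[OF g'(3)] unfolding \<zeta>_def[symmetric] K
      by (simp add: half_line_part_def term_low_def \<zeta>_def algebra_simps)
  next
    case 3
    then have "high_defined g a" using defined by (simp add: half_line_defined_def)
    then have high: "- g \<notin> \<int>\<^sub>\<le>\<^sub>0" "sin (- pi * g / a) \<noteq> 0" "sin (- pi * (g - 1) / a) \<noteq> 0"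
      "R21_defined (of_real (- g)) 1 a"
      by (auto simp: high_defined_def low_defined_def ell_defined_def)
    have "a + g \<noteq> 1" using \<open>high_defined g a\<close> by (rule high_defined_imp_ne_1)
    then have g': "1 - a < g" "- a < g" "- 1 < g" using 3 g a by auto
    have poles: "a * real k - g \<notin> \<int>\<^sub>\<le>\<^sub>0" for k
    proof -
      have "complex_of_real (a * real k - g) \<notin> \<int>\<^sub>\<le>\<^sub>0"
        using high(4) by (simp add: R21_defined_def add.commute)
      then show ?thesis by (simp only: of_real_in_nonpos_Ints_iff not_False_eq_True)
    qed
    obtain n where n: "a * (real n - 1) < g" "g < a * real n"
      using exists_order[OF g'(2) high(2)] by auto
    have "K g \<zeta> = F g n \<zeta> - of_real (ell g a lam) + \<zeta> * of_real (ell (g - 1) a lam) - \<zeta> * of_real (LINT x:{1<..}|lborel. x * W g x)"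
      using K_eq_J2(2)[OF g'(1) g(2) \<zeta>(1)] J2_eq[OF g'(1) g(2) high(2,3) poles n \<zeta>] by simp
    also have "F g n \<zeta> = of_real (Gamma (- g)) * iz_pow s g z * R21 1 (of_real (- g)) 1 a (of_real (- lam) / iz_pow s a z)"
      unfolding \<zeta>_def by (rule F_eq_R21[OF g'(3) n(2) high(1) s z])
    finally have K: "K g \<zeta> = of_real (Gamma (- g)) * iz_pow s g z * R21 1 (of_real (- g)) 1 a (of_real (- lam) / iz_pow s a z)
        - of_real (ell g a lam) + \<zeta> * of_real (ell (g - 1) a lam) - \<zeta> * of_real (LINT x:{1<..}|lborel. x * W g x)" .
    show ?thesis
      using 3 far[OF g'(1)] unfolding \<zeta>_def[symmetric] K
      by (simp add: half_line_part_def term_high_def \<zeta>_def algebra_simps)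
  qed
qed

end

section \<open>The two-sided exponent\<close>

locale two_sided =
  pos: relaxation \<alpha>\<^sub>p lam\<^sub>p + neg: relaxation \<alpha>\<^sub>m lam\<^sub>m for \<alpha>\<^sub>p lam\<^sub>p \<alpha>\<^sub>m lam\<^sub>m +
  fixes \<gamma>\<^sub>p \<gamma>\<^sub>m \<delta>\<^sub>p \<delta>\<^sub>m :: real
  assumes \<gamma>\<^sub>p: "0 \<le> \<gamma>\<^sub>p" "\<gamma>\<^sub>p < 2" and \<gamma>\<^sub>m: "0 \<le> \<gamma>\<^sub>m" "\<gamma>\<^sub>m < 2"
begin

abbreviation m :: "real \<Rightarrow> real" where
  "m \<equiv> gtgs_density \<gamma>\<^sub>p \<gamma>\<^sub>m \<alpha>\<^sub>p \<alpha>\<^sub>m lam\<^sub>p lam\<^sub>m \<delta>\<^sub>p \<delta>\<^sub>m"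

lemma m_pos: "x > 0 \<Longrightarrow> m x = \<delta>\<^sub>p * pos.W \<gamma>\<^sub>p x"
  by (simp add: gtgs_density_def pos.W_def pos.u_def powr_add powr_diff powr_minus field_simps)

lemma m_neg: "x > 0 \<Longrightarrow> m (- x) = \<delta>\<^sub>m * neg.W \<gamma>\<^sub>m x"
  by (simp add: gtgs_density_def neg.W_def neg.u_def powr_add powr_diff powr_minus field_simps)

lemma m_0: "m 0 = 0"
  by (simp add: gtgs_density_def)

lemma levy_exponent_eq:
  "levy_exponent \<mu> m z = \<i> * of_real z * of_real \<mu> + of_real \<delta>\<^sub>p * pos.K \<gamma>\<^sub>p (- \<i> * of_real z)
     + of_real \<delta>\<^sub>m * neg.K \<gamma>\<^sub>m (\<i> * of_real z)"
proof -
  let ?f = "\<lambda>x. (exp (\<i> * of_real z * of_real x) - 1 - \<i> * of_real z * of_real x * of_bool (\<bar>x\<bar> < 1)) * complex_of_real (m x)"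
  let ?k = "\<lambda>\<zeta> x. exp (- \<zeta> * of_real x) - 1 + \<zeta> * of_real x * of_bool (x < 1)"
  have f_pos: "?f x = of_real \<delta>\<^sub>p * (?k (- \<i> * of_real z) x * of_real (pos.W \<gamma>\<^sub>p x))" if "x \<in> {0<..}" for x
    using that by (simp add: m_pos algebra_simps)
  have f_neg: "?f (- x) = of_real \<delta>\<^sub>m * (?k (\<i> * of_real z) x * of_real (neg.W \<gamma>\<^sub>m x))" if "x \<in> {0<..}" for x
    using that by (simp add: m_neg algebra_simps)
  have "set_integrable lborel {0<..} (\<lambda>x. of_real \<delta>\<^sub>p * (?k (- \<i> * of_real z) x * of_real (pos.W \<gamma>\<^sub>p x)))"
    using \<gamma>\<^sub>p by (intro set_integrable_mult_right pos.K_integrable) auto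
  then have 1: "set_integrable lborel {0<..} ?f"
    by (subst set_integrable_cong[OF refl refl f_pos])
  have "set_integrable lborel {0<..} (\<lambda>x. of_real \<delta>\<^sub>m * (?k (\<i> * of_real z) x * of_real (neg.W \<gamma>\<^sub>m x)))"
    using \<gamma>\<^sub>m by (intro set_integrable_mult_right neg.K_integrable) auto
  then have 2: "set_integrable lborel {0<..} (\<lambda>x. ?f (- x))"
    by (subst set_integrable_cong[OF refl refl f_neg])
  have "(LINT x|lborel. ?f x) = (LINT x:{0<..}|lborel. ?f x) + (LINT x:{0<..}|lborel. ?f (- x))"
    using 1 2 by (rule integral_eq_sum_of_half_lines) (simp add: m_0)
  also have "(LINT x:{0<..}|lborel. ?f x) = (LINT x:{0<..}|lborel. of_real \<delta>\<^sub>p * (?k (- \<i> * of_real z) x * of_real (pos.W \<gamma>\<^sub>p x)))"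
    by (intro set_lebesgue_integral_cong) (use f_pos in auto)
  also have "\<dots> = of_real \<delta>\<^sub>p * pos.K \<gamma>\<^sub>p (- \<i> * of_real z)"
    unfolding pos.K_def by (rule set_integral_mult_right)
  also have "(LINT x:{0<..}|lborel. ?f (- x)) = (LINT x:{0<..}|lborel. of_real \<delta>\<^sub>m * (?k (\<i> * of_real z) x * of_real (neg.W \<gamma>\<^sub>m x)))"
    by (intro set_lebesgue_integral_cong) (use f_neg in auto)
  also have "\<dots> = of_real \<delta>\<^sub>m * neg.K \<gamma>\<^sub>m (\<i> * of_real z)"
    unfolding neg.K_def by (rule set_integral_mult_right)
  finally show ?thesis by (simp add: levy_exponent_def add.assoc)
qed

lemma mean_positive_half:
  "(LINT x:{x. P \<bar>x\<bar> \<and> 1 * x > 0}|lborel. x * m x) = 1 * \<delta>\<^sub>p * (LINT x:{x. P x \<and> x > 0}|lborel. x * pos.W \<gamma>\<^sub>p x)"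
proof -
  have "(LINT x:{x. P \<bar>x\<bar> \<and> 1 * x > 0}|lborel. x * m x) = (LINT x:{x. P x \<and> x > 0}|lborel. \<delta>\<^sub>p * (x * pos.W \<gamma>\<^sub>p x))"
    unfolding set_lebesgue_integral_def
    by (intro Bochner_Integration.integral_cong) (auto simp: indicator_def m_pos)
  then show ?thesis by simp
qed

lemma mean_negative_half:
  "(LINT x:{x. P \<bar>x\<bar> \<and> - 1 * x > 0}|lborel. x * m x) = - 1 * \<delta>\<^sub>m * (LINT x:{x. P x \<and> x > 0}|lborel. x * neg.W \<gamma>\<^sub>m x)"
proof -
  let ?A = "{x::real. P \<bar>x\<bar> \<and> - 1 * x > 0}"
  have "(LINT x:?A|lborel. x * m x) = (LINT x|lborel. indicator ?A (- x) *\<^sub>R (- x * m (- x)))"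
    unfolding set_lebesgue_integral_def by (subst lborel_integral_real_affine[of "- 1" _ 0]) auto
  also have "\<dots> = (LINT x:{x. P x \<and> x > 0}|lborel. (- 1 * \<delta>\<^sub>m) * (x * neg.W \<gamma>\<^sub>m x))"
    unfolding set_lebesgue_integral_def
    by (intro Bochner_Integration.integral_cong) (auto simp: indicator_def m_neg)
  also have "\<dots> = - 1 * \<delta>\<^sub>m * (LINT x:{x. P x \<and> x > 0}|lborel. x * neg.W \<gamma>\<^sub>m x)"
    by (rule set_integral_mult_right)
  finally show ?thesis .
qed

lemma mean_split:
  assumes "set_integrable lborel {x. P x \<and> x > 0} (\<lambda>x. x * pos.W \<gamma>\<^sub>p x)"
    and "set_integrable lborel {x. P x \<and> x > 0} (\<lambda>x. x * neg.W \<gamma>\<^sub>m x)"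
  shows "(LINT x:{x. P \<bar>x\<bar>}|lborel. x * m x)
    = (LINT x:{x. P \<bar>x\<bar> \<and> 1 * x > 0}|lborel. x * m x) + (LINT x:{x. P \<bar>x\<bar> \<and> - 1 * x > 0}|lborel. x * m x)"
proof -
  let ?B = "{x. P x \<and> x > 0}"
  let ?f = "\<lambda>x. indicator {x. P \<bar>x\<bar>} x *\<^sub>R (x * m x)"
  have f_pos: "indicator {0<..} x *\<^sub>R ?f x = indicator ?B x *\<^sub>R (\<delta>\<^sub>p * (x * pos.W \<gamma>\<^sub>p x))" for x
    by (auto simp: indicator_def m_pos)
  have f_neg: "indicator {0<..} x *\<^sub>R ?f (- x) = indicator ?B x *\<^sub>R ((- 1 * \<delta>\<^sub>m) * (x * neg.W \<gamma>\<^sub>m x))" for x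
    by (auto simp: indicator_def m_neg)
  have 1: "set_integrable lborel {0<..} ?f"
    using set_integrable_mult_right[OF assms(1), of "\<delta>\<^sub>p"] unfolding set_integrable_def f_pos by simp
  have 2: "set_integrable lborel {0<..} (\<lambda>x. ?f (- x))"
    using set_integrable_mult_right[OF assms(2), of "- 1 * \<delta>\<^sub>m"] unfolding set_integrable_def f_neg by simp
  have "(LINT x:{x. P \<bar>x\<bar>}|lborel. x * m x) = (LINT x:{0<..}|lborel. ?f x) + (LINT x:{0<..}|lborel. ?f (- x))"
    using integral_eq_sum_of_half_lines[OF 1 2] by (simp add: set_lebesgue_integral_def)
  also have "(LINT x:{0<..}|lborel. ?f x) = 1 * \<delta>\<^sub>p * (LINT x:?B|lborel. x * pos.W \<gamma>\<^sub>p x)"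
    unfolding set_integral_mult_right[symmetric] unfolding set_lebesgue_integral_def f_pos by simp
  also have "(LINT x:{0<..}|lborel. ?f (- x)) = - 1 * \<delta>\<^sub>m * (LINT x:?B|lborel. x * neg.W \<gamma>\<^sub>m x)"
    unfolding set_integral_mult_right[symmetric] unfolding set_lebesgue_integral_def f_neg ..
  finally show ?thesis
    unfolding mean_positive_half mean_negative_half .
qed

lemma near_and_far_sets:
  "{x::real. x < 1 \<and> x > 0} = {0<..<1}" "{x::real. x > 1 \<and> x > 0} = {1<..}"
  by auto

lemmas mean_near = mean_positive_half[of "\<lambda>r. r < 1", unfolded near_and_far_sets]
  mean_negative_half[of "\<lambda>r. r < 1", unfolded near_and_far_sets]

lemmas mean_far = mean_positive_half[of "\<lambda>r. r > 1", unfolded near_and_far_sets]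
  mean_negative_half[of "\<lambda>r. r > 1", unfolded near_and_far_sets]

lemma mean_near_split:
  assumes "\<gamma>\<^sub>p < 1" "\<gamma>\<^sub>m < 1"
  shows "(LINT x:{x. \<bar>x\<bar> < 1}|lborel. x * m x)
    = (LINT x:{x. \<bar>x\<bar> < 1 \<and> 1 * x > 0}|lborel. x * m x) + (LINT x:{x. \<bar>x\<bar> < 1 \<and> - 1 * x > 0}|lborel. x * m x)"
  by (rule mean_split; unfold near_and_far_sets)
     (use assms \<gamma>\<^sub>p \<gamma>\<^sub>m pos.a neg.a in \<open>auto intro: pos.mean_near_integrable neg.mean_near_integrable\<close>)

lemma mean_far_split:
  assumes "1 - \<alpha>\<^sub>p < \<gamma>\<^sub>p" "1 - \<alpha>\<^sub>m < \<gamma>\<^sub>m"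
  shows "(LINT x:{x. \<bar>x\<bar> > 1}|lborel. x * m x)
    = (LINT x:{x. \<bar>x\<bar> > 1 \<and> 1 * x > 0}|lborel. x * m x) + (LINT x:{x. \<bar>x\<bar> > 1 \<and> - 1 * x > 0}|lborel. x * m x)"
  by (rule mean_split; unfold near_and_far_sets)
     (use assms \<gamma>\<^sub>p \<gamma>\<^sub>m in \<open>auto intro: pos.mean_far_integrable neg.mean_far_integrable\<close>)

lemma levy_exponent_tendsto_0: "(levy_exponent \<mu> m \<longlongrightarrow> levy_exponent \<mu> m 0) (at 0)"
proof -
  have "((\<lambda>z. pos.K \<gamma>\<^sub>p (- \<i> * of_real z)) \<longlongrightarrow> pos.K \<gamma>\<^sub>p (- \<i> * of_real 0)) (at 0)"
    by (rule continuous_on_tendsto_compose[OF pos.continuous_on_K[OF \<gamma>\<^sub>p]])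
       (intro tendsto_intros | simp)+
  moreover have "((\<lambda>z. neg.K \<gamma>\<^sub>m (\<i> * of_real z)) \<longlongrightarrow> neg.K \<gamma>\<^sub>m (\<i> * of_real 0)) (at 0)"
    by (rule continuous_on_tendsto_compose[OF neg.continuous_on_K[OF \<gamma>\<^sub>m]])
       (intro tendsto_intros | simp)+
  ultimately show ?thesis
    unfolding levy_exponent_eq[abs_def] by (intro tendsto_intros)
qed

text \<open>The limit at \<open>0\<close> costs nothing: the exponent is continuous, so any formula for it off \<open>0\<close> has
  the right limit.\<close>

lemma eq_with_limit_at_0_levy_exponent:
  assumes "\<And>z. z \<noteq> 0 \<Longrightarrow> levy_exponent \<mu> m z = \<Phi> z"
  shows "eq_with_limit_at_0 (levy_exponent \<mu> m) \<Phi>"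
  unfolding eq_with_limit_at_0_def
proof (intro conjI allI impI assms)
  show "(\<Phi> \<longlongrightarrow> levy_exponent \<mu> m 0) (at 0)"
    by (rule Lim_transform_eventually[OF levy_exponent_tendsto_0])
       (auto simp: eventually_at_filter assms)
qed

text \<open>The general case, in which the two half-lines may be in different regimes. The three pure cases
  follow from it by adding up the means of the half-lines.\<close>

lemma levy_exponent_eq_half_line_parts:
  assumes "half_line_defined \<gamma>\<^sub>p \<alpha>\<^sub>p" "half_line_defined \<gamma>\<^sub>m \<alpha>\<^sub>m" and z: "z \<noteq> 0"
  shows "levy_exponent \<mu> m z = \<i> * of_real z * of_real \<mu> + half_line_part 1 m \<gamma>\<^sub>p \<alpha>\<^sub>p lam\<^sub>p \<delta>\<^sub>p z
    + half_line_part (- 1) m \<gamma>\<^sub>m \<alpha>\<^sub>m lam\<^sub>m \<delta>\<^sub>m z"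
proof -
  have "half_line_part 1 m \<gamma>\<^sub>p \<alpha>\<^sub>p lam\<^sub>p \<delta>\<^sub>p z = of_real \<delta>\<^sub>p * pos.K \<gamma>\<^sub>p (- of_real 1 * \<i> * of_real z)"
    by (intro pos.half_line_part_eq z \<gamma>\<^sub>p assms mean_near(1) mean_far(1)) simp
  moreover have "half_line_part (- 1) m \<gamma>\<^sub>m \<alpha>\<^sub>m lam\<^sub>m \<delta>\<^sub>m z = of_real \<delta>\<^sub>m * neg.K \<gamma>\<^sub>m (- of_real (- 1) * \<i> * of_real z)"
    by (intro neg.half_line_part_eq z \<gamma>\<^sub>m assms mean_near(2) mean_far(2)) simp
  ultimately show ?thesis by (simp add: levy_exponent_eq)
qed

lemma levy_exponent_log:
  assumes "\<gamma>\<^sub>p = 0" "\<gamma>\<^sub>m = 0"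
  shows "levy_exponent \<mu> m z = term_log 1 \<alpha>\<^sub>p lam\<^sub>p \<delta>\<^sub>p z + term_log (- 1) \<alpha>\<^sub>m lam\<^sub>m \<delta>\<^sub>m z
    + \<i> * of_real z * of_real (\<mu> - (LINT x:{x. \<bar>x\<bar> < 1}|lborel. x * m x))"
proof (cases "z = 0")
  case True
  then show ?thesis
    using pos.a pos.lam neg.a neg.lam by (simp add: levy_exponent_def term_log_def iz_pow_def)
next
  case False
  have "half_line_defined \<gamma>\<^sub>p \<alpha>\<^sub>p" "half_line_defined \<gamma>\<^sub>m \<alpha>\<^sub>m"
    using assms by (simp_all add: half_line_defined_def)
  from levy_exponent_eq_half_line_parts[OF this False] show ?thesis
    using assms mean_near_split by (simp add: half_line_part_def algebra_simps)
qed

lemma levy_exponent_low: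
  assumes "\<alpha>\<^sub>p + \<gamma>\<^sub>p < 1" "\<alpha>\<^sub>m + \<gamma>\<^sub>m < 1" "low_defined \<gamma>\<^sub>p \<alpha>\<^sub>p" "low_defined \<gamma>\<^sub>m \<alpha>\<^sub>m" and z: "z \<noteq> 0"
  shows "levy_exponent \<mu> m z = term_low 1 \<gamma>\<^sub>p \<alpha>\<^sub>p lam\<^sub>p \<delta>\<^sub>p z + term_low (- 1) \<gamma>\<^sub>m \<alpha>\<^sub>m lam\<^sub>m \<delta>\<^sub>m z
    + \<i> * of_real z * of_real (\<mu> - (LINT x:{x. \<bar>x\<bar> < 1}|lborel. x * m x))"
proof -
  have nz: "\<gamma>\<^sub>p \<noteq> 0" "\<gamma>\<^sub>m \<noteq> 0" using assms by (auto simp: low_defined_def)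
  have "half_line_defined \<gamma>\<^sub>p \<alpha>\<^sub>p" "half_line_defined \<gamma>\<^sub>m \<alpha>\<^sub>m"
    using assms by (simp_all add: half_line_defined_def)
  from levy_exponent_eq_half_line_parts[OF this z] show ?thesis
    using assms nz mean_near_split pos.a neg.a by (simp add: half_line_part_def algebra_simps)
qed

lemma levy_exponent_high:
  assumes "\<alpha>\<^sub>p + \<gamma>\<^sub>p \<ge> 1" "\<alpha>\<^sub>m + \<gamma>\<^sub>m \<ge> 1" "high_defined \<gamma>\<^sub>p \<alpha>\<^sub>p" "high_defined \<gamma>\<^sub>m \<alpha>\<^sub>m" and z: "z \<noteq> 0"
  shows "levy_exponent \<mu> m z = term_high 1 \<gamma>\<^sub>p \<alpha>\<^sub>p lam\<^sub>p \<delta>\<^sub>p z + term_high (- 1) \<gamma>\<^sub>m \<alpha>\<^sub>m lam\<^sub>m \<delta>\<^sub>m z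
    + \<i> * of_real z * of_real (\<mu> + (LINT x:{x. \<bar>x\<bar> > 1}|lborel. x * m x))"
proof -
  have nz: "\<gamma>\<^sub>p \<noteq> 0" "\<gamma>\<^sub>m \<noteq> 0" using assms by (auto simp: high_defined_def low_defined_def)
  have "half_line_defined \<gamma>\<^sub>p \<alpha>\<^sub>p" "half_line_defined \<gamma>\<^sub>m \<alpha>\<^sub>m"
    using assms by (simp_all add: half_line_defined_def)
  note eq = levy_exponent_eq_half_line_parts[OF this z]
  have "\<alpha>\<^sub>p + \<gamma>\<^sub>p \<noteq> 1" "\<alpha>\<^sub>m + \<gamma>\<^sub>m \<noteq> 1"
    using pos.high_defined_imp_ne_1 neg.high_defined_imp_ne_1 assms by auto
  then have "1 - \<alpha>\<^sub>p < \<gamma>\<^sub>p" "1 - \<alpha>\<^sub>m < \<gamma>\<^sub>m" using assms by auto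
  from mean_far_split[OF this] eq show ?thesis
    using assms nz by (simp add: half_line_part_def algebra_simps)
qed

end

theorem theorem4:
  fixes M :: "'a measure" and X :: "'a \<Rightarrow> real"
    and \<gamma>\<^sub>p \<gamma>\<^sub>m \<alpha>\<^sub>p \<alpha>\<^sub>m lam\<^sub>p lam\<^sub>m \<delta>\<^sub>p \<delta>\<^sub>m \<mu> \<mu>0 \<mu>1 :: real
    and m :: "real \<Rightarrow> real" and \<psi> :: "real \<Rightarrow> complex"
  assumes "\<alpha>\<^sub>p \<in> {0<..<1}" "\<alpha>\<^sub>m \<in> {0<..<1}"
    and "lam\<^sub>p > 0" "lam\<^sub>m > 0"
    and "\<delta>\<^sub>p \<ge> 0" "\<delta>\<^sub>m \<ge> 0" "(\<delta>\<^sub>p, \<delta>\<^sub>m) \<noteq> (0, 0)"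
    and "\<gamma>\<^sub>p \<in> {0..<2}" "\<gamma>\<^sub>m \<in> {0..<2}" "\<gamma>\<^sub>p \<noteq> 1" "\<gamma>\<^sub>m \<noteq> 1"
    and "prob_space M" and "X \<in> borel_measurable M"
    and "GTGS0_law \<gamma>\<^sub>p \<gamma>\<^sub>m \<alpha>\<^sub>p \<alpha>\<^sub>m lam\<^sub>p lam\<^sub>m \<delta>\<^sub>p \<delta>\<^sub>m \<mu> (distr M borel X)"
    and "m = gtgs_density \<gamma>\<^sub>p \<gamma>\<^sub>m \<alpha>\<^sub>p \<alpha>\<^sub>m lam\<^sub>p lam\<^sub>m \<delta>\<^sub>p \<delta>\<^sub>m"
    and "\<psi> = levy_exponent \<mu> m"
    and "\<mu>0 = (LINT x:{x. \<bar>x\<bar> < 1}|lborel. x * m x)"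
    and "\<mu>1 = (LINT x:{x. \<bar>x\<bar> > 1}|lborel. x * m x)"
  shows
    "(\<gamma>\<^sub>p = 0 \<and> \<gamma>\<^sub>m = 0 \<longrightarrow>
        (\<forall>z. \<psi> z = term_log 1 \<alpha>\<^sub>p lam\<^sub>p \<delta>\<^sub>p z + term_log (-1) \<alpha>\<^sub>m lam\<^sub>m \<delta>\<^sub>m z
                 + \<i> * of_real z * of_real (\<mu> - \<mu>0)) \<and>
        eq_with_limit_at_0 \<psi>
          (\<lambda>z. term_log 1 \<alpha>\<^sub>p lam\<^sub>p \<delta>\<^sub>p z + term_log (-1) \<alpha>\<^sub>m lam\<^sub>m \<delta>\<^sub>m z
             + \<i> * of_real z * of_real (\<mu> - \<mu>0))) \<and>
     (max (\<alpha>\<^sub>p + \<gamma>\<^sub>p) (\<alpha>\<^sub>m + \<gamma>\<^sub>m) \<in> {0<..<1} \<and> low_defined \<gamma>\<^sub>p \<alpha>\<^sub>p \<and> low_defined \<gamma>\<^sub>m \<alpha>\<^sub>m \<longrightarrow>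
        eq_with_limit_at_0 \<psi>
          (\<lambda>z. term_low 1 \<gamma>\<^sub>p \<alpha>\<^sub>p lam\<^sub>p \<delta>\<^sub>p z + term_low (-1) \<gamma>\<^sub>m \<alpha>\<^sub>m lam\<^sub>m \<delta>\<^sub>m z
             + \<i> * of_real z * of_real (\<mu> - \<mu>0))) \<and>
     (min (\<alpha>\<^sub>p + \<gamma>\<^sub>p) (\<alpha>\<^sub>m + \<gamma>\<^sub>m) \<in> {1..<3} \<and> high_defined \<gamma>\<^sub>p \<alpha>\<^sub>p \<and> high_defined \<gamma>\<^sub>m \<alpha>\<^sub>m \<longrightarrow>
        eq_with_limit_at_0 \<psi>
          (\<lambda>z. term_high 1 \<gamma>\<^sub>p \<alpha>\<^sub>p lam\<^sub>p \<delta>\<^sub>p z + term_high (-1) \<gamma>\<^sub>m \<alpha>\<^sub>m lam\<^sub>m \<delta>\<^sub>m z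
             + \<i> * of_real z * of_real (\<mu> + \<mu>1))) \<and>
     (half_line_defined \<gamma>\<^sub>p \<alpha>\<^sub>p \<and> half_line_defined \<gamma>\<^sub>m \<alpha>\<^sub>m \<longrightarrow>
        eq_with_limit_at_0 \<psi>
          (\<lambda>z. \<i> * of_real z * of_real \<mu>
             + half_line_part 1 m \<gamma>\<^sub>p \<alpha>\<^sub>p lam\<^sub>p \<delta>\<^sub>p z
             + half_line_part (-1) m \<gamma>\<^sub>m \<alpha>\<^sub>m lam\<^sub>m \<delta>\<^sub>m z))"
proof -
  interpret two_sided \<alpha>\<^sub>p lam\<^sub>p \<alpha>\<^sub>m lam\<^sub>m \<gamma>\<^sub>p \<gamma>\<^sub>m \<delta>\<^sub>p \<delta>\<^sub>m
    using assms(1-11) by unfold_locales auto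
  note \<psi> = \<open>\<psi> = levy_exponent \<mu> m\<close> \<open>m = gtgs_density \<gamma>\<^sub>p \<gamma>\<^sub>m \<alpha>\<^sub>p \<alpha>\<^sub>m lam\<^sub>p lam\<^sub>m \<delta>\<^sub>p \<delta>\<^sub>m\<close>
    \<open>\<mu>0 = (LINT x:{x. \<bar>x\<bar> < 1}|lborel. x * m x)\<close> \<open>\<mu>1 = (LINT x:{x. \<bar>x\<bar> > 1}|lborel. x * m x)\<close>
  show ?thesis
    unfolding \<psi>
    by (intro conjI impI allI eq_with_limit_at_0_levy_exponent levy_exponent_log levy_exponent_low
          levy_exponent_high levy_exponent_eq_half_line_parts) auto
qed

end
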